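(* Let $\sigma=\{\sigma_i\mid i\in I\}$ be a partition of the set of all primes, let $G$ be a finite $\sigma$-soluble group and let $D=G^{\mathfrak{N}_\sigma}$. Suppose that $G$ has a generalized Wielandt $\sigma$-set. Then $G$ is a $P\sigma T$-group if and only if the following conditions hold: (i) $D$ is an abelian Hall subgroup of $G$ of odd order and every element of $G$ induces a power automorphism in $D$; (ii) $G/O^{\sigma_i}(D)$ is a special $P\sigma T$-group for each $\sigma_i\in\sigma(D)$.
   Context: All groups are finite. $\sigma=\{\sigma_i\mid i\in I\}$ is a partition of the set $\mathbb{P}$ of primes. For $n\in\mathbb{N}$, $\sigma(n)=\{\sigma_i\mid \sigma_i\cap\pi(n)\ne\emptyset\}$ with $\pi(n)$ the primes dividing $n$; $\sigma(G)=\sigma(|G|)$, $\pi(G)=\pi(|G|)$. A group is $\sigma$-primary if $|\sigma(G)|\le1$, a $\sigma_i$-group if all prime divisors of its order lie in $\sigma_i$, $\sigma$-nilpotent if it is a direct product of $\sigma$-primary groups, and $\sigma$-soluble if every chief factor is $\sigma$-primary. $O^{\sigma_i}(D)$ denotes the smallest normal subgroup of $D$ whose quotient is a $\sigma_i$-group. A Hall $\sigma_i$-subgroup of $G$ is a subgroup whose order has all prime divisors in $\sigma_i$ and whose index has none in $\sigma_i$. $G^{\mathfrak{N}_\sigma}$ (the $\sigma$-nilpotent residual) is the intersection of all normal subgroups $N$ of $G$ with $G/N$ $\sigma$-nilpotent. A power automorphism of $D$ is an automorphism mapping every subgroup of $D$ onto itself; an element of $G$ induces a power automorphism in a normal subgroup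 $D$ if conjugation by it is a power automorphism of $D$. A complete Hall $\sigma$-set of $G$ is a set $\mathcal{H}$ of subgroups such that every nontrivial member is a Hall $\sigma_i$-subgroup for some $i$ and $\mathcal{H}$ contains exactly one Hall $\sigma_i$-subgroup of $G$ for each $\sigma_i\in\sigma(G)$. For a set of primes $\pi$, a group is $\pi$-supersoluble if each of its chief factors is either cyclic of prime order in $\pi$ or a $\pi'$-group. A complete Hall $\sigma$-set $\mathcal{H}$ of $G$ is a generalized Wielandt $\sigma$-set if every member of $\mathcal{H}$ is $\pi(G^{\mathfrak{N}_\sigma})$-supersoluble. $G$ is a special $P\sigma T$-group if $D_0=G^{\mathfrak{N}_\sigma}$ is contained in a Hall $\sigma_i$-subgroup $E$ of $G$ for some $i$ and: (a) $D_0$ is a Hall subgroup of $G$ and every element of $G$ induces a power automorphism in $D_0$; (b) $D_0$ has a normal complement $S$ in $E$. A subgroup $A$ is $\sigma$-quasinormal in $G$ if $G$ has a complete Hall $\sigma$-set $\mathcal{H}$ with $AH^x=H^xA$ for all $H\in\mathcal{H}$, $x\in G$. $G$ is a $P\sigma T$-group if whenever $K$ is $\sigma$-quasinormal in $H$ and $H$ is $\sigma$-quasinormal in $G$, then $K$ is $\sigma$-quasinormal in $G$. *)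

theory Defs
  imports "HOL-Algebra.Algebra" "HOL-Computational_Algebra.Primes"
begin

definition sigma_partition :: "nat set set \<Rightarrow> bool" where
  "sigma_partition \<sigma> \<longleftrightarrow>
     (\<forall>s\<in>\<sigma>. s \<noteq> {}) \<and> (\<forall>s\<in>\<sigma>. \<forall>t\<in>\<sigma>. s \<noteq> t \<longrightarrow> s \<inter> t = {}) \<and> \<Union>\<sigma> = {p::nat. Factorial_Ring.prime p}"

definition sigma_of :: "nat set set \<Rightarrow> nat \<Rightarrow> nat set set" where
  "sigma_of \<sigma> n = {s\<in>\<sigma>. s \<inter> prime_factors n \<noteq> {}}"

definition sigma_primary :: "nat set set \<Rightarrow> ('a, 'b) monoid_scheme \<Rightarrow> bool" where
  "sigma_primary \<sigma> G \<longleftrightarrow> card (sigma_of \<sigma> (order G)) \<le> 1"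

definition chief_factor :: "('a, 'b) monoid_scheme \<Rightarrow> 'a set \<Rightarrow> 'a set \<Rightarrow> bool" where
  "chief_factor G H K \<longleftrightarrow> normal K G \<and> normal H G \<and> K \<subset> H \<and>
     (\<forall>N. normal N G \<and> K \<subseteq> N \<and> N \<subseteq> H \<longrightarrow> N = K \<or> N = H)"

definition sigma_soluble :: "nat set set \<Rightarrow> ('a, 'b) monoid_scheme \<Rightarrow> bool" where
  "sigma_soluble \<sigma> G \<longleftrightarrow>
     (\<forall>H K. chief_factor G H K \<longrightarrow> sigma_primary \<sigma> ((G\<lparr>carrier := H\<rparr>) Mod K))"

definition sigma_nilpotent :: "nat set set \<Rightarrow> ('a, 'b) monoid_scheme \<Rightarrow> bool" where
  "sigma_nilpotent \<sigma> G \<longleftrightarrow>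
     (\<exists>\<H>. finite \<H> \<and> (\<forall>H\<in>\<H>. subgroup H G \<and> sigma_primary \<sigma> (G\<lparr>carrier := H\<rparr>)) \<and>
          G \<cong> product_group \<H> (\<lambda>H. G\<lparr>carrier := H\<rparr>))"

definition sigma_nilp_residual :: "nat set set \<Rightarrow> ('a, 'b) monoid_scheme \<Rightarrow> 'a set" where
  "sigma_nilp_residual \<sigma> G = \<Inter>{N. normal N G \<and> sigma_nilpotent \<sigma> (G Mod N)}"

definition O_upper :: "nat set \<Rightarrow> ('a, 'b) monoid_scheme \<Rightarrow> 'a set \<Rightarrow> 'a set" where
  "O_upper s G D = \<Inter>{N. normal N (G\<lparr>carrier := D\<rparr>) \<and>
                          prime_factors (order ((G\<lparr>carrier := D\<rparr>) Mod N)) \<subseteq> s}"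

definition hall_sigma_subgroup :: "nat set \<Rightarrow> ('a, 'b) monoid_scheme \<Rightarrow> 'a set \<Rightarrow> bool" where
  "hall_sigma_subgroup s G H \<longleftrightarrow> subgroup H G \<and> prime_factors (card H) \<subseteq> s \<and>
     prime_factors (order G div card H) \<inter> s = {}"

definition hall_subgroup :: "('a, 'b) monoid_scheme \<Rightarrow> 'a set \<Rightarrow> bool" where
  "hall_subgroup G H \<longleftrightarrow> subgroup H G \<and> coprime (card H) (order G div card H)"

definition complete_hall_sigma_set :: "nat set set \<Rightarrow> ('a, 'b) monoid_scheme \<Rightarrow> 'a set set \<Rightarrow> bool" where
  "complete_hall_sigma_set \<sigma> G \<H> \<longleftrightarrow>
     (\<forall>H\<in>\<H>. subgroup H G) \<and>
     (\<forall>H\<in>\<H>. H \<noteq> {\<one>\<^bsub>G\<^esub>} \<longrightarrow> (\<exists>s\<in>\<sigma>. hall_sigma_subgroup s G H)) \<and>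
     (\<forall>s\<in>sigma_of \<sigma> (order G). \<exists>!H. H \<in> \<H> \<and> hall_sigma_subgroup s G H)"

definition pi_supersoluble :: "nat set \<Rightarrow> ('a, 'b) monoid_scheme \<Rightarrow> bool" where
  "pi_supersoluble \<pi> G \<longleftrightarrow>
     (\<forall>H K. chief_factor G H K \<longrightarrow>
        (cyclic_group ((G\<lparr>carrier := H\<rparr>) Mod K) \<and> Factorial_Ring.prime (order ((G\<lparr>carrier := H\<rparr>) Mod K)) \<and>
           order ((G\<lparr>carrier := H\<rparr>) Mod K) \<in> \<pi>) \<or>
        prime_factors (order ((G\<lparr>carrier := H\<rparr>) Mod K)) \<inter> \<pi> = {})"

definition generalized_wielandt_sigma_set :: "nat set set \<Rightarrow> ('a, 'b) monoid_scheme \<Rightarrow> 'a set set \<Rightarrow> bool" where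
  "generalized_wielandt_sigma_set \<sigma> G \<H> \<longleftrightarrow> complete_hall_sigma_set \<sigma> G \<H> \<and>
     (\<forall>H\<in>\<H>. pi_supersoluble (prime_factors (card (sigma_nilp_residual \<sigma> G))) (G\<lparr>carrier := H\<rparr>))"

definition induces_power_aut :: "('a, 'b) monoid_scheme \<Rightarrow> 'a \<Rightarrow> 'a set \<Rightarrow> bool" where
  "induces_power_aut G g D \<longleftrightarrow>
     (\<forall>K. subgroup K G \<and> K \<subseteq> D \<longrightarrow> (\<lambda>x. inv\<^bsub>G\<^esub> g \<otimes>\<^bsub>G\<^esub> x \<otimes>\<^bsub>G\<^esub> g) ` K = K)"

definition special_PsigmaT_group :: "nat set set \<Rightarrow> ('a, 'b) monoid_scheme \<Rightarrow> bool" where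
  "special_PsigmaT_group \<sigma> G \<longleftrightarrow>
     (\<exists>s\<in>\<sigma>. \<exists>E. hall_sigma_subgroup s G E \<and> sigma_nilp_residual \<sigma> G \<subseteq> E \<and>
        hall_subgroup G (sigma_nilp_residual \<sigma> G) \<and>
        (\<forall>g\<in>carrier G. induces_power_aut G g (sigma_nilp_residual \<sigma> G)) \<and>
        (\<exists>S. normal S (G\<lparr>carrier := E\<rparr>) \<and> sigma_nilp_residual \<sigma> G \<inter> S = {\<one>\<^bsub>G\<^esub>} \<and>
             set_mult G (sigma_nilp_residual \<sigma> G) S = E))"

definition conj_set :: "('a, 'b) monoid_scheme \<Rightarrow> 'a set \<Rightarrow> 'a \<Rightarrow> 'a set" where
  "conj_set G H x = r_coset G (l_coset G (inv\<^bsub>G\<^esub> x) H) x"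

definition sigma_quasinormal :: "nat set set \<Rightarrow> ('a, 'b) monoid_scheme \<Rightarrow> 'a set \<Rightarrow> bool" where
  "sigma_quasinormal \<sigma> G A \<longleftrightarrow> subgroup A G \<and>
     (\<exists>\<H>. complete_hall_sigma_set \<sigma> G \<H> \<and>
        (\<forall>H\<in>\<H>. \<forall>x\<in>carrier G. set_mult G A (conj_set G H x) = set_mult G (conj_set G H x) A))"

definition PsigmaT_group :: "nat set set \<Rightarrow> ('a, 'b) monoid_scheme \<Rightarrow> bool" where
  "PsigmaT_group \<sigma> G \<longleftrightarrow>
     (\<forall>H K. sigma_quasinormal \<sigma> (G\<lparr>carrier := H\<rparr>) K \<and> sigma_quasinormal \<sigma> G H \<longrightarrow>
            sigma_quasinormal \<sigma> G K)"

end

theory Submission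
  imports Defs "HOL-Number_Theory.Cong"
begin


text \<open>
  Let \<open>D\<close> be the \<open>\<sigma>\<close>-nilpotent residual. Once Hall subgroups exist, \<open>D\<close> is generated by the
  commutators \<open>[x, y]\<close> of an \<open>s\<close>-element \<open>x\<close> with an element \<open>y\<close> of order prime to \<open>s\<close>, for \<open>s \<in> \<sigma>\<close>.
  Working with such elements avoids conjugacy of Hall subgroups throughout.

  Sufficiency: a \<open>\<sigma>\<close>-quasinormal subgroup \<open>A\<close> contains \<open>[a, y]\<close> for every \<open>s\<close>-element \<open>a \<in> A\<close> of order
  prime to \<open>|D|\<close> and every \<open>y\<close> of order prime to \<open>s\<close>. Conversely this property makes \<open>A\<close> permute with
  all Hall subgroups, and it is transitive because \<open>a\<close> acts coprimely on \<open>[a, y]\<close>.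

  Necessity: if \<open>K \<le> M\<close> are normal in \<open>G\<close> and \<open>M / K\<close> is an \<open>s\<close>-group, every subgroup \<open>V\<close> between them is
  \<open>\<sigma>\<close>-quasinormal in \<open>M\<close>, hence in \<open>G\<close>, and is therefore normalised by the elements of order prime to
  \<open>s\<close>. These act on \<open>M / K\<close> as coprime power automorphisms, which move only central elements and
  have the same exponent on conjugate elements. So \<open>D\<close> centralises every normal \<open>s\<close>-subgroup,
  and \<open>\<sigma>\<close>-solubility makes \<open>D\<close> abelian. In \<open>G / O\<^sup>s(D)\<close> the Hall \<open>s\<close>-subgroup is normal and is the direct
  product of its moved part, which is the image of \<open>D\<close>, and its fixed part, of coprime orders.
\<close>

section \<open>Elements of \<open>\<pi>\<close>-order\<close>

hide_const (open) Divisibility.prime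

text \<open>The Hall set witnessing \<sigma>-quasinormality varies with the subgroup, so two such
  subgroups share no Hall subgroup to argue with. The part of x for a set T of primes is a power x^k
  with one k for the whole group, so it stays in every subgroup containing x and is carried along by
  homomorphisms; a subgroup contains x as soon as it contains those powers of x that have prime
  power order. Whether a subgroup is all of G is decided by its index, one prime at a time, through
  Sylow's theorem. A recurring argument: if a and b commute modulo a normal subgroup N and N
  contains (ab)^n and a^n, then b^n lies in N, and so does b if its order is prime to n. It is used
  with b = [a, y], where ab is the conjugate a^y and has the order of a. In the converse direction
  the P\<sigma>T property is applied in G alone, to preimages of subgroups of quotients, so that it
  never has to be inherited by quotients.\<close>

lemma sigma_partition_disjoint:
  "sigma_partition \<sigma> \<Longrightarrow> s \<in> \<sigma> \<Longrightarrow> t \<in> \<sigma> \<Longrightarrow> p \<in> s \<Longrightarrow> p \<in> t \<Longrightarrow> s = t"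
  unfolding sigma_partition_def by blast

lemma sigma_partition_cover:
  "sigma_partition \<sigma> \<Longrightarrow> prime p \<Longrightarrow> \<exists>s\<in>\<sigma>. p \<in> s"
  unfolding sigma_partition_def by blast

lemma sigma_of_iff: "s \<in> sigma_of \<sigma> n \<longleftrightarrow> s \<in> \<sigma> \<and> (\<exists>p\<in>prime_factors n. p \<in> s)"
  unfolding sigma_of_def by auto

text \<open>\<open>sigma_primary\<close> compares a \<open>card\<close> with 1, and an infinite set
  has \<open>card\<close> 0, so finiteness is what makes that test meaningful. A prime determines
  its class, hence there are at most as many classes as prime factors.\<close>

lemma finite_sigma_of:
  assumes "sigma_partition \<sigma>"
  shows "finite (sigma_of \<sigma> n)"
proof -
  have "sigma_of \<sigma> n \<subseteq> (\<lambda>p. THE s. s \<in> \<sigma> \<and> p \<in> s) ` prime_factors n"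
  proof
    fix s assume "s \<in> sigma_of \<sigma> n"
    then obtain p where p: "s \<in> \<sigma>" "p \<in> prime_factors n" "p \<in> s" by (auto simp: sigma_of_iff)
    then have "(THE s. s \<in> \<sigma> \<and> p \<in> s) = s"
      using sigma_partition_disjoint[OF assms] by (intro the_equality) auto
    with p show "s \<in> (\<lambda>p. THE s. s \<in> \<sigma> \<and> p \<in> s) ` prime_factors n" by blast
  qed
  then show ?thesis using finite_surj by blast
qed

section \<open>Arithmetic of orders split along a set of primes\<close>

lemma coprime_if_prime_factors_disjoint:
  fixes m n :: nat
  assumes "0 < m" "0 < n" "prime_factors m \<subseteq> T" "prime_factors n \<subseteq> - T"
  shows "coprime m n"
proof (rule ccontr)
  assume "\<not> coprime m n"
  then have "gcd m n \<noteq> 1" by (simp add: coprime_iff_gcd_eq_1)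
  then obtain p where "prime p" "p dvd gcd m n" using prime_factor_nat by blast
  then show False using assms by (auto simp: prime_factors_dvd)
qed

lemma prime_factors_mono_dvd: "(m::nat) dvd n \<Longrightarrow> 0 < n \<Longrightarrow> prime_factors m \<subseteq> prime_factors n"
  by (auto simp: prime_factors_dvd intro: dvd_trans)

lemma index_dvd_index:
  fixes a b n :: nat
  assumes "a dvd b" "b dvd n" "0 < b"
  shows "n div b dvd n div a"
proof -
  obtain k where "b = a * k" using assms by (auto elim: dvdE)
  moreover obtain j where "n = b * j" using assms by (auto elim: dvdE)
  ultimately show ?thesis using assms(3) by (auto simp: mult.assoc)
qed

lemma prime_factors_mult_nat:
  "0 < (m::nat) \<Longrightarrow> 0 < n \<Longrightarrow> prime_factors (m * n) = prime_factors m \<union> prime_factors n"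
  by (simp add: prime_factors_product)

text \<open>\<open>a\<close> is the largest divisor of \<open>n\<close> with all its primes in
  \<open>T\<close>; a prime of \<open>T\<close> in the cofactor could be moved into \<open>a\<close>
  and would enlarge it.\<close>

lemma ex_part_factorization:
  fixes n :: nat
  assumes "0 < n"
  obtains a b where "n = a * b" "prime_factors a \<subseteq> T" "prime_factors b \<subseteq> - T" "0 < a" "0 < b" "coprime a b"
proof -
  let ?A = "{d. d dvd n \<and> prime_factors d \<subseteq> T}"
  have fin: "finite ?A" using assms by (auto intro: finite_subset[OF _ finite_divisors_nat])
  have ne: "1 \<in> ?A" by simp
  define a where "a = Max ?A"
  have a: "a \<in> ?A" unfolding a_def using fin ne by (intro Max_in) auto
  then obtain b where b: "n = a * b" by auto
  have pos: "0 < a" "0 < b" using b assms by auto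
  have "prime_factors b \<subseteq> - T"
  proof (rule ccontr)
    assume "\<not> ?thesis"
    then obtain p where p: "p \<in> prime_factors b" "p \<in> T" by auto
    have "a * p dvd n" using p b by (auto simp: prime_factors_dvd)
    moreover have "prime_factors (a * p) \<subseteq> T"
    proof -
      have "prime_factors p = {p}" "0 < p" using in_prime_factors_imp_prime[OF p(1)]
        by (auto simp: prime_prime_factors prime_gt_0_nat)
      then show ?thesis using p a pos prime_factors_mult_nat[of a p] by auto
    qed
    ultimately have "a * p \<le> a" unfolding a_def using fin by (intro Max_ge) auto
    then show False using p pos prime_gt_1_nat[of p] by (auto simp: prime_factors_dvd)
  qed
  with that a b pos coprime_if_prime_factors_disjoint[of a b T] show ?thesis by auto
qed

text \<open>Some annihilating exponent is demanded instead of a condition on \<open>ord\<close>, so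
  that the notion passes at once to powers, conjugates and homomorphic images;
  \<open>pi_elt_iff_ord\<close> gives the link to the order in finite groups.\<close>

definition pi_elt :: "('a, 'b) monoid_scheme \<Rightarrow> nat set \<Rightarrow> 'a \<Rightarrow> bool" where
  "pi_elt G T x \<longleftrightarrow> x \<in> carrier G \<and> (\<exists>n>0. prime_factors n \<subseteq> T \<and> x [^]\<^bsub>G\<^esub> (n::nat) = \<one>\<^bsub>G\<^esub>)"

definition cj :: "('a, 'b) monoid_scheme \<Rightarrow> 'a \<Rightarrow> 'a \<Rightarrow> 'a" where
  "cj G x y = inv\<^bsub>G\<^esub> y \<otimes>\<^bsub>G\<^esub> x \<otimes>\<^bsub>G\<^esub> y"

lemma pi_elt_carrier: "pi_elt G T x \<Longrightarrow> x \<in> carrier G"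
  by (simp add: pi_elt_def)

lemma pi_elt_mono: "pi_elt G T x \<Longrightarrow> T \<subseteq> U \<Longrightarrow> pi_elt G U x"
  unfolding pi_elt_def by blast

lemma (in group) pi_elt_subgroup:
  "subgroup H G \<Longrightarrow> pi_elt (G\<lparr>carrier := H\<rparr>) T x \<longleftrightarrow> pi_elt G T x \<and> x \<in> H"
  unfolding pi_elt_def using subgroup.subset by (auto simp flip: nat_pow_consistent)

lemma (in group) cj_subgroup:
  "subgroup H G \<Longrightarrow> y \<in> H \<Longrightarrow> cj (G\<lparr>carrier := H\<rparr>) x y = cj G x y"
  unfolding cj_def by simp

lemma (in group_hom) pi_elt_hom: "pi_elt G T x \<Longrightarrow> pi_elt H T (h x)"
  unfolding pi_elt_def by (metis hom_closed hom_nat_pow hom_one)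

lemma (in group_hom) cj_hom: "x \<in> carrier G \<Longrightarrow> y \<in> carrier G \<Longrightarrow> h (cj G x y) = cj H (h x) (h y)"
  unfolding cj_def by simp

context group
begin

lemma inv_m_cancel: "x \<in> carrier G \<Longrightarrow> y \<in> carrier G \<Longrightarrow> inv x \<otimes> (x \<otimes> y) = y"
  by (simp flip: m_assoc)

lemma m_inv_cancel: "x \<in> carrier G \<Longrightarrow> y \<in> carrier G \<Longrightarrow> x \<otimes> (inv x \<otimes> y) = y"
  by (simp flip: m_assoc)

lemmas word_simps = m_assoc inv_mult_group inv_m_cancel m_inv_cancel

lemma cj_closed [simp]: "x \<in> carrier G \<Longrightarrow> y \<in> carrier G \<Longrightarrow> cj G x y \<in> carrier G"
  by (simp add: cj_def)

lemma cj_one [simp]: "y \<in> carrier G \<Longrightarrow> cj G \<one> y = \<one>"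
  by (simp add: cj_def)

lemma cj_one_right [simp]: "x \<in> carrier G \<Longrightarrow> cj G x \<one> = x"
  by (simp add: cj_def)

lemma cj_mult: "x \<in> carrier G \<Longrightarrow> z \<in> carrier G \<Longrightarrow> y \<in> carrier G \<Longrightarrow> cj G (x \<otimes> z) y = cj G x y \<otimes> cj G z y"
  by (simp add: cj_def word_simps)

lemma cj_inv: "x \<in> carrier G \<Longrightarrow> y \<in> carrier G \<Longrightarrow> cj G (inv x) y = inv (cj G x y)"
  by (simp add: cj_def word_simps)

lemma cj_cj: "x \<in> carrier G \<Longrightarrow> z \<in> carrier G \<Longrightarrow> y \<in> carrier G \<Longrightarrow> cj G (cj G x y) z = cj G x (y \<otimes> z)"
  by (simp add: cj_def word_simps)

lemma cj_pow: "x \<in> carrier G \<Longrightarrow> y \<in> carrier G \<Longrightarrow> cj G (x [^] (n::nat)) y = cj G x y [^] n"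
  by (induction n) (simp_all add: cj_mult)

lemma cj_eq_iff_commute: "x \<in> carrier G \<Longrightarrow> y \<in> carrier G \<Longrightarrow> cj G x y = x \<longleftrightarrow> x \<otimes> y = y \<otimes> x"
  unfolding cj_def by (metis inv_solve_left m_assoc m_closed inv_closed)

lemma cj_inj: "x \<in> carrier G \<Longrightarrow> z \<in> carrier G \<Longrightarrow> y \<in> carrier G \<Longrightarrow> cj G x y = cj G z y \<longleftrightarrow> x = z"
  unfolding cj_def by (simp add: m_assoc)

lemma cj_inv_cancel [simp]: "x \<in> carrier G \<Longrightarrow> y \<in> carrier G \<Longrightarrow> cj G (cj G x y) (inv y) = x"
    "x \<in> carrier G \<Longrightarrow> y \<in> carrier G \<Longrightarrow> cj G (cj G x (inv y)) y = x"
  by (simp_all add: cj_cj)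

lemma normal_iff_cj:
  "N \<lhd> G \<longleftrightarrow> subgroup N G \<and> (\<forall>x\<in>carrier G. \<forall>h\<in>N. cj G h x \<in> N)"
proof
  assume "N \<lhd> G" then show "subgroup N G \<and> (\<forall>x\<in>carrier G. \<forall>h\<in>N. cj G h x \<in> N)"
    by (simp add: normal_imp_subgroup normal.inv_op_closed1 cj_def)
next
  assume R: "subgroup N G \<and> (\<forall>x\<in>carrier G. \<forall>h\<in>N. cj G h x \<in> N)"
  show "N \<lhd> G"
  proof (rule normal_invI)
    fix x h assume "x \<in> carrier G" "h \<in> N"
    then have "cj G h (inv x) \<in> N" using R by blast
    then show "x \<otimes> h \<otimes> inv x \<in> N" using \<open>x \<in> carrier G\<close> by (simp add: cj_def)
  qed (use R in blast)
qed

lemma subgroup_pow_closed: "subgroup H G \<Longrightarrow> x \<in> H \<Longrightarrow> x [^] (n::nat) \<in> H"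
  by (metis int_pow_int subgroup_int_pow_closed)

lemma subgroup_pow_coprime:
  assumes "subgroup H G" "x \<in> carrier G" "x [^] (m::nat) \<in> H" "x [^] (n::nat) \<in> H" "coprime m n"
  shows "x \<in> H"
proof -
  obtain a b where ab: "a * int m + b * int n = 1"
    using assms(5) by (metis coprime_imp_gcd_eq_1 bezout_int coprime_int_iff)
  have "x = x [^] (int m * a + int n * b)" using ab assms(2) by (simp add: mult.commute)
  also have "\<dots> = (x [^] int m) [^] a \<otimes> (x [^] int n) [^] b"
    using assms(2) by (simp add: int_pow_mult int_pow_pow)
  also have "\<dots> \<in> H" using assms subgroup_int_pow_closed by (simp add: int_pow_int subgroup.m_closed)
  finally show ?thesis .
qed

lemma pi_elt_pow: "pi_elt G T x \<Longrightarrow> pi_elt G T (x [^] (k::nat))"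
  unfolding pi_elt_def by (metis nat_pow_closed nat_pow_one nat_pow_pow mult.commute)

lemma pi_elt_one [simp]: "pi_elt G T \<one>"
  unfolding pi_elt_def by (auto intro!: exI[of _ 1])

lemma pi_elt_cj: "pi_elt G T x \<Longrightarrow> y \<in> carrier G \<Longrightarrow> pi_elt G T (cj G x y)"
  unfolding pi_elt_def by (metis cj_closed cj_one cj_pow)

lemma pi_elt_inv: "pi_elt G T x \<Longrightarrow> pi_elt G T (inv x)"
  unfolding pi_elt_def by (metis inv_closed inv_one nat_pow_inv)

lemma pi_elt_mult_commute:
  assumes "pi_elt G T x" "pi_elt G T y" "x \<otimes> y = y \<otimes> x"
  shows "pi_elt G T (x \<otimes> y)"
proof -
  from assms obtain m n where mn: "0 < m" "0 < n" "prime_factors m \<subseteq> T" "prime_factors n \<subseteq> T"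
    "x [^] (m::nat) = \<one>" "y [^] (n::nat) = \<one>" "x \<in> carrier G" "y \<in> carrier G"
    unfolding pi_elt_def by blast
  have "(x \<otimes> y) [^] (m * n) = x [^] (m * n) \<otimes> y [^] (n * m)"
    by (simp only: pow_mult_distrib[OF assms(3) mn(7,8)] mult.commute)
  also have "\<dots> = \<one>" using mn by (simp flip: nat_pow_pow)
  finally show ?thesis
    unfolding pi_elt_def using mn by (intro conjI exI[of _ "m * n"]) (auto simp: prime_factors_mult_nat)
qed

lemma pi_elt_Int:
  assumes "pi_elt G T x" "pi_elt G U x"
  shows "pi_elt G (T \<inter> U) x"
proof -
  from assms obtain m n where mn: "0 < m" "0 < n" "prime_factors m \<subseteq> T" "prime_factors n \<subseteq> U"
    "x [^] (m::nat) = \<one>" "x [^] (n::nat) = \<one>" "x \<in> carrier G"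
    unfolding pi_elt_def by blast
  have "x [^] gcd m n = \<one>" using mn by (simp add: pow_eq_id)
  moreover have "prime_factors (gcd m n) \<subseteq> T \<inter> U" using mn by (auto simp: prime_factors_dvd)
  ultimately show ?thesis unfolding pi_elt_def using mn by (intro conjI exI[of _ "gcd m n"]) auto
qed

lemma pi_elt_disjoint:
  assumes "pi_elt G T x" "pi_elt G U x" "T \<inter> U = {}"
  shows "x = \<one>"
proof -
  obtain n where n: "0 < n" "prime_factors n \<subseteq> {}" "x [^] (n::nat) = \<one>" "x \<in> carrier G"
    using pi_elt_Int[OF assms(1,2)] assms(3) unfolding pi_elt_def by auto
  have "n = 1"
  proof (rule ccontr)
    assume "n \<noteq> 1"
    then obtain p where "prime p" "p dvd n" using prime_factor_nat by blast
    then show False using n by (auto simp: prime_factors_dvd)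
  qed
  with n show ?thesis by simp
qed

text \<open>The order of \<open>x\<close> is prime to \<open>n\<close>, so \<open>x\<close> is a
  power of \<open>x [^] n\<close>. Arguments by coprime action end with this step.\<close>

lemma pi_elt_pow_mem:
  assumes "subgroup H G" "pi_elt G T x" "x [^] (n::nat) \<in> H" "0 < n" "prime_factors n \<subseteq> - T"
  shows "x \<in> H"
proof -
  obtain m where m: "0 < m" "prime_factors m \<subseteq> T" "x [^] (m::nat) = \<one>" "x \<in> carrier G"
    using assms(2) unfolding pi_elt_def by auto
  have "coprime m n" using coprime_if_prime_factors_disjoint m assms by blast
  then show ?thesis using subgroup_pow_coprime[OF assms(1), of x m n] m assms by (simp add: subgroup.one_closed)
qed

end

section \<open>Finite groups: parts of elements, indices and orders of products\<close>

locale fin_group = group +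
  assumes fin: "finite (carrier G)"
begin

lemma order_pos: "0 < order G"
  using fin order_gt_0_iff_finite by blast

lemma finite_subgroup: "subgroup H G \<Longrightarrow> finite H"
  using fin subgroup.subset finite_subset by blast

lemma card_subgroup_pos: "subgroup H G \<Longrightarrow> 0 < card H"
  using finite_subgroup subgroup.one_closed card_gt_0_iff by blast

lemma card_subgroup_dvd: "subgroup H G \<Longrightarrow> card H dvd order G"
  by (metis lagrange dvd_triv_right)

lemma order_eq_index: "subgroup H G \<Longrightarrow> order G = (order G div card H) * card H"
  by (simp add: card_subgroup_dvd)

lemma index_pos: "subgroup H G \<Longrightarrow> 0 < order G div card H"
  by (simp add: card_subgroup_dvd card_subgroup_pos dvd_imp_le order_pos div_greater_zero_iff)

lemma fin_group_subgroup: "subgroup H G \<Longrightarrow> fin_group (G\<lparr>carrier := H\<rparr>)"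
  by (simp add: fin_group_def fin_group_axioms_def subgroup_imp_group finite_subgroup)

lemma pow_card_subgroup: "subgroup H G \<Longrightarrow> x \<in> H \<Longrightarrow> x [^] card H = \<one>"
  using group.pow_order_eq_1[of "G\<lparr>carrier := H\<rparr>" x]
  by (simp add: subgroup_imp_group order_def flip: nat_pow_consistent)

lemma pi_elt_mem_subgroup:
  "subgroup H G \<Longrightarrow> prime_factors (card H) \<subseteq> T \<Longrightarrow> x \<in> H \<Longrightarrow> pi_elt G T x"
  unfolding pi_elt_def
  by (intro conjI exI[of _ "card H"]) (simp_all add: pow_card_subgroup card_subgroup_pos subgroup.mem_carrier)

lemma pow_cong: "x \<in> carrier G \<Longrightarrow> [m = n] (mod order G) \<Longrightarrow> x [^] (m::nat) = x [^] n"
proof -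
  assume x: "x \<in> carrier G" and "[m = n] (mod order G)"
  have *: "x [^] k = x [^] (k mod order G)" for k :: nat
  proof -
    have "x [^] k = x [^] (order G * (k div order G) + k mod order G)" by simp
    also have "\<dots> = x [^] (k mod order G)"
      using x by (simp only: flip: nat_pow_mult nat_pow_pow) (simp add: pow_order_eq_1)
    finally show ?thesis .
  qed
  show ?thesis using *[of m] *[of n] \<open>[m = n] (mod order G)\<close> by (simp add: cong_def)
qed

text \<open>By the Chinese remainder theorem \<open>k\<close> is 1 modulo the \<open>T\<close>-part
  of the group order and 0 modulo the rest, and \<open>l\<close> the reverse. Neither depends on
  \<open>x\<close>, so taking \<open>T\<close>-parts is a power map of the whole group.\<close>

lemma ex_part_exponent:
  obtains k l :: nat where
    "\<And>x. x \<in> carrier G \<Longrightarrow> x = x [^] k \<otimes> x [^] l"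
    "\<And>x. x \<in> carrier G \<Longrightarrow> pi_elt G T (x [^] k)"
    "\<And>x. x \<in> carrier G \<Longrightarrow> pi_elt G (- T) (x [^] l)"
    "\<And>x. pi_elt G T x \<Longrightarrow> x [^] k = x"
    "\<And>x. pi_elt G (- T) x \<Longrightarrow> x [^] k = \<one>"
proof -
  obtain a b where ab: "order G = a * b" "prime_factors a \<subseteq> T" "prime_factors b \<subseteq> - T"
      "0 < a" "0 < b" "coprime a b"
    using ex_part_factorization[OF order_pos] by metis
  obtain k where k: "[k = 1] (mod a)" "[k = 0] (mod b)"
    using binary_chinese_remainder_nat[OF ab(6)] by blast
  obtain l where l: "[l = 0] (mod a)" "[l = 1] (mod b)"
    using binary_chinese_remainder_nat[OF ab(6)] by blast
  have kl: "[k + l = 1] (mod order G)"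
    unfolding ab using ab(6) cong_add[OF k(1) l(1)] cong_add[OF k(2) l(2)]
    by (intro coprime_cong_mult_nat) auto
  have 1: "x = x [^] k \<otimes> x [^] l" if "x \<in> carrier G" for x
    using pow_cong[OF that kl] that by (simp add: nat_pow_mult)
  have dvd: "order G dvd k * a" "order G dvd l * b"
    using k(2) l(1) ab(1) by (auto simp: cong_0_iff mult.commute)
  have 2: "pi_elt G T (x [^] k)" if "x \<in> carrier G" for x
    unfolding pi_elt_def using that ab dvd
    by (intro conjI exI[of _ a])
       (auto simp: nat_pow_pow pow_eq_id intro: dvd_trans[OF ord_dvd_group_order])
  have 3: "pi_elt G (- T) (x [^] l)" if "x \<in> carrier G" for x
    unfolding pi_elt_def using that ab dvd
    by (intro conjI exI[of _ b])
       (auto simp: nat_pow_pow pow_eq_id intro: dvd_trans[OF ord_dvd_group_order])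
  have 4: "x [^] k = x" if "pi_elt G T x" for x
  proof -
    have x: "x \<in> carrier G" using that by (rule pi_elt_carrier)
    have "pi_elt G (- T) (x [^] l)" "pi_elt G T (x [^] l)" using 3 x pi_elt_pow that by auto
    then have "x [^] l = \<one>" using pi_elt_disjoint by blast
    then show ?thesis using 1[OF x] x by simp
  qed
  have 5: "x [^] k = \<one>" if "pi_elt G (- T) x" for x
    using 2[of x] pi_elt_pow[OF that, of k] pi_elt_disjoint pi_elt_carrier[OF that] by blast
  show ?thesis using that 1 2 3 4 5 by blast
qed

lemma pi_elt_order: "x \<in> carrier G \<Longrightarrow> pi_elt G (prime_factors (order G)) x"
  unfolding pi_elt_def using pow_order_eq_1 order_pos by blast

text \<open>Splitting off one prime at a time writes \<open>x\<close> as a product of powers of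
  itself. The hypothesis concerns powers of \<open>x\<close> only, so it can be verified inside any
  subgroup known to contain \<open>x\<close>.\<close>

lemma prime_parts_mem:
  assumes B: "subgroup B G" and x: "x \<in> carrier G"
    and parts: "\<And>p k. prime p \<Longrightarrow> pi_elt G {p} (x [^] (k::nat)) \<Longrightarrow> x [^] k \<in> B"
  shows "x \<in> B"
proof -
  \<comment> \<open>Generalised over \<open>x\<close> and over a finite set \<open>P\<close> of
    primes covering its order: the induction passes to the part of \<open>x\<close> prime to
    \<open>p\<close>, whose powers are again powers of \<open>x\<close>.\<close>
  have "finite P \<Longrightarrow> (\<And>p. p \<in> P \<Longrightarrow> prime p) \<Longrightarrow> x \<in> carrier G \<Longrightarrow> pi_elt G P x \<Longrightarrow>
     (\<And>p k. prime p \<Longrightarrow> pi_elt G {p} (x [^] (k::nat)) \<Longrightarrow> x [^] k \<in> B) \<Longrightarrow> x \<in> B" for P x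
  proof (induction P arbitrary: x rule: finite_induct)
    case empty
    then show ?case using pi_elt_disjoint[of "{}" x "{}"] subgroup.one_closed[OF B] by simp
  next
    case (insert p P)
    obtain k l :: nat where kl: "x = x [^] k \<otimes> x [^] l" "pi_elt G {p} (x [^] k)" "pi_elt G (- {p}) (x [^] l)"
      by (rule ex_part_exponent[of "{p}"]) (use insert.prems in blast)
    have "x [^] k \<in> B" using insert.prems kl by auto
    moreover have "x [^] l \<in> B"
    proof (rule insert.IH)
      have "pi_elt G (insert p P \<inter> - {p}) (x [^] l)"
        using pi_elt_Int kl(3) pi_elt_pow insert.prems(3) by blast
      then show "pi_elt G P (x [^] l)" by (rule pi_elt_mono) auto
      show "(x [^] l) [^] k' \<in> B" if "prime q" "pi_elt G {q} ((x [^] l) [^] k')" for q and k' :: nat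
        using that insert.prems by (simp add: nat_pow_pow)
    qed (use insert.prems in auto)
    ultimately show ?case using kl(1) subgroup.m_closed[OF B] by metis
  qed
  from this[of "prime_factors (order G)" x] show ?thesis
    using x parts pi_elt_order by (auto simp: prime_factors_dvd)
qed

text \<open>A Sylow \<open>p\<close>-subgroup consists of \<open>p\<close>-elements, so it lies in
  \<open>B\<close>, and the full power of \<open>p\<close> in the group order already divides
  \<open>card B\<close>.\<close>

lemma sylow_index:
  assumes B: "subgroup B G" and p: "prime p" and all: "\<And>x. pi_elt G {p} x \<Longrightarrow> x \<in> B"
  shows "\<not> p dvd order G div card B"
proof
  assume dv: "p dvd order G div card B"
  define a where "a = multiplicity p (order G)"
  have pa: "p ^ a dvd order G" by (simp add: a_def multiplicity_dvd)
  then obtain P where P: "subgroup P G" "card P = p ^ a"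
    using sylow_thm[of p G a] p is_group fin by (metis dvdE)
  have "prime_factors (p ^ a) \<subseteq> {p}" using p by (auto simp: prime_factors_dvd intro: primes_dvd_imp_eq dest: prime_dvd_power)
  then have "P \<subseteq> B" using all pi_elt_mem_subgroup[OF P(1)] P(2) by auto
  then have "subgroup P (G\<lparr>carrier := B\<rparr>)" using P(1) B by (simp add: subgroup_incl)
  then have "p ^ a dvd card B"
    using fin_group.card_subgroup_dvd[OF fin_group_subgroup[OF B], of P] P(2) by (simp add: order_def)
  then have "p ^ a * p dvd order G"
    using dv order_eq_index[OF B] by (metis mult_dvd_mono mult.commute)
  then have "p ^ Suc a dvd order G" by (simp add: mult.commute)
  then have "Suc a \<le> multiplicity p (order G)"
    using p order_pos by (intro multiplicity_geI) (auto dest: prime_gt_1_nat)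
  then show False unfolding a_def by simp
qed

text \<open>The index annihilates the coset of \<open>x\<close> in the factor group, so
  \<open>N\<close> contains a power of \<open>x\<close> whose exponent is prime to the order of
  \<open>x\<close>.\<close>

lemma normal_contains_coprime:
  assumes N: "N \<lhd> G" and x: "pi_elt G T x" and i: "prime_factors (order G div card N) \<subseteq> - T"
  shows "x \<in> N"
proof -
  interpret N: normal N G by (rule N)
  have sub: "subgroup N G" by (rule N.is_subgroup)
  have xc: "x \<in> carrier G" using x by (rule pi_elt_carrier)
  interpret Q: group "G Mod N" by (rule N.factorgroup_is_group)
  let ?i = "order G div card N"
  have oi: "order (G Mod N) = ?i"
    using card_subgroup_pos[OF sub] by (simp add: FactGroup_def order_def flip: lagrange[OF sub, unfolded order_def])
  have pos: "0 < ?i" by (rule index_pos[OF sub])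
  have "(N #> x) [^]\<^bsub>G Mod N\<^esub> ?i = \<one>\<^bsub>G Mod N\<^esub>"
    using Q.pow_order_eq_1[of "N #> x"] xc oi by (simp add: carrier_FactGroup)
  then have "N #> x [^] ?i = N" using N.FactGroup_pow[OF xc, of ?i] by simp
  then have "x [^] ?i \<in> N" using rcos_self[OF nat_pow_closed[OF xc] sub, of ?i] by simp
  then show ?thesis using pi_elt_pow_mem[OF sub x] pos i by blast
qed

text \<open>No prime divides the index of \<open>B\<close>: those of \<open>s\<close> are excluded
  by \<open>H\<close>, the others by \<open>sylow_index\<close>. Applied with \<open>B\<close> a
  normalizer, this turns normalization by a Hall \<open>s\<close>-subgroup and by the
  \<open>- s\<close>-elements into normality.\<close>

lemma subgroup_eq_carrierI:
  assumes B: "subgroup B G" and H: "subgroup H G" "H \<subseteq> B" "prime_factors (order G div card H) \<subseteq> - s"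
    and y: "\<And>y. pi_elt G (- s) y \<Longrightarrow> y \<in> B"
  shows "B = carrier G"
proof -
  have "order G div card B = 1"
  proof (rule ccontr)
    assume "order G div card B \<noteq> 1"
    then obtain p where p: "prime p" "p dvd order G div card B" using prime_factor_nat by blast
    show False
    proof (cases "p \<in> s")
      case True
      have "card H dvd card B"
        using fin_group.card_subgroup_dvd[OF fin_group_subgroup[OF B]] subgroup_incl[OF H(1) B H(2)] by (simp add: order_def)
      then have "order G div card B dvd order G div card H"
        using index_dvd_index card_subgroup_dvd[OF B] card_subgroup_pos[OF B] by blast
      then have "p dvd order G div card H" using p dvd_trans by blast
      moreover have "0 < order G div card H" using index_pos[OF H(1)] .
      ultimately have "p \<in> prime_factors (order G div card H)" using p by (auto simp: prime_factors_dvd)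
      then show False using H(3) True by auto
    next
      case False
      then have "x \<in> B" if "pi_elt G {p} x" for x using y pi_elt_mono[OF that, of "- s"] by auto
      then show False using sylow_index[OF B p(1)] p(2) by blast
    qed
  qed
  then have "card B = order G" using order_eq_index[OF B] by simp
  then show ?thesis using subgroup.subset[OF B] fin by (simp add: order_def card_subset_eq)
qed

text \<open>Here \<open>A <#> B\<close> may fail to be a subgroup, so cosets are replaced by a
  choice: fix one factorization of each product; every other one differs from it by a unique element
  of the intersection.\<close>

lemma card_set_mult:
  assumes A: "subgroup A G" and B: "subgroup B G"
  shows "card (A <#> B) * card (A \<inter> B) = card A * card B"
proof -
  define f where "f y = (SOME a. a \<in> A \<and> (\<exists>b\<in>B. y = a \<otimes> b))" for y
  define g where "g y = inv (f y) \<otimes> y" for y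
  have f: "f y \<in> A" "g y \<in> B" "f y \<otimes> g y = y" if "y \<in> A <#> B" for y
  proof -
    have "\<exists>a. a \<in> A \<and> (\<exists>b\<in>B. y = a \<otimes> b)" using that unfolding set_mult_def by blast
    then have *: "f y \<in> A \<and> (\<exists>b\<in>B. y = f y \<otimes> b)" unfolding f_def by (rule someI_ex)
    then obtain b where b: "b \<in> B" "y = f y \<otimes> b" by blast
    have c: "f y \<in> carrier G" "b \<in> carrier G" using * b A B subgroup.mem_carrier by metis+
    have "g y = b" unfolding g_def using b(2) c inv_m_cancel by metis
    then show "f y \<in> A" "g y \<in> B" "f y \<otimes> g y = y" using * b by auto
  qed
  let ?h = "\<lambda>(y, c). (f y \<otimes> c, inv c \<otimes> g y)"
  note mem = subgroup.mem_carrier[OF A] subgroup.mem_carrier[OF B]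
  have "bij_betw ?h ((A <#> B) \<times> (A \<inter> B)) (A \<times> B)"
  proof (rule bij_betwI')
    fix u v assume u: "u \<in> (A <#> B) \<times> (A \<inter> B)" and v: "v \<in> (A <#> B) \<times> (A \<inter> B)"
    obtain y c where uy: "u = (y, c)" by (cases u)
    obtain z d where vz: "v = (z, d)" by (cases v)
    have pr: "(f y \<otimes> c) \<otimes> (inv c \<otimes> g y) = y" if "y \<in> A <#> B" "c \<in> A" for y c
      using f[OF that(1)] that(2) mem by (simp add: word_simps)
    show "(?h u = ?h v) = (u = v)"
    proof
      assume e: "?h u = ?h v"
      then have "y = z" using pr[of y c] pr[of z d] u v uy vz by auto
      with e show "u = v" using u v uy vz f[of y] mem by auto
    qed simp
  next
    fix u assume "u \<in> (A <#> B) \<times> (A \<inter> B)"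
    then show "?h u \<in> A \<times> B" using f A B by (auto intro: subgroup.m_closed subgroup.m_inv_closed)
  next
    fix w assume w: "w \<in> A \<times> B"
    then obtain a b where ab: "w = (a, b)" "a \<in> A" "b \<in> B" by auto
    let ?y = "a \<otimes> b" let ?c = "inv (f ?y) \<otimes> a"
    have y: "?y \<in> A <#> B" using ab unfolding set_mult_def by blast
    have cc: "f ?y \<in> carrier G" "g ?y \<in> carrier G" "a \<in> carrier G" "b \<in> carrier G" using f[OF y] ab mem by auto
    have c2: "?c = g ?y \<otimes> inv b" unfolding g_def using cc by (simp add: word_simps)
    have "?c \<in> A" using f[OF y] ab A by (auto intro: subgroup.m_closed subgroup.m_inv_closed)
    moreover have "?c \<in> B" unfolding c2 using f[OF y] ab B by (auto intro: subgroup.m_closed subgroup.m_inv_closed)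
    moreover have "f ?y \<otimes> ?c = a" using cc by (simp add: word_simps)
    moreover have "inv ?c \<otimes> g ?y = b" unfolding g_def using cc by (simp add: word_simps)
    ultimately show "\<exists>u\<in>(A <#> B) \<times> (A \<inter> B). w = ?h u" using y ab by (intro bexI[of _ "(?y, ?c)"]) auto
  qed
  from bij_betw_same_card[OF this] show ?thesis by (simp add: card_cartesian_product)
qed

end


section \<open>Commutators, Hall subgroups and quotients\<close>

definition cm :: "('a, 'b) monoid_scheme \<Rightarrow> 'a \<Rightarrow> 'a \<Rightarrow> 'a" where
  "cm G x y = inv\<^bsub>G\<^esub> x \<otimes>\<^bsub>G\<^esub> cj G x y"

text \<open>One inclusion is enough: for finite \<open>V\<close> an injective map of
  \<open>V\<close> into itself is onto, so this is the usual normalizer. For a singleton it is the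
  centralizer of its element, which lets centralizers share the same lemmas.\<close>

definition normalizer_of :: "('a, 'b) monoid_scheme \<Rightarrow> 'a set \<Rightarrow> 'a set" where
  "normalizer_of G V = {g \<in> carrier G. \<forall>v\<in>V. cj G v g \<in> V}"

definition sigma_commutators :: "nat set set \<Rightarrow> ('a, 'b) monoid_scheme \<Rightarrow> 'a set" where
  "sigma_commutators \<sigma> G = {cm G x y | x y s. s \<in> \<sigma> \<and> pi_elt G s x \<and> pi_elt G (- s) y}"

definition sigma_comm :: "nat set set \<Rightarrow> ('a, 'b) monoid_scheme \<Rightarrow> 'a set" where
  "sigma_comm \<sigma> G = generate G (sigma_commutators \<sigma> G)"

context group
begin

lemma cm_closed [simp]: "x \<in> carrier G \<Longrightarrow> y \<in> carrier G \<Longrightarrow> cm G x y \<in> carrier G"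
  by (simp add: cm_def)

lemma cj_eq_cm: "x \<in> carrier G \<Longrightarrow> y \<in> carrier G \<Longrightarrow> cj G x y = x \<otimes> cm G x y"
  by (simp add: cm_def word_simps)

lemma cm_eq_one_iff:
  assumes "x \<in> carrier G" "y \<in> carrier G"
  shows "cm G x y = \<one> \<longleftrightarrow> x \<otimes> y = y \<otimes> x"
  using cj_eq_cm[OF assms] cj_eq_iff_commute[OF assms] r_cancel_one[of x "cm G x y"] assms by simp

lemma cm_inv: "x \<in> carrier G \<Longrightarrow> y \<in> carrier G \<Longrightarrow> inv (cm G x y) = cm G y x"
  by (simp add: cm_def cj_def word_simps)

lemma cj_cm: "x \<in> carrier G \<Longrightarrow> y \<in> carrier G \<Longrightarrow> g \<in> carrier G \<Longrightarrow> cj G (cm G x y) g = cm G (cj G x g) (cj G y g)"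
  by (simp add: cm_def cj_def word_simps)

lemma cm_subgroup: "subgroup H G \<Longrightarrow> x \<in> H \<Longrightarrow> y \<in> H \<Longrightarrow> cm (G\<lparr>carrier := H\<rparr>) x y = cm G x y"
  unfolding cm_def by (simp add: cj_subgroup)

lemma normal_disjoint_commute:
  assumes "M \<lhd> G" "N \<lhd> G" "M \<inter> N = {\<one>}" "m \<in> M" "n \<in> N"
  shows "m \<otimes> n = n \<otimes> m"
proof -
  have sM: "subgroup M G" and sN: "subgroup N G" using assms normal_imp_subgroup by auto
  have c: "m \<in> carrier G" "n \<in> carrier G"
    using assms subgroup.mem_carrier[OF sM] subgroup.mem_carrier[OF sN] by auto
  have "cm G m n \<in> M" unfolding cm_def using assms c sM
    by (auto simp: normal_iff_cj intro!: subgroup.m_closed subgroup.m_inv_closed)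
  moreover have "cm G n m \<in> N" unfolding cm_def using assms c sN
    by (auto simp: normal_iff_cj intro!: subgroup.m_closed subgroup.m_inv_closed)
  then have "cm G m n \<in> N" using c sN by (metis cm_inv subgroup.m_inv_closed)
  ultimately have "cm G m n = \<one>" using assms(3) by auto
  then show ?thesis using c by (simp add: cm_eq_one_iff)
qed

text \<open>Conjugation permutes the generators, since it preserves \<open>s\<close>-elements and
  \<open>- s\<close>-elements.\<close>

lemma sigma_comm_normal: "sigma_comm \<sigma> G \<lhd> G"
  unfolding sigma_comm_def
proof (rule normal_generateI)
  show "sigma_commutators \<sigma> G \<subseteq> carrier G"
    unfolding sigma_commutators_def by (auto dest!: pi_elt_carrier)
  fix h g assume h: "h \<in> sigma_commutators \<sigma> G" and g: "g \<in> carrier G"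
  obtain x y s where xy: "h = cm G x y" "s \<in> \<sigma>" "pi_elt G s x" "pi_elt G (- s) y"
    using h unfolding sigma_commutators_def by blast
  have "g \<otimes> h \<otimes> inv g = cj G h (inv g)" using g by (simp add: cj_def)
  also have "\<dots> = cm G (cj G x (inv g)) (cj G y (inv g))"
    using xy g cj_cm pi_elt_carrier by (metis inv_closed)
  finally show "g \<otimes> h \<otimes> inv g \<in> sigma_commutators \<sigma> G"
    unfolding sigma_commutators_def using xy g pi_elt_cj inv_closed by blast
qed

lemma cm_mem_sigma_comm:
  "s \<in> \<sigma> \<Longrightarrow> pi_elt G s x \<Longrightarrow> pi_elt G (- s) y \<Longrightarrow> cm G x y \<in> sigma_comm \<sigma> G"
  unfolding sigma_comm_def sigma_commutators_def by (rule generate.incl) blast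

lemma sigma_comm_minimal:
  "subgroup H G \<Longrightarrow> (\<And>s x y. s \<in> \<sigma> \<Longrightarrow> pi_elt G s x \<Longrightarrow> pi_elt G (- s) y \<Longrightarrow> cm G x y \<in> H) \<Longrightarrow>
    sigma_comm \<sigma> G \<subseteq> H"
  unfolding sigma_comm_def sigma_commutators_def
  by (rule generate_subgroup_incl) auto

lemma conj_set_eq_image:
  "H \<subseteq> carrier G \<Longrightarrow> x \<in> carrier G \<Longrightarrow> conj_set G H x = (\<lambda>h. cj G h x) ` H"
  unfolding conj_set_def r_coset_def l_coset_def cj_def by auto

lemma set_mult_memI: "a \<in> A \<Longrightarrow> b \<in> B \<Longrightarrow> a \<otimes> b \<in> A <#> B"
  unfolding set_mult_def by blast

lemma set_mult_memE: "x \<in> A <#> B \<Longrightarrow> (\<And>a b. a \<in> A \<Longrightarrow> b \<in> B \<Longrightarrow> x = a \<otimes> b \<Longrightarrow> P) \<Longrightarrow> P"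
  unfolding set_mult_def by blast

lemma set_mult_subgroup:
  assumes A: "subgroup A G" and B: "subgroup B G" and c: "A <#> B = B <#> A"
  shows "subgroup (A <#> B) G"
proof (rule subgroupI)
  show "A <#> B \<subseteq> carrier G" using A B by (simp add: setmult_subset_G subgroup.subset)
  show "A <#> B \<noteq> {}" using set_mult_memI[OF subgroup.one_closed[OF A] subgroup.one_closed[OF B]] by blast
  fix x assume "x \<in> A <#> B"
  then obtain a b where x: "a \<in> A" "b \<in> B" "x = a \<otimes> b" unfolding set_mult_def by blast
  have "inv x = inv b \<otimes> inv a" using x A B by (simp add: inv_mult_group subgroup.mem_carrier)
  then have "inv x \<in> B <#> A"
    using set_mult_memI[OF subgroup.m_inv_closed[OF B x(2)] subgroup.m_inv_closed[OF A x(1)]] by simp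
  then show "inv x \<in> A <#> B" using c by simp
next
  fix x y assume "x \<in> A <#> B" "y \<in> A <#> B"
  then have "x \<otimes> y \<in> (A <#> B) <#> (A <#> B)" unfolding set_mult_def by blast
  also have "(A <#> B) <#> (A <#> B) = A <#> ((B <#> A) <#> B)"
    using A B by (simp add: set_mult_assoc setmult_subset_G subgroup.subset)
  also have "\<dots> = (A <#> A) <#> (B <#> B)"
    using A B by (simp add: set_mult_assoc setmult_subset_G subgroup.subset flip: c)
  also have "\<dots> = A <#> B" using A B by (simp add: subgroup_mult_id)
  finally show "x \<otimes> y \<in> A <#> B" .
qed

lemma set_mult_normal_subgroup:
  assumes "N \<lhd> G" "subgroup H G"
  shows "subgroup (H <#> N) G" "H \<subseteq> H <#> N" "N \<subseteq> H <#> N"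
proof -
  show "subgroup (H <#> N) G"
    using set_mult_subgroup[OF assms(2) normal_imp_subgroup[OF assms(1)]] commut_normal[OF assms(2,1)] by simp
  show "H \<subseteq> H <#> N"
  proof
    fix h assume "h \<in> H"
    then have "h \<otimes> \<one> \<in> H <#> N"
      using set_mult_memI subgroup.one_closed[OF normal_imp_subgroup[OF assms(1)]] by blast
    then show "h \<in> H <#> N" using subgroup.mem_carrier[OF assms(2) \<open>h \<in> H\<close>] by simp
  qed
  show "N \<subseteq> H <#> N"
  proof
    fix n assume "n \<in> N"
    then have "\<one> \<otimes> n \<in> H <#> N" using set_mult_memI subgroup.one_closed[OF assms(2)] by blast
    then show "n \<in> H <#> N"
      using subgroup.mem_carrier[OF normal_imp_subgroup[OF assms(1)] \<open>n \<in> N\<close>] by simp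
  qed
qed

end

section \<open>Normalizers and Hall subgroups\<close>

context fin_group
begin

lemma normalizer_of_subgroup:
  assumes V: "V \<subseteq> carrier G"
  shows "subgroup (normalizer_of G V) G"
proof (rule subgroupI)
  show "normalizer_of G V \<subseteq> carrier G" unfolding normalizer_of_def by blast
  have "\<one> \<in> normalizer_of G V" unfolding normalizer_of_def using V by auto
  then show "normalizer_of G V \<noteq> {}" by blast
  fix a assume a: "a \<in> normalizer_of G V"
  then have ac: "a \<in> carrier G" unfolding normalizer_of_def by blast
  have "inj_on (\<lambda>v. cj G v a) V" using V ac by (intro inj_onI) (use cj_inj in blast)
  moreover have "(\<lambda>v. cj G v a) ` V \<subseteq> V" using a unfolding normalizer_of_def by blast
  ultimately have im: "(\<lambda>v. cj G v a) ` V = V" using finite_subset[OF V fin] by (simp add: endo_inj_surj)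
  have "cj G v (inv a) \<in> V" if v: "v \<in> V" for v
  proof -
    obtain w where w: "w \<in> V" "v = cj G w a" using im v by blast
    then show ?thesis using V ac by auto
  qed
  then show "inv a \<in> normalizer_of G V" unfolding normalizer_of_def using ac by simp
  fix b assume b: "b \<in> normalizer_of G V"
  then show "a \<otimes> b \<in> normalizer_of G V" using a V unfolding normalizer_of_def
    by (auto simp flip: cj_cj)
qed

lemma normal_if_normalizer: "subgroup V G \<Longrightarrow> normalizer_of G V = carrier G \<Longrightarrow> V \<lhd> G"
  unfolding normal_iff_cj normalizer_of_def by blast

lemma card_subgroup_mono_dvd: "subgroup A G \<Longrightarrow> subgroup B G \<Longrightarrow> A \<subseteq> B \<Longrightarrow> card A dvd card B"
  using fin_group.card_subgroup_dvd[OF fin_group_subgroup, of B A] subgroup_incl by (simp add: order_def)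

text \<open>Cauchy's theorem, taken from Sylow's with exponent 1: a prime dividing
  \<open>card H\<close> yields a nontrivial element of that order in \<open>H\<close>, which would
  be trivial if the prime were outside \<open>T\<close>.\<close>

lemma prime_factors_card_subgroupI:
  assumes H: "subgroup H G" and el: "\<And>x. x \<in> H \<Longrightarrow> pi_elt G T x"
  shows "prime_factors (card H) \<subseteq> T"
proof
  fix p assume "p \<in> prime_factors (card H)"
  then have p: "prime p" "p dvd card H" by (auto simp: prime_factors_dvd)
  interpret H: fin_group "G\<lparr>carrier := H\<rparr>" by (rule fin_group_subgroup[OF H])
  obtain m where "order (G\<lparr>carrier := H\<rparr>) = p ^ 1 * m" using p by (auto simp: order_def)
  then obtain P where P: "subgroup P (G\<lparr>carrier := H\<rparr>)" "card P = p ^ 1"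
    using sylow_thm[OF p(1) H.is_group _ H.fin] by blast
  then have "P \<noteq> {\<one>}" using p(1) by auto
  then obtain x where x: "x \<in> P" "x \<noteq> \<one>" using subgroup.one_closed[OF P(1)] by auto
  have "pi_elt (G\<lparr>carrier := H\<rparr>) {p} x"
    using H.pi_elt_mem_subgroup[OF P(1) _ x(1)] P(2) p(1) by (simp add: prime_prime_factors)
  then have "pi_elt G {p} x" "x \<in> H" using pi_elt_subgroup[OF H] by auto
  then show "p \<in> T" using el x(2) pi_elt_disjoint by blast
qed

lemma hall_subgroupD:
  assumes "hall_sigma_subgroup s G H"
  shows "subgroup H G" "prime_factors (card H) \<subseteq> s" "prime_factors (order G div card H) \<subseteq> - s"
  using assms unfolding hall_sigma_subgroup_def by auto

lemma card_set_mult_dvd: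
  assumes "subgroup A G" "subgroup B G" "subgroup (A <#> B) G"
  shows "card (A <#> B) dvd card A * card B" "card (A <#> B) div card A dvd card B"
proof -
  note c = card_set_mult[OF assms(1,2)]
  show "card (A <#> B) dvd card A * card B" using c by (metis dvd_triv_left)
  have "A \<subseteq> A <#> B"
  proof
    fix a assume a: "a \<in> A"
    then have "a \<otimes> \<one> \<in> A <#> B" using set_mult_memI subgroup.one_closed[OF assms(2)] by blast
    then show "a \<in> A <#> B" using subgroup.mem_carrier[OF assms(1) a] by simp
  qed
  then have "card A dvd card (A <#> B)" using card_subgroup_mono_dvd assms by blast
  then obtain k where k: "card (A <#> B) = card A * k" by (elim dvdE)
  have pos: "0 < card A" using card_subgroup_pos assms by blast
  then have "k * card (A \<inter> B) = card B" using c k by simp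
  then have "k dvd card B" by (metis dvd_triv_left)
  then show "card (A <#> B) div card A dvd card B" using k pos by simp
qed

text \<open>The index of \<open>H\<close> in the product with \<open>N\<close> divides both
  \<open>card N\<close> and the index of \<open>H\<close>, hence is 1. The order of \<open>H\<close>
  is left arbitrary, as the lemma is later applied inside a product AQ to its factor A.\<close>

lemma normal_pi_subgroup_le:
  assumes h: "subgroup H G" "prime_factors (order G div card H) \<subseteq> - s"
    and N: "N \<lhd> G" "prime_factors (card N) \<subseteq> s"
  shows "N \<subseteq> H"
proof -
  have sN: "subgroup N G" using N(1) normal_imp_subgroup by blast
  note sm = set_mult_normal_subgroup[OF N(1) h(1)]
  let ?k = "card (H <#> N) div card H"
  have "?k dvd card N" using card_set_mult_dvd(2)[OF h(1) sN sm(1)] .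
  then have 1: "prime_factors ?k \<subseteq> s"
    using N(2) prime_factors_mono_dvd[of ?k "card N"] card_subgroup_pos[OF sN] by auto
  have d1: "card H dvd card (H <#> N)" using card_subgroup_mono_dvd h(1) sm by blast
  then have "?k dvd order G div card H"
    using card_subgroup_dvd[OF sm(1)] div_dvd_div[THEN iffD2] dvd_trans by blast
  then have 2: "prime_factors ?k \<subseteq> - s"
    using h(2) prime_factors_mono_dvd[of ?k "order G div card H"] index_pos[OF h(1)] by auto
  have "?k = 1"
  proof (rule ccontr)
    assume "?k \<noteq> 1"
    then obtain p where "prime p" "p dvd ?k" using prime_factor_nat by blast
    moreover have "?k \<noteq> 0" using d1 card_subgroup_pos[OF sm(1)] by auto
    ultimately show False using 1 2 by (auto simp: prime_factors_dvd)
  qed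
  then have "card (H <#> N) = card H" using d1 by (metis dvd_mult_div_cancel mult.right_neutral)
  then have "H = H <#> N" using sm finite_subgroup card_subset_eq by metis
  then show ?thesis using sm by simp
qed

lemma hall_conj:
  assumes H: "hall_sigma_subgroup s G H" and x: "x \<in> carrier G"
  shows "hall_sigma_subgroup s G (conj_set G H x)"
proof -
  note h = hall_subgroupD[OF H]
  have Hc: "H \<subseteq> carrier G" using h(1) subgroup.subset by blast
  have im: "conj_set G H x = (\<lambda>h. cj G h x) ` H" by (rule conj_set_eq_image[OF Hc x])
  have "group_hom G G (\<lambda>h. cj G h x)"
    by (simp add: group_hom_def group_hom_axioms_def hom_def x cj_mult is_group)
  then have "subgroup (conj_set G H x) G" unfolding im using group_hom.subgroup_img_is_subgroup h(1) by blast
  moreover have "card (conj_set G H x) = card H" unfolding im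
  proof (rule card_image, rule inj_onI)
    fix a b assume "a \<in> H" "b \<in> H" "cj G a x = cj G b x"
    then show "a = b" using cj_inj x Hc by blast
  qed
  ultimately show ?thesis using H unfolding hall_sigma_subgroup_def by simp
qed

text \<open>Fills in the classes not meeting the group order, so that Hall subgroups may be indexed
  by all of \<sigma>.\<close>

lemma hall_trivial: "s \<in> \<sigma> \<Longrightarrow> s \<notin> sigma_of \<sigma> (order G) \<Longrightarrow> hall_sigma_subgroup s G {\<one>}"
  unfolding hall_sigma_subgroup_def sigma_of_iff using triv_subgroup by auto

lemma hall_of_complete:
  assumes "complete_hall_sigma_set \<sigma> G \<H>" "s \<in> \<sigma>"
  shows "\<exists>H. hall_sigma_subgroup s G H"
proof (cases "s \<in> sigma_of \<sigma> (order G)")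
  case True
  then show ?thesis using assms(1) unfolding complete_hall_sigma_set_def by (auto dest!: bspec ex1_implies_ex)
qed (use hall_trivial[OF assms(2)] in blast)

lemma complete_of_hall:
  assumes \<sigma>: "sigma_partition \<sigma>" and F: "\<And>s. s \<in> \<sigma> \<Longrightarrow> hall_sigma_subgroup s G (F s)"
  shows "complete_hall_sigma_set \<sigma> G (F ` sigma_of \<sigma> (order G))"
proof -
  \<comment> \<open>Uniqueness in a complete Hall set: a prime of \<open>s\<close> dividing the
    group order must divide the order of \<open>F s\<close>, so \<open>F s\<close> can be a Hall
    subgroup for no class other than \<open>s\<close>.\<close>
  have un: "s = t" if s: "s \<in> sigma_of \<sigma> (order G)" and t: "t \<in> \<sigma>" "hall_sigma_subgroup t G (F s)" for s t
  proof -
    obtain p where p: "s \<in> \<sigma>" "p \<in> prime_factors (order G)" "p \<in> s" using s sigma_of_iff by metis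
    note h = hall_subgroupD[OF F[OF p(1)]]
    have "p \<in> prime_factors (card (F s))"
    proof (rule ccontr)
      assume n: "p \<notin> prime_factors (card (F s))"
      then have "\<not> p dvd card (F s)" using p(2) card_subgroup_pos[OF h(1)] by (auto simp: prime_factors_dvd)
      then have "p dvd order G div card (F s)" using p(2) order_eq_index[OF h(1)]
        by (metis in_prime_factors_imp_prime in_prime_factors_imp_dvd prime_dvd_multD)
      then have "p \<in> prime_factors (order G div card (F s))" using p(2) index_pos[OF h(1)] by (auto simp: prime_factors_dvd)
      then show False using h(3) p(3) by auto
    qed
    then have "p \<in> t" using hall_subgroupD(2)[OF t(2)] by auto
    then show "s = t" using sigma_partition_disjoint[OF \<sigma>] p t by blast
  qed
  have el: "s \<in> \<sigma>" if "s \<in> sigma_of \<sigma> (order G)" for s using that sigma_of_iff by blast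
  show ?thesis unfolding complete_hall_sigma_set_def
  proof (intro conjI ballI impI)
    fix s assume s: "s \<in> sigma_of \<sigma> (order G)"
    show "\<exists>!H. H \<in> F ` sigma_of \<sigma> (order G) \<and> hall_sigma_subgroup s G H"
      using s F el un by (intro ex1I[of _ "F s"]) auto
  next
    fix H assume "H \<in> F ` sigma_of \<sigma> (order G)"
    then obtain s where "s \<in> \<sigma>" "H = F s" using el by blast
    then show "subgroup H G" "\<exists>s\<in>\<sigma>. hall_sigma_subgroup s G H" using F hall_subgroupD(1)[OF F] by auto
  qed
qed

text \<open>A complete Hall set is nothing more than an independent choice of one Hall subgroup per
  class, so permutability can be treated class by class; a class not meeting the group order is
  served by the trivial subgroup.\<close>

lemma sigma_quasinormal_iff:
  assumes \<sigma>: "sigma_partition \<sigma>"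
  shows "sigma_quasinormal \<sigma> G A \<longleftrightarrow> subgroup A G \<and>
    (\<forall>s\<in>\<sigma>. \<exists>H. hall_sigma_subgroup s G H \<and>
       (\<forall>x\<in>carrier G. A <#> conj_set G H x = conj_set G H x <#> A))" (is "?L \<longleftrightarrow> ?R")
proof
  assume L: ?L
  then have A: "subgroup A G" unfolding sigma_quasinormal_def by blast
  obtain \<H> where \<H>: "complete_hall_sigma_set \<sigma> G \<H>"
    "\<And>H x. H \<in> \<H> \<Longrightarrow> x \<in> carrier G \<Longrightarrow> A <#> conj_set G H x = conj_set G H x <#> A"
    using L unfolding sigma_quasinormal_def by blast
  have "\<exists>H. hall_sigma_subgroup s G H \<and>
       (\<forall>x\<in>carrier G. A <#> conj_set G H x = conj_set G H x <#> A)" if s: "s \<in> \<sigma>" for s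
  proof (cases "s \<in> sigma_of \<sigma> (order G)")
    case True
    then obtain H where "H \<in> \<H>" "hall_sigma_subgroup s G H"
      using \<H>(1) unfolding complete_hall_sigma_set_def by (auto dest!: bspec ex1_implies_ex)
    then show ?thesis using \<H>(2) by (intro exI[of _ H]) simp
  next
    case False
    have "A <#> conj_set G {\<one>} x = conj_set G {\<one>} x <#> A" if "x \<in> carrier G" for x
    proof -
      have "conj_set G {\<one>} x = {\<one>}" using that by (simp add: conj_set_eq_image)
      then show ?thesis using subgroup.mem_carrier[OF A] unfolding set_mult_def by auto
    qed
    then show ?thesis using hall_trivial[OF s False] by blast
  qed
  with A show ?R by blast
next
  assume R: ?R
  then have "\<exists>F. \<forall>s\<in>\<sigma>. hall_sigma_subgroup s G (F s) \<and>
       (\<forall>x\<in>carrier G. A <#> conj_set G (F s) x = conj_set G (F s) x <#> A)"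
    by (intro bchoice) blast
  then obtain F where F': "\<forall>s\<in>\<sigma>. hall_sigma_subgroup s G (F s) \<and>
       (\<forall>x\<in>carrier G. A <#> conj_set G (F s) x = conj_set G (F s) x <#> A)" ..
  then have F: "hall_sigma_subgroup s G (F s)"
    "x \<in> carrier G \<Longrightarrow> A <#> conj_set G (F s) x = conj_set G (F s) x <#> A" if "s \<in> \<sigma>" for s x
    using that by simp_all
  show ?L unfolding sigma_quasinormal_def
  proof (intro conjI exI[of _ "F ` sigma_of \<sigma> (order G)"] ballI)
    show "complete_hall_sigma_set \<sigma> G (F ` sigma_of \<sigma> (order G))" by (rule complete_of_hall[OF \<sigma> F(1)])
  qed (use R F(2) in \<open>auto simp: sigma_of_iff\<close>)
qed

lemma sigma_quasinormalI:
  assumes "sigma_partition \<sigma>" "subgroup A G" "\<And>s. s \<in> \<sigma> \<Longrightarrow> \<exists>H. hall_sigma_subgroup s G H"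
    and "\<And>s H. s \<in> \<sigma> \<Longrightarrow> hall_sigma_subgroup s G H \<Longrightarrow> A <#> H = H <#> A"
  shows "sigma_quasinormal \<sigma> G A"
  unfolding sigma_quasinormal_iff[OF assms(1)] using assms hall_conj by meson

end

section \<open>Epimorphisms of finite groups\<close>

lemma (in group_hom) card_subgroup_image_kernel:
  assumes A: "subgroup A G" and fin: "finite A"
  shows "card A = card (h ` A) * card {x \<in> A. h x = \<one>\<^bsub>H\<^esub>}"
proof -
  have "card {x \<in> A. h x = y} = card {x \<in> A. h x = \<one>\<^bsub>H\<^esub>}" if y: "y \<in> h ` A" for y
  proof -
    obtain a where a: "a \<in> A" "y = h a" using y by blast
    note mem = subgroup.mem_carrier[OF A]
    have "bij_betw (\<lambda>k. k \<otimes> a) {x \<in> A. h x = \<one>\<^bsub>H\<^esub>} {x \<in> A. h x = y}"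
    proof (rule bij_betwI[where g = "\<lambda>x. x \<otimes> inv a"])
      show "(\<lambda>k. k \<otimes> a) \<in> {x \<in> A. h x = \<one>\<^bsub>H\<^esub>} \<rightarrow> {x \<in> A. h x = y}"
        using a mem subgroup.m_closed[OF A] by auto
      show "(\<lambda>x. x \<otimes> inv a) \<in> {x \<in> A. h x = y} \<rightarrow> {x \<in> A. h x = \<one>\<^bsub>H\<^esub>}"
        using a mem subgroup.m_closed[OF A] subgroup.m_inv_closed[OF A] by auto
    qed (use a mem in \<open>auto simp: G.m_assoc\<close>)
    from bij_betw_same_card[OF this] show ?thesis by simp
  qed
  then have "(\<Sum>y\<in>h ` A. card {x \<in> A. h x = y}) = card (h ` A) * card {x \<in> A. h x = \<one>\<^bsub>H\<^esub>}"
    by simp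
  moreover have "card A = (\<Sum>y\<in>h ` A. card {x \<in> A. h x = y})"
    using sum.image_gen[OF fin, of "\<lambda>_. 1::nat" h] by simp
  ultimately show ?thesis by simp
qed

text \<open>Covers both the projections onto factor groups and the identity, so that results on
  quotients apply to the group itself as well.\<close>

locale fin_epi = group_hom G H h for G (structure) and H (structure) and h +
  assumes finG: "finite (carrier G)" and surj: "h ` carrier G = carrier H"
begin

sublocale G: fin_group G
  by unfold_locales (rule finG)

sublocale H: fin_group H
  by unfold_locales (use finG surj in \<open>metis finite_imageI\<close>)

lemma cm_hom: "x \<in> carrier G \<Longrightarrow> y \<in> carrier G \<Longrightarrow> h (cm G x y) = cm H (h x) (h y)"
  unfolding cm_def by (simp add: cj_hom)

text \<open>The \<open>T\<close>-part of any preimage works: the complementary part is sent to an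
  element that is both a \<open>T\<close>- and a \<open>- T\<close>-element, hence to the
  identity.\<close>

lemma pi_elt_lift:
  assumes z: "pi_elt H T z"
  obtains x where "pi_elt G T x" "h x = z"
proof -
  obtain g where g: "g \<in> carrier G" "h g = z" using pi_elt_carrier[OF z] unfolding surj[symmetric] by blast
  obtain k l :: nat where kl: "g = g [^] k \<otimes> g [^] l" "pi_elt G T (g [^] k)" "pi_elt G (- T) (g [^] l)"
    by (rule G.ex_part_exponent[of T]) (metis g(1))
  have "h (g [^] l) = z [^]\<^bsub>H\<^esub> l" using g by (simp add: hom_nat_pow)
  then have "h (g [^] l) = \<one>\<^bsub>H\<^esub>"
    using H.pi_elt_disjoint[of T "h (g [^] l)" "- T"] pi_elt_hom[OF kl(3)] H.pi_elt_pow[OF z, of l] by simp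
  then have "h (g [^] k) = z" using kl(1) g hom_mult[of "g [^] k" "g [^] l"]
    by (metis G.nat_pow_closed H.r_one hom_closed)
  then show ?thesis using that kl by blast
qed

lemma vimage_subgroup:
  assumes B: "subgroup B H"
  shows "subgroup {x \<in> carrier G. h x \<in> B} G"
proof (rule G.subgroupI)
  have "\<one> \<in> {x \<in> carrier G. h x \<in> B}" using subgroup.one_closed[OF B] by simp
  then show "{x \<in> carrier G. h x \<in> B} \<noteq> {}" by blast
qed (use subgroup.m_closed[OF B] subgroup.m_inv_closed[OF B] in auto)

lemma vimage_normal:
  assumes "B \<lhd> H"
  shows "{x \<in> carrier G. h x \<in> B} \<lhd> G"
  using assms vimage_subgroup unfolding G.normal_iff_cj H.normal_iff_cj by (auto simp: cj_hom)

lemma image_normal: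
  assumes "N \<lhd> G"
  shows "h ` N \<lhd> H"
  unfolding H.normal_iff_cj
proof (intro conjI ballI)
  show "subgroup (h ` N) H" by (rule subgroup_img_is_subgroup[OF normal_imp_subgroup[OF assms]])
  fix x y assume "x \<in> carrier H" "y \<in> h ` N"
  then obtain g n where "x = h g" "g \<in> carrier G" "y = h n" "n \<in> N"
    unfolding surj[symmetric] by blast
  then show "cj H y x \<in> h ` N"
    using assms by (auto simp: G.normal_iff_cj subgroup.mem_carrier simp flip: cj_hom)
qed

lemma card_vimage:
  assumes B: "subgroup B H"
  shows "card {x \<in> carrier G. h x \<in> B} = card B * card {x \<in> carrier G. h x = \<one>\<^bsub>H\<^esub>}"
proof -
  have "h ` {x \<in> carrier G. h x \<in> B} = B" using subgroup.subset[OF B] surj by auto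
  moreover have "{x \<in> {x \<in> carrier G. h x \<in> B}. h x = \<one>\<^bsub>H\<^esub>} = {x \<in> carrier G. h x = \<one>\<^bsub>H\<^esub>}"
    using subgroup.one_closed[OF B] by auto
  ultimately show ?thesis
    using card_subgroup_image_kernel[OF vimage_subgroup[OF B]] finG by simp
qed

lemma index_vimage:
  assumes B: "subgroup B H"
  shows "order H div card B = order G div card {x \<in> carrier G. h x \<in> B}"
proof -
  let ?k = "card {x \<in> carrier G. h x = \<one>\<^bsub>H\<^esub>}"
  have "order G = order H * ?k"
  proof -
    have "{x \<in> carrier G. h x \<in> carrier H} = carrier G" by auto
    then show ?thesis using card_vimage[OF H.subgroup_self] unfolding order_def by argo
  qed
  moreover have "\<one> \<in> {x \<in> carrier G. h x = \<one>\<^bsub>H\<^esub>}" by simp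
  then have "0 < ?k" using finG by (auto simp: card_gt_0_iff)
  ultimately show ?thesis using card_vimage[OF B] by simp
qed

lemma hall_image:
  assumes "hall_sigma_subgroup s G A"
  shows "hall_sigma_subgroup s H (h ` A)"
proof -
  note a = G.hall_subgroupD[OF assms]
  have B: "subgroup (h ` A) H" using a(1) subgroup_img_is_subgroup by blast
  have "card (h ` A) dvd card A"
    using card_subgroup_image_kernel[OF a(1) G.finite_subgroup[OF a(1)]] by simp
  then have "prime_factors (card (h ` A)) \<subseteq> s"
    using subset_trans[OF prime_factors_mono_dvd a(2)] G.card_subgroup_pos[OF a(1)] by simp
  moreover have "A \<subseteq> {x \<in> carrier G. h x \<in> h ` A}" using subgroup.subset[OF a(1)] by auto
  then have "card A dvd card {x \<in> carrier G. h x \<in> h ` A}"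
    using G.card_subgroup_mono_dvd[OF a(1) vimage_subgroup[OF B]] by blast
  then have "order H div card (h ` A) dvd order G div card A"
    unfolding index_vimage[OF B]
    using index_dvd_index[OF _ G.card_subgroup_dvd[OF vimage_subgroup[OF B]] G.card_subgroup_pos[OF vimage_subgroup[OF B]]]
    by simp
  then have "prime_factors (order H div card (h ` A)) \<subseteq> - s"
    using subset_trans[OF prime_factors_mono_dvd a(3)] G.index_pos[OF a(1)] by simp
  ultimately show ?thesis unfolding hall_sigma_subgroup_def using B by auto
qed

text \<open>Because \<open>s\<close>-elements and \<open>- s\<close>-elements lift, the generating
  commutators of the image are exactly the images of generating commutators.\<close>

lemma image_sigma_comm:
  "h ` sigma_comm \<sigma> G = sigma_comm \<sigma> H"
proof
  have sub: "subgroup (h ` sigma_comm \<sigma> G) H"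
    by (rule subgroup_img_is_subgroup[OF normal_imp_subgroup[OF G.sigma_comm_normal]])
  show "sigma_comm \<sigma> H \<subseteq> h ` sigma_comm \<sigma> G"
  proof (rule H.sigma_comm_minimal[OF sub])
    fix s x y assume s: "s \<in> \<sigma>" "pi_elt H s x" "pi_elt H (- s) y"
    obtain x' where x': "pi_elt G s x'" "h x' = x" using pi_elt_lift s by blast
    obtain y' where y': "pi_elt G (- s) y'" "h y' = y" using pi_elt_lift s by blast
    have "cm H x y = h (cm G x' y')" using x' y' by (simp add: cm_hom pi_elt_carrier)
    then show "cm H x y \<in> h ` sigma_comm \<sigma> G"
      using G.cm_mem_sigma_comm[OF s(1) x'(1) y'(1)] by simp
  qed
  have "sigma_comm \<sigma> G \<subseteq> {x \<in> carrier G. h x \<in> sigma_comm \<sigma> H}"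
  proof (rule G.sigma_comm_minimal[OF vimage_subgroup])
    show "subgroup (sigma_comm \<sigma> H) H"
      by (rule normal_imp_subgroup[OF H.sigma_comm_normal])
    fix s x y assume "s \<in> \<sigma>" "pi_elt G s x" "pi_elt G (- s) y"
    then show "cm G x y \<in> {x \<in> carrier G. h x \<in> sigma_comm \<sigma> H}"
      using H.cm_mem_sigma_comm pi_elt_hom by (auto simp: cm_hom pi_elt_carrier)
  qed
  then show "h ` sigma_comm \<sigma> G \<subseteq> sigma_comm \<sigma> H" by blast
qed

end

context fin_group
begin

lemma fin_epi_Mod:
  assumes "N \<lhd> G"
  shows "fin_epi G (G Mod N) ((#>) N)"
  using normal.factorgroup_is_group[OF assms] normal.r_coset_hom_Mod[OF assms] fin
  by (simp add: fin_epi_def fin_epi_axioms_def group_hom_def group_hom_axioms_def is_group carrier_FactGroup)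

lemma order_Mod: "N \<lhd> G \<Longrightarrow> order (G Mod N) = order G div card N"
  using card_subgroup_pos[OF normal_imp_subgroup]
  by (simp add: FactGroup_def order_def flip: lagrange[OF normal_imp_subgroup, unfolded order_def])

lemma rcos_eq_one_iff:
  assumes "N \<lhd> G" "x \<in> carrier G"
  shows "N #> x = \<one>\<^bsub>G Mod N\<^esub> \<longleftrightarrow> x \<in> N"
  using coset_join1[OF _ assms(2) normal_imp_subgroup[OF assms(1)]] coset_join2[OF assms(2) normal_imp_subgroup[OF assms(1)]]
    subgroup.subset[OF normal_imp_subgroup[OF assms(1)]] by auto

end


section \<open>The \<open>\<sigma>\<close>-nilpotent residual\<close>

context fin_group
begin

text \<open>In each \<sigma>-primary factor one of the two components is trivial, since the order of
  the factor involves at most one class; so the images commute componentwise.\<close>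

lemma sigma_nilpotent_commute:
  assumes \<sigma>: "sigma_partition \<sigma>" and nil: "sigma_nilpotent \<sigma> G"
    and s: "s \<in> \<sigma>" and x: "pi_elt G s x" and y: "pi_elt G (- s) y"
  shows "x \<otimes> y = y \<otimes> x"
proof -
  obtain \<H> where \<H>: "\<And>H. H \<in> \<H> \<Longrightarrow> subgroup H G" "\<And>H. H \<in> \<H> \<Longrightarrow> sigma_primary \<sigma> (G\<lparr>carrier := H\<rparr>)"
    and iso: "G \<cong> product_group \<H> (\<lambda>H. G\<lparr>carrier := H\<rparr>)"
    using nil unfolding sigma_nilpotent_def by blast
  obtain \<phi> where \<phi>: "\<phi> \<in> iso G (product_group \<H> (\<lambda>H. G\<lparr>carrier := H\<rparr>))"
    using iso unfolding is_iso_def by blast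
  have ph: "\<phi> \<in> hom G (product_group \<H> (\<lambda>H. G\<lparr>carrier := H\<rparr>))" and inj: "inj_on \<phi> (carrier G)"
    using \<phi> by (auto simp: iso_def bij_betw_def)
  have mem: "\<phi> g \<in> (\<Pi>\<^sub>E H\<in>\<H>. H)" if "g \<in> carrier G" for g
    using ph that by (auto simp: hom_def)
  have mul: "\<phi> (a \<otimes> b) = (\<lambda>H\<in>\<H>. \<phi> a H \<otimes> \<phi> b H)" if "a \<in> carrier G" "b \<in> carrier G" for a b
    using hom_mult[OF ph that] by simp
  have comm: "\<phi> x H \<otimes> \<phi> y H = \<phi> y H \<otimes> \<phi> x H" if H: "H \<in> \<H>" for H
  proof -
    interpret H: fin_group "G\<lparr>carrier := H\<rparr>" by (rule fin_group_subgroup[OF \<H>(1)[OF H]])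
    have "(\<lambda>g. \<phi> g H) \<in> hom G (G\<lparr>carrier := H\<rparr>)"
      using H mem mul by (auto simp: hom_def PiE_iff)
    then interpret hom: group_hom G "G\<lparr>carrier := H\<rparr>" "\<lambda>g. \<phi> g H"
      by (rule group_hom.intro[OF is_group H.is_group group_hom_axioms.intro])
    let ?P = "prime_factors (order (G\<lparr>carrier := H\<rparr>))"
    note a = hom.pi_elt_hom[OF x] and b = hom.pi_elt_hom[OF y]
    have "\<phi> x H = \<one> \<or> \<phi> y H = \<one>"
    proof (rule disjCI)
      assume ne: "\<phi> y H \<noteq> \<one>"
      show "\<phi> x H = \<one>"
      proof (rule ccontr)
        assume ne': "\<phi> x H \<noteq> \<one>"
        have "s \<inter> ?P \<noteq> {}"
          using ne' H.pi_elt_disjoint[OF a H.pi_elt_order[OF pi_elt_carrier[OF a]]] by auto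
        then have s1: "s \<in> sigma_of \<sigma> (order (G\<lparr>carrier := H\<rparr>))" using s by (auto simp: sigma_of_def)
        have "- s \<inter> ?P \<noteq> {}"
          using ne H.pi_elt_disjoint[OF b H.pi_elt_order[OF pi_elt_carrier[OF b]]] by auto
        then obtain p where p: "p \<in> ?P" "p \<notin> s" by auto
        then obtain t where t: "t \<in> \<sigma>" "p \<in> t" using sigma_partition_cover[OF \<sigma>] by (meson in_prime_factors_imp_prime)
        then have t1: "t \<in> sigma_of \<sigma> (order (G\<lparr>carrier := H\<rparr>))" using p by (auto simp: sigma_of_def)
        have "card (sigma_of \<sigma> (order (G\<lparr>carrier := H\<rparr>))) \<le> 1" using \<H>(2)[OF H] unfolding sigma_primary_def .
        then have "s = t" using s1 t1 finite_sigma_of[OF \<sigma>] by (metis card_le_Suc0_iff_eq One_nat_def)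
        then show False using t p by simp
      qed
    qed
    moreover have "\<phi> x H \<in> carrier G" "\<phi> y H \<in> carrier G"
      using subgroup.mem_carrier[OF \<H>(1)[OF H]] pi_elt_carrier[OF a] pi_elt_carrier[OF b] by auto
    ultimately show ?thesis by auto
  qed
  have "\<phi> (x \<otimes> y) = \<phi> (y \<otimes> x)"
    using mul[of x y] mul[of y x] comm x y by (auto simp: pi_elt_carrier restrict_def)
  then show ?thesis using inj x y by (auto dest: inj_onD simp: pi_elt_carrier)
qed

lemma normal_hall_mem:
  assumes "hall_sigma_subgroup s G H" "H \<lhd> G" "pi_elt G s x"
  shows "x \<in> H"
  using normal_contains_coprime[OF assms(2,3)] hall_subgroupD(3)[OF assms(1)] by blast

text \<open>The product of the normal Hall subgroups for all other classes. Its order divides the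
  product of their orders, and containing each of them forces the index to be an
  \<open>s\<close>-number.\<close>

lemma normal_hall_complement:
  assumes \<sigma>: "sigma_partition \<sigma>" and s: "s \<in> \<sigma>"
    and F: "\<And>t. t \<in> \<sigma> \<Longrightarrow> hall_sigma_subgroup t G (F t)" "\<And>t. t \<in> \<sigma> \<Longrightarrow> F t \<lhd> G"
  obtains N where "N \<lhd> G" "prime_factors (card N) \<subseteq> - s" "prime_factors (order G div card N) \<subseteq> s"
proof -
  have "\<exists>N. N \<lhd> G \<and> prime_factors (card N) \<subseteq> \<Union>J \<and> (\<forall>t\<in>J. F t \<subseteq> N)"
    if "finite J" "J \<subseteq> \<sigma>" for J
    using that
  proof (induction J rule: finite_induct)
    case empty
    then show ?case using one_is_normal by (intro exI[of _ "{\<one>}"]) auto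
  next
    case (insert t J)
    then obtain N where N: "N \<lhd> G" "prime_factors (card N) \<subseteq> \<Union>J" "\<And>t. t \<in> J \<Longrightarrow> F t \<subseteq> N" by auto
    have t: "t \<in> \<sigma>" using insert by auto
    note h = hall_subgroupD[OF F(1)[OF t]]
    note sN = normal_imp_subgroup[OF N(1)]
    note sm = set_mult_normal_subgroup[OF F(2)[OF t] sN]
    have nm: "N <#> F t \<lhd> G" by (rule normal_subgroup_set_mult_closed[OF N(1) F(2)[OF t]])
    have "prime_factors (card (N <#> F t)) \<subseteq> prime_factors (card N * card (F t))"
      using card_set_mult_dvd(1)[OF sN h(1) sm(1)] card_subgroup_pos[OF sN] card_subgroup_pos[OF h(1)]
      by (intro prime_factors_mono_dvd) auto
    also have "\<dots> \<subseteq> \<Union>(insert t J)"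
      using h(2) N(2) card_subgroup_pos[OF sN] card_subgroup_pos[OF h(1)] by (auto simp: prime_factors_mult_nat)
    finally have "prime_factors (card (N <#> F t)) \<subseteq> \<Union>(insert t J)" .
    moreover have "\<forall>t'\<in>insert t J. F t' \<subseteq> N <#> F t" using sm N(3) by auto
    ultimately show ?case using nm by blast
  qed
  from this[of "sigma_of \<sigma> (order G) - {s}"]
  have "\<exists>N. N \<lhd> G \<and> prime_factors (card N) \<subseteq> \<Union>(sigma_of \<sigma> (order G) - {s}) \<and>
      (\<forall>t\<in>sigma_of \<sigma> (order G) - {s}. F t \<subseteq> N)"
    using finite_sigma_of[OF \<sigma>] unfolding sigma_of_def by blast
  then obtain N where N: "N \<lhd> G" "prime_factors (card N) \<subseteq> \<Union>(sigma_of \<sigma> (order G) - {s})"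
    "\<And>t. t \<in> sigma_of \<sigma> (order G) \<Longrightarrow> t \<noteq> s \<Longrightarrow> F t \<subseteq> N"
    by auto
  note sN = normal_imp_subgroup[OF N(1)]
  have "prime_factors (card N) \<subseteq> - s"
  proof
    fix p assume "p \<in> prime_factors (card N)"
    then obtain t where t: "t \<in> \<sigma>" "t \<noteq> s" "p \<in> t" using N(2) unfolding sigma_of_def by blast
    then show "p \<in> - s" using sigma_partition_disjoint[OF \<sigma> s t(1) _ t(3)] by auto
  qed
  moreover have "prime_factors (order G div card N) \<subseteq> s"
  proof
    fix p assume p: "p \<in> prime_factors (order G div card N)"
    then have pp: "prime p" by auto
    obtain t where t: "t \<in> \<sigma>" "p \<in> t" using sigma_partition_cover[OF \<sigma> pp] by blast
    show "p \<in> s"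
    proof (rule ccontr)
      assume "p \<notin> s"
      then have ts: "t \<noteq> s" using t by auto
      have "p \<in> prime_factors (order G)"
        using p order_eq_index[OF sN] order_pos by (metis dvd_triv_left prime_factors_mono_dvd subsetD)
      then have "t \<in> sigma_of \<sigma> (order G)" using t by (auto simp: sigma_of_iff)
      then have FN: "F t \<subseteq> N" using N(3) ts by blast
      note h = hall_subgroupD[OF F(1)[OF t(1)]]
      have "order G div card N dvd order G div card (F t)"
        using index_dvd_index[OF card_subgroup_mono_dvd[OF h(1) sN FN] card_subgroup_dvd[OF sN] card_subgroup_pos[OF sN]] .
      then have "p \<in> prime_factors (order G div card (F t))"
        using p index_pos[OF h(1)] prime_factors_mono_dvd by blast
      then show False using h(3) t(2) by auto
    qed
  qed
  ultimately show ?thesis using that N(1) by blast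
qed

text \<open>The power map onto \<open>s\<close>-parts is multiplicative, because \<open>F s\<close>
  and its normal complement meet trivially and therefore centralise each other.\<close>

lemma normal_hall_projection:
  assumes \<sigma>: "sigma_partition \<sigma>" and s: "s \<in> \<sigma>"
    and F: "\<And>t. t \<in> \<sigma> \<Longrightarrow> hall_sigma_subgroup t G (F t)" "\<And>t. t \<in> \<sigma> \<Longrightarrow> F t \<lhd> G"
  shows "\<exists>k::nat. (\<forall>x\<in>carrier G. x [^] k \<in> F s) \<and>
    (\<forall>x\<in>carrier G. \<forall>y\<in>carrier G. (x \<otimes> y) [^] k = x [^] k \<otimes> y [^] k) \<and>
    (\<forall>x. pi_elt G s x \<longrightarrow> x [^] k = x)"
proof -
  obtain N where N: "N \<lhd> G" "prime_factors (card N) \<subseteq> - s" "prime_factors (order G div card N) \<subseteq> s"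
    using normal_hall_complement[OF \<sigma> s F] by blast
  note sN = normal_imp_subgroup[OF N(1)] and h = hall_subgroupD[OF F(1)[OF s]]
  have disj: "F s \<inter> N = {\<one>}"
  proof -
    have "x = \<one>" if "x \<in> F s" "x \<in> N" for x
      using pi_elt_disjoint[OF pi_elt_mem_subgroup[OF h(1,2) that(1)] pi_elt_mem_subgroup[OF sN N(2) that(2)]] by simp
    then show ?thesis using subgroup.one_closed[OF h(1)] subgroup.one_closed[OF sN] by blast
  qed
  show ?thesis
  proof (rule ex_part_exponent[of s])
    fix k l :: nat assume kl: "\<And>x. x \<in> carrier G \<Longrightarrow> x = x [^] k \<otimes> x [^] l"
      "\<And>x. x \<in> carrier G \<Longrightarrow> pi_elt G s (x [^] k)" "\<And>x. x \<in> carrier G \<Longrightarrow> pi_elt G (- s) (x [^] l)"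
      "\<And>x. pi_elt G s x \<Longrightarrow> x [^] k = x" "\<And>x. pi_elt G (- s) x \<Longrightarrow> x [^] k = \<one>"
    have F1: "x [^] k \<in> F s" if "x \<in> carrier G" for x
      using normal_hall_mem[OF F(1)[OF s] F(2)[OF s] kl(2)[OF that]] .
    have N1: "x [^] l \<in> N" if "x \<in> carrier G" for x
      using normal_contains_coprime[OF N(1) kl(3)[OF that]] N(3) by simp
    have "(x \<otimes> y) [^] k = x [^] k \<otimes> y [^] k" if x: "x \<in> carrier G" and y: "y \<in> carrier G" for x y
    proof -
      let ?a = "x [^] k \<otimes> y [^] k" let ?b = "x [^] l \<otimes> y [^] l"
      have "x \<otimes> y = (x [^] k \<otimes> x [^] l) \<otimes> (y [^] k \<otimes> y [^] l)" using kl(1)[OF x] kl(1)[OF y] by simp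
      also have "\<dots> = x [^] k \<otimes> (x [^] l \<otimes> y [^] k) \<otimes> y [^] l" using x y by (simp add: m_assoc)
      also have "x [^] l \<otimes> y [^] k = y [^] k \<otimes> x [^] l"
        using normal_disjoint_commute[OF F(2)[OF s] N(1) disj F1[OF y] N1[OF x]] by simp
      also have "x [^] k \<otimes> (y [^] k \<otimes> x [^] l) \<otimes> y [^] l = ?a \<otimes> ?b" using x y by (simp add: m_assoc)
      finally have e: "x \<otimes> y = ?a \<otimes> ?b" .
      have a: "?a \<in> F s" using F1 x y subgroup.m_closed[OF h(1)] by simp
      have b: "?b \<in> N" using N1 x y subgroup.m_closed[OF sN] by simp
      have "(x \<otimes> y) [^] k = ?a [^] k \<otimes> ?b [^] k"
        unfolding e using normal_disjoint_commute[OF F(2)[OF s] N(1) disj a b] x y by (intro pow_mult_distrib) auto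
      also have "?a [^] k = ?a" using kl(4)[OF pi_elt_mem_subgroup[OF h(1,2) a]] .
      also have "?b [^] k = \<one>" using kl(5)[OF pi_elt_mem_subgroup[OF sN N(2) b]] .
      finally show ?thesis using x y by simp
    qed
    then show ?thesis using F1 kl(4) by (intro exI[of _ k]) simp
  qed
qed

text \<open>The isomorphism onto the product of the normal Hall subgroups is \<open>x \<mapsto> (x\<^sup>m)\<close>, with one exponent
  \<open>m\<close> from the Chinese remainder theorem for each factor.\<close>
lemma sigma_nilpotentI:
  assumes \<sigma>: "sigma_partition \<sigma>"
    and F: "\<And>t. t \<in> \<sigma> \<Longrightarrow> hall_sigma_subgroup t G (F t)" "\<And>t. t \<in> \<sigma> \<Longrightarrow> F t \<lhd> G"
  shows "sigma_nilpotent \<sigma> G"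
proof -
  let ?S = "sigma_of \<sigma> (order G)"
  define \<H> where "\<H> = F ` ?S"
  have S\<sigma>: "s \<in> \<sigma>" if "s \<in> ?S" for s using that by (simp add: sigma_of_iff)
  have fin\<H>: "finite \<H>" unfolding \<H>_def using finite_sigma_of[OF \<sigma>] by simp
  have sub: "subgroup H G" if "H \<in> \<H>" for H
    using that hall_subgroupD(1)[OF F(1)] S\<sigma> unfolding \<H>_def by auto
  have "\<exists>k::nat. (\<forall>x\<in>carrier G. x [^] k \<in> H) \<and>
    (\<forall>x\<in>carrier G. \<forall>y\<in>carrier G. (x \<otimes> y) [^] k = x [^] k \<otimes> y [^] k) \<and>
    (\<forall>s\<in>?S. H = F s \<longrightarrow> (\<forall>x. pi_elt G s x \<longrightarrow> x [^] k = x))" if H: "H \<in> \<H>" for H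
  proof -
    obtain s where s: "s \<in> ?S" "H = F s" using H unfolding \<H>_def by blast
    obtain k :: nat where k: "\<And>x. x \<in> carrier G \<Longrightarrow> x [^] k \<in> F s"
      "\<And>x y. x \<in> carrier G \<Longrightarrow> y \<in> carrier G \<Longrightarrow> (x \<otimes> y) [^] k = x [^] k \<otimes> y [^] k"
      "\<And>x. pi_elt G s x \<Longrightarrow> x [^] k = x"
      using normal_hall_projection[OF \<sigma> S\<sigma>[OF s(1)] F] by blast
    \<comment> \<open>The product is indexed by subgroups, not by classes, so the exponent is
      checked for every class \<open>t\<close> with \<open>F t = F s\<close>; this avoids having to
      show \<open>F\<close> injective.\<close>
    have "x [^] k = x" if t: "t \<in> ?S" "F s = F t" "pi_elt G t x" for t x
    proof -
      have "x \<in> F s" using normal_hall_mem[OF F(1)[OF S\<sigma>[OF t(1)]] F(2)[OF S\<sigma>[OF t(1)]] t(3)] t(2) by simp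
      then show ?thesis using k(3) pi_elt_mem_subgroup[OF hall_subgroupD(1,2)[OF F(1)[OF S\<sigma>[OF s(1)]]]] by blast
    qed
    then show ?thesis using k s(2) by (intro exI[of _ k]) simp
  qed
  then have "\<exists>m. \<forall>H\<in>\<H>. (\<forall>x\<in>carrier G. x [^] (m H::nat) \<in> H) \<and>
    (\<forall>x\<in>carrier G. \<forall>y\<in>carrier G. (x \<otimes> y) [^] m H = x [^] m H \<otimes> y [^] m H) \<and>
    (\<forall>s\<in>?S. H = F s \<longrightarrow> (\<forall>x. pi_elt G s x \<longrightarrow> x [^] m H = x))"
    by (intro bchoice ballI)
  then obtain m where m: "\<forall>H\<in>\<H>. (\<forall>x\<in>carrier G. x [^] (m H::nat) \<in> H) \<and>
    (\<forall>x\<in>carrier G. \<forall>y\<in>carrier G. (x \<otimes> y) [^] m H = x [^] m H \<otimes> y [^] m H) \<and>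
    (\<forall>s\<in>?S. H = F s \<longrightarrow> (\<forall>x. pi_elt G s x \<longrightarrow> x [^] m H = x))" ..
  have m1: "x [^] m H \<in> H" if "H \<in> \<H>" "x \<in> carrier G" for x H
    using bspec[OF m that(1)] that(2) by simp
  have m2: "(x \<otimes> y) [^] m H = x [^] m H \<otimes> y [^] m H" if "H \<in> \<H>" "x \<in> carrier G" "y \<in> carrier G" for x y H
    using bspec[OF m that(1)] that(2,3) by simp
  have m3: "x [^] m (F s) = x" if "F s \<in> \<H>" "s \<in> ?S" "pi_elt G s x" for x s
    using bspec[OF m that(1)] that(2,3) by blast
  define \<psi> where "\<psi> x = (\<lambda>H\<in>\<H>. x [^] m H)" for x
  let ?P = "product_group \<H> (\<lambda>H. G\<lparr>carrier := H\<rparr>)"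
  have gP: "group ?P" using sub subgroup_imp_group by (intro product_group) simp
  have hom: "\<psi> \<in> hom G ?P"
    unfolding hom_def \<psi>_def using m1 m2 by (auto simp: restrict_def fun_eq_iff)
  interpret hm: group_hom G ?P \<psi>
    by (rule group_hom.intro[OF is_group gP group_hom_axioms.intro[OF hom]])
  have inj: "inj_on \<psi> (carrier G)"
  proof (rule hm.inj_on_one_iff[THEN iffD2], intro allI impI)
    fix x assume x: "x \<in> carrier G" and one: "\<psi> x = \<one>\<^bsub>?P\<^esub>"
    have x1: "x [^] m H = \<one>" if "H \<in> \<H>" for H
      using fun_cong[OF one, of H] that unfolding \<psi>_def by simp
    have "x \<in> {\<one>}"
    proof (rule prime_parts_mem[OF triv_subgroup x])
      fix p and k :: nat assume p: "prime p" and pk: "pi_elt G {p} (x [^] k)"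
      show "x [^] k \<in> {\<one>}"
      proof (cases "p \<in> prime_factors (order G)")
        case False
        then show ?thesis
          using pi_elt_disjoint[OF pk pi_elt_order] x by simp
      next
        case True
        obtain s where s: "s \<in> \<sigma>" "p \<in> s" using sigma_partition_cover[OF \<sigma> p] by blast
        have sS: "s \<in> ?S" using s True by (auto simp: sigma_of_iff)
        have FH: "F s \<in> \<H>" using sS unfolding \<H>_def by blast
        have "pi_elt G s (x [^] k)" using pi_elt_mono[OF pk, of s] s by simp
        then have "(x [^] k) [^] m (F s) = x [^] k" by (rule m3[OF FH sS])
        moreover have "(x [^] k) [^] m (F s) = (x [^] m (F s)) [^] k" using x by (simp add: nat_pow_pow mult.commute)
        ultimately show ?thesis using x1[OF FH] by simp
      qed
    qed
    then show "x = \<one>" by simp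
  qed
  \<comment> \<open>Surjectivity of \<open>\<psi>\<close> is obtained by counting: it is injective,
    and the order of the product divides the order of the group.\<close>
  have cop: "(\<Prod>H\<in>\<H>. card H) dvd order G"
  proof -
    have "(\<Prod>H\<in>F ` J. card H) dvd order G \<and> prime_factors (\<Prod>H\<in>F ` J. card H) \<subseteq> \<Union>J \<and> 0 < (\<Prod>H\<in>F ` J. card H)"
      if "finite J" "J \<subseteq> ?S" for J
      using that
    proof (induction J rule: finite_induct)
      case (insert t J)
      show ?case
      proof (cases "F t \<in> F ` J")
        case True
        then have "F ` insert t J = F ` J" by auto
        then show ?thesis using insert by auto
      next
        case False
        have t: "t \<in> \<sigma>" using insert S\<sigma> by auto
        note h = hall_subgroupD[OF F(1)[OF t]]
        have eq: "(\<Prod>H\<in>F ` insert t J. card H) = card (F t) * (\<Prod>H\<in>F ` J. card H)"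
          using False insert(1) by simp
        have IH: "(\<Prod>H\<in>F ` J. card H) dvd order G" "prime_factors (\<Prod>H\<in>F ` J. card H) \<subseteq> \<Union>J" "0 < (\<Prod>H\<in>F ` J. card H)"
          using insert by auto
        have "\<Union>J \<subseteq> - t" using sigma_partition_disjoint[OF \<sigma> t] S\<sigma> insert by blast
        then have "coprime (card (F t)) (\<Prod>H\<in>F ` J. card H)"
          using coprime_if_prime_factors_disjoint[OF card_subgroup_pos[OF h(1)] IH(3) h(2)] IH(2) by blast
        then have "card (F t) * (\<Prod>H\<in>F ` J. card H) dvd order G"
          using IH(1) card_subgroup_dvd[OF h(1)] by (intro divides_mult)
        moreover have "prime_factors (card (F t) * (\<Prod>H\<in>F ` J. card H)) \<subseteq> \<Union>(insert t J)"
          unfolding prime_factors_mult_nat[OF card_subgroup_pos[OF h(1)] IH(3)] using h(2) IH(2) by blast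
        ultimately show ?thesis unfolding eq using IH(3) card_subgroup_pos[OF h(1)] by simp
      qed
    qed simp
    from this[of ?S] show ?thesis unfolding \<H>_def using finite_sigma_of[OF \<sigma>] by simp
  qed
  have "card (carrier ?P) = (\<Prod>H\<in>\<H>. card H)" using fin\<H> by (simp add: card_PiE)
  then have cle: "card (carrier ?P) \<le> card (carrier G)"
    using dvd_imp_le[OF cop order_pos] by (simp add: order_def)
  have finP: "finite (carrier ?P)" using fin\<H> sub finite_subgroup by (auto intro!: finite_PiE)
  have "\<psi> ` carrier G = carrier ?P"
    using card_seteq[OF finP, of "\<psi> ` carrier G"] cle card_image[OF inj] hm.hom_closed by (simp add: image_subset_iff)
  then have "\<psi> \<in> iso G ?P" using hom inj by (simp add: iso_def bij_betw_def)
  then have "G \<cong> ?P" unfolding is_iso_def by blast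
  moreover have "sigma_primary \<sigma> (G\<lparr>carrier := H\<rparr>)" if H: "H \<in> \<H>" for H
  proof -
    obtain s where s: "s \<in> ?S" "H = F s" using H unfolding \<H>_def by blast
    have "sigma_of \<sigma> (card H) \<subseteq> {s}"
    proof
      fix t assume "t \<in> sigma_of \<sigma> (card H)"
      then obtain p where p: "t \<in> \<sigma>" "p \<in> prime_factors (card H)" "p \<in> t" unfolding sigma_of_def by blast
      then have "p \<in> s" using s(2) hall_subgroupD(2)[OF F(1)[OF S\<sigma>[OF s(1)]]] by blast
      then show "t \<in> {s}" using sigma_partition_disjoint[OF \<sigma> S\<sigma>[OF s(1)] p(1) _ p(3)] by simp
    qed
    then have "card (sigma_of \<sigma> (card H)) \<le> card {s}" by (intro card_mono) auto
    then show ?thesis unfolding sigma_primary_def by (simp add: order_def)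
  qed
  ultimately show ?thesis unfolding sigma_nilpotent_def using fin\<H> sub by blast
qed

text \<open>A \<sigma>-nilpotent quotient kills the commutators. Conversely, modulo them the image
  of each Hall \<open>s\<close>-subgroup is centralised by all \<open>- s\<close>-elements and so is
  normal, which makes the quotient \<sigma>-nilpotent.\<close>

theorem sigma_nilp_residual_eq:
  assumes \<sigma>: "sigma_partition \<sigma>" and hall: "\<And>s. s \<in> \<sigma> \<Longrightarrow> \<exists>H. hall_sigma_subgroup s G H"
  shows "sigma_nilp_residual \<sigma> G = sigma_comm \<sigma> G"
proof
  show "sigma_comm \<sigma> G \<subseteq> sigma_nilp_residual \<sigma> G"
    unfolding sigma_nilp_residual_def
  proof (rule Inter_greatest)
    fix N assume "N \<in> {N. N \<lhd> G \<and> sigma_nilpotent \<sigma> (G Mod N)}"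
    then have N: "N \<lhd> G" "sigma_nilpotent \<sigma> (G Mod N)" by auto
    interpret e: fin_epi G "G Mod N" "(#>) N" by (rule fin_epi_Mod[OF N(1)])
    show "sigma_comm \<sigma> G \<subseteq> N"
    proof (rule sigma_comm_minimal[OF normal_imp_subgroup[OF N(1)]])
      fix s x y assume s: "s \<in> \<sigma>" "pi_elt G s x" "pi_elt G (- s) y"
      have "N #> cm G x y = \<one>\<^bsub>G Mod N\<^esub>"
        using e.H.sigma_nilpotent_commute[OF \<sigma> N(2) s(1) e.pi_elt_hom[OF s(2)] e.pi_elt_hom[OF s(3)]]
          s by (simp only: e.cm_hom pi_elt_carrier e.H.cm_eq_one_iff e.hom_closed)
      then show "cm G x y \<in> N" using rcos_eq_one_iff[OF N(1)] s by (simp add: pi_elt_carrier)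
    qed
  qed
next
  let ?N = "sigma_comm \<sigma> G"
  have N: "?N \<lhd> G" by (rule sigma_comm_normal)
  interpret e: fin_epi G "G Mod ?N" "(#>) ?N" by (rule fin_epi_Mod[OF N])
  have "\<exists>F. \<forall>s\<in>\<sigma>. hall_sigma_subgroup s G (F s)" using hall by (intro bchoice ballI)
  then obtain F where F: "\<forall>s\<in>\<sigma>. hall_sigma_subgroup s G (F s)" ..
  let ?F = "\<lambda>s. (#>) ?N ` F s"
  have hF: "hall_sigma_subgroup s (G Mod ?N) (?F s)" if "s \<in> \<sigma>" for s
    using e.hall_image F that by simp
  have "?F s \<lhd> (G Mod ?N)" if s: "s \<in> \<sigma>" for s
  proof -
    note h = e.H.hall_subgroupD[OF hF[OF s]]
    have "normalizer_of (G Mod ?N) (?F s) = carrier (G Mod ?N)"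
    proof (rule e.H.subgroup_eq_carrierI[OF e.H.normalizer_of_subgroup[OF subgroup.subset[OF h(1)]] h(1) _ h(3)])
      show "?F s \<subseteq> normalizer_of (G Mod ?N) (?F s)"
        unfolding normalizer_of_def cj_def using subgroup.mem_carrier[OF h(1)] subgroup.m_closed[OF h(1)] subgroup.m_inv_closed[OF h(1)]
        by (simp add: subset_iff)
      fix y assume y: "pi_elt (G Mod ?N) (- s) y"
      have "cj (G Mod ?N) v y = v" if v: "v \<in> ?F s" for v
      proof -
        have "pi_elt (G Mod ?N) s v" by (rule e.H.pi_elt_mem_subgroup[OF h(1,2) v])
        then obtain x' where x': "pi_elt G s x'" "?N #> x' = v" by (rule e.pi_elt_lift)
        obtain y' where y': "pi_elt G (- s) y'" "?N #> y' = y" using y by (rule e.pi_elt_lift)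
        have "?N #> cm G x' y' = \<one>\<^bsub>G Mod ?N\<^esub>"
          using rcos_eq_one_iff[OF N] cm_mem_sigma_comm[OF s x'(1) y'(1)] x'(1) y'(1)
          by (simp add: pi_elt_carrier)
        then have "cm (G Mod ?N) v y = \<one>\<^bsub>G Mod ?N\<^esub>"
          using e.cm_hom[OF pi_elt_carrier[OF x'(1)] pi_elt_carrier[OF y'(1)]] x'(2) y'(2) by (simp only:)
        then show ?thesis
          using e.H.cj_eq_cm[OF subgroup.mem_carrier[OF h(1) v] pi_elt_carrier[OF y]]
            e.H.r_one[OF subgroup.mem_carrier[OF h(1) v]] by (simp only:)
      qed
      then show "y \<in> normalizer_of (G Mod ?N) (?F s)"
        unfolding normalizer_of_def using pi_elt_carrier[OF y] by simp
    qed
    then show ?thesis using e.H.normal_if_normalizer[OF h(1)] by blast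
  qed
  then have "sigma_nilpotent \<sigma> (G Mod ?N)" using e.H.sigma_nilpotentI[OF \<sigma> hF] by blast
  then show "sigma_nilp_residual \<sigma> G \<subseteq> ?N" unfolding sigma_nilp_residual_def using N by blast
qed

end

lemma (in fin_epi) sigma_nilp_residual_image:
  assumes \<sigma>: "sigma_partition \<sigma>" and hall: "\<And>s. s \<in> \<sigma> \<Longrightarrow> \<exists>A. hall_sigma_subgroup s G A"
  shows "sigma_nilp_residual \<sigma> H = sigma_comm \<sigma> H"
proof (rule H.sigma_nilp_residual_eq[OF \<sigma>])
  fix t assume "t \<in> \<sigma>"
  then obtain A where "hall_sigma_subgroup t G A" using hall by blast
  then have "hall_sigma_subgroup t H (h ` A)" by (rule hall_image)
  then show "\<exists>A. hall_sigma_subgroup t H A" ..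
qed


section \<open>Sufficiency\<close>

text \<open>For abelian \<open>D\<close> this is the Hall \<open>T\<close>-subgroup of
  \<open>D\<close>; with \<open>T = - s\<close> it becomes the subgroup
  \<open>O_upper s G D\<close>.\<close>

definition pi_part :: "('a, 'b) monoid_scheme \<Rightarrow> nat set \<Rightarrow> 'a set \<Rightarrow> 'a set" where
  "pi_part G T D = {d \<in> D. pi_elt G T d}"

section \<open>Hall parts of an abelian normal subgroup\<close>

context fin_group
begin

lemma subgroup_le_normalizer:
  assumes B: "subgroup B G"
  shows "B \<subseteq> normalizer_of G B"
  unfolding normalizer_of_def cj_def
  using subgroup.mem_carrier[OF B] subgroup.m_closed[OF B] subgroup.m_inv_closed[OF B] by (simp add: subset_iff)

text \<open>A \<open>- s\<close>-element \<open>y\<close> sends \<open>e\<close> to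
  \<open>e \<otimes> cm G e y\<close>, and the commutator lies in the residual, hence in
  \<open>E\<close>.\<close>

lemma hall_normal_if_residual_le:
  assumes s: "s \<in> \<sigma>" and E: "hall_sigma_subgroup s G E" and D: "sigma_comm \<sigma> G \<subseteq> E"
  shows "E \<lhd> G"
proof -
  note h = hall_subgroupD[OF E]
  have "normalizer_of G E = carrier G"
  proof (rule subgroup_eq_carrierI[OF normalizer_of_subgroup[OF subgroup.subset[OF h(1)]] h(1) subgroup_le_normalizer[OF h(1)] h(3)])
    fix y assume y: "pi_elt G (- s) y"
    have "cj G e y \<in> E" if e: "e \<in> E" for e
    proof -
      have "cm G e y \<in> E"
        using cm_mem_sigma_comm[OF s pi_elt_mem_subgroup[OF h(1,2) e] y] D by blast
      then have "e \<otimes> cm G e y \<in> E" by (rule subgroup.m_closed[OF h(1) e])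
      then show ?thesis using cj_eq_cm[OF subgroup.mem_carrier[OF h(1) e] pi_elt_carrier[OF y]] by simp
    qed
    then show "y \<in> normalizer_of G E" unfolding normalizer_of_def using pi_elt_carrier[OF y] by simp
  qed
  then show ?thesis by (rule normal_if_normalizer[OF h(1)])
qed

text \<open>Modulo \<open>N\<close> the elements commute, so the power of the product splits. In the
  applications \<open>b\<close> is a commutator with \<open>a\<close>, or is chosen so that
  \<open>a \<otimes> b\<close> has a known order.\<close>

lemma pow_commute_mod:
  assumes N: "N \<lhd> G" and a: "a \<in> carrier G" and b: "b \<in> carrier G" and ab: "cm G a b \<in> N"
    and 1: "(a \<otimes> b) [^] (m::nat) \<in> N" "a [^] m \<in> N"
  shows "b [^] m \<in> N"
proof -
  interpret e: fin_epi G "G Mod N" "(#>) N" by (rule fin_epi_Mod[OF N])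
  let ?a = "N #> a" and ?b = "N #> b"
  have c: "?a \<in> carrier (G Mod N)" "?b \<in> carrier (G Mod N)" using a b by (blast intro: e.hom_closed)+
  have "cm (G Mod N) ?a ?b = \<one>\<^bsub>G Mod N\<^esub>"
    using rcos_eq_one_iff[OF N cm_closed[OF a b]] ab e.cm_hom[OF a b] by argo
  then have comm: "?a \<otimes>\<^bsub>G Mod N\<^esub> ?b = ?b \<otimes>\<^bsub>G Mod N\<^esub> ?a" using e.H.cm_eq_one_iff[OF c] by blast
  have "(?a \<otimes>\<^bsub>G Mod N\<^esub> ?b) [^]\<^bsub>G Mod N\<^esub> m = \<one>\<^bsub>G Mod N\<^esub>"
    using rcos_eq_one_iff[OF N, of "(a \<otimes> b) [^] m"] 1(1) a b
      e.hom_nat_pow[of "a \<otimes> b" m] e.hom_mult[OF a b] by (metis m_closed nat_pow_closed)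
  moreover have "?a [^]\<^bsub>G Mod N\<^esub> m = \<one>\<^bsub>G Mod N\<^esub>"
    using rcos_eq_one_iff[OF N, of "a [^] m"] 1(2) a e.hom_nat_pow[OF a, of m] by (metis nat_pow_closed)
  ultimately have "?b [^]\<^bsub>G Mod N\<^esub> m = \<one>\<^bsub>G Mod N\<^esub>"
    using e.H.pow_mult_distrib[OF comm c, of m] e.H.l_one[OF e.H.nat_pow_closed[OF c(2)], of m] by (simp only:)
  then show ?thesis using rcos_eq_one_iff[OF N, of "b [^] m"] b e.hom_nat_pow[OF b, of m] by (metis nat_pow_closed)
qed

lemma pi_part_subgroup:
  assumes D: "subgroup D G" and ab: "\<And>a b. a \<in> D \<Longrightarrow> b \<in> D \<Longrightarrow> a \<otimes> b = b \<otimes> a"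
  shows "subgroup (pi_part G T D) G"
proof (rule subgroupI)
  show "pi_part G T D \<subseteq> carrier G" unfolding pi_part_def by (auto dest: pi_elt_carrier)
  have "\<one> \<in> pi_part G T D" unfolding pi_part_def using subgroup.one_closed[OF D] by simp
  then show "pi_part G T D \<noteq> {}" by blast
qed (use subgroup.m_closed[OF D] subgroup.m_inv_closed[OF D] ab in \<open>auto simp: pi_part_def pi_elt_inv intro: pi_elt_mult_commute\<close>)

lemma pi_part_normal:
  assumes D: "D \<lhd> G" and ab: "\<And>a b. a \<in> D \<Longrightarrow> b \<in> D \<Longrightarrow> a \<otimes> b = b \<otimes> a"
  shows "pi_part G T D \<lhd> G"
  unfolding normal_iff_cj using pi_part_subgroup[OF normal_imp_subgroup[OF D] ab] D
  by (auto simp: pi_part_def pi_elt_cj normal_iff_cj)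

lemma pi_part_prime_factors:
  assumes D: "subgroup D G" and ab: "\<And>a b. a \<in> D \<Longrightarrow> b \<in> D \<Longrightarrow> a \<otimes> b = b \<otimes> a"
  shows "prime_factors (card (pi_part G T D)) \<subseteq> T"
  by (rule prime_factors_card_subgroupI[OF pi_part_subgroup[OF D ab]]) (simp_all add: pi_part_def)

lemma pi_parts_product:
  assumes D: "subgroup D G" and d: "d \<in> D"
  obtains a b where "a \<in> pi_part G T D" "b \<in> pi_part G (- T) D" "d = a \<otimes> b"
proof (rule ex_part_exponent[of T])
  fix k l :: nat
  assume kl: "\<And>x. x \<in> carrier G \<Longrightarrow> x = x [^] k \<otimes> x [^] l"
    "\<And>x. x \<in> carrier G \<Longrightarrow> pi_elt G T (x [^] k)" "\<And>x. x \<in> carrier G \<Longrightarrow> pi_elt G (- T) (x [^] l)"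
  have dc: "d \<in> carrier G" using subgroup.mem_carrier[OF D d] .
  show ?thesis
  proof (rule that)
    show "d [^] k \<in> pi_part G T D" "d [^] l \<in> pi_part G (- T) D"
      unfolding pi_part_def using kl(2,3)[OF dc] subgroup_pow_closed[OF D d] by auto
    show "d = d [^] k \<otimes> d [^] l" by (rule kl(1)[OF dc])
  qed
qed

text \<open>Modulo the \<open>- s\<close>-part every element of \<open>D\<close> is represented by
  its \<open>s\<close>-part, and any normal subgroup whose quotient is an \<open>s\<close>-group
  contains all \<open>- s\<close>-elements.\<close>

lemma O_upper_eq:
  assumes D: "subgroup D G" and ab: "\<And>a b. a \<in> D \<Longrightarrow> b \<in> D \<Longrightarrow> a \<otimes> b = b \<otimes> a"
  shows "O_upper s G D = pi_part G (- s) D"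
proof -
  let ?D = "G\<lparr>carrier := D\<rparr>" and ?K = "pi_part G (- s) D"
  interpret D: fin_group ?D by (rule fin_group_subgroup[OF D])
  have K: "?K = pi_part ?D (- s) D" unfolding pi_part_def using pi_elt_subgroup[OF D] by auto
  have KD: "?K \<lhd> ?D" unfolding K by (rule D.pi_part_normal) (use D.normal_self ab in auto)
  show ?thesis
  proof
    interpret e: fin_epi ?D "?D Mod ?K" "r_coset ?D ?K" by (rule D.fin_epi_Mod[OF KD])
    have "prime_factors (card (carrier (?D Mod ?K))) \<subseteq> s"
    proof (rule e.H.prime_factors_card_subgroupI[OF e.H.subgroup_self])
      fix z assume "z \<in> carrier (?D Mod ?K)"
      then obtain d where d: "d \<in> D" "z = ?K #>\<^bsub>?D\<^esub> d" using carrier_FactGroup[of ?D ?K] by auto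
      obtain a b where p: "a \<in> pi_part G s D" "b \<in> ?K" "d = a \<otimes> b" by (rule pi_parts_product[OF D d(1)])
      have aD: "a \<in> D" "b \<in> D" using p unfolding pi_part_def by auto
      have "z = (?K #>\<^bsub>?D\<^esub> a) \<otimes>\<^bsub>?D Mod ?K\<^esub> (?K #>\<^bsub>?D\<^esub> b)"
        unfolding d(2) p(3) using e.hom_mult[of a b] aD by simp
      also have "?K #>\<^bsub>?D\<^esub> b = \<one>\<^bsub>?D Mod ?K\<^esub>" using D.rcos_eq_one_iff[OF KD, of b] aD p(2) by simp
      also have "(?K #>\<^bsub>?D\<^esub> a) \<otimes>\<^bsub>?D Mod ?K\<^esub> \<one>\<^bsub>?D Mod ?K\<^esub> = ?K #>\<^bsub>?D\<^esub> a"
        using aD by (intro e.H.r_one e.hom_closed) simp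
      finally show "pi_elt (?D Mod ?K) s z"
        using e.pi_elt_hom[of s a] p(1) pi_elt_subgroup[OF D] unfolding pi_part_def by simp
    qed
    then show "O_upper s G D \<subseteq> ?K" unfolding O_upper_def using KD by (auto simp: order_def)
  next
    show "?K \<subseteq> O_upper s G D" unfolding O_upper_def
    proof (rule Inter_greatest, rule subsetI)
      fix N x assume "N \<in> {N. N \<lhd> ?D \<and> prime_factors (order (?D Mod N)) \<subseteq> s}" and x: "x \<in> ?K"
      then have N: "N \<lhd> ?D" "prime_factors (order ?D div card N) \<subseteq> s" using D.order_Mod by auto
      show "x \<in> N"
        by (rule D.normal_contains_coprime[OF N(1), of "- s"]) (use x N(2) pi_elt_subgroup[OF D] in \<open>auto simp: pi_part_def\<close>)
    qed
  qed
qed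

end

text \<open>\<open>\<pi>\<close> stands for the primes dividing \<open>|D|\<close>. It stays fixed on passing to a subgroup \<open>H\<close>, although
  \<open>D \<inter> H\<close> may involve fewer primes; this is what makes the assumptions hereditary.\<close>
locale sigma_T = fin_group +
  fixes \<sigma> :: "nat set set" and D :: "'a set" and \<pi> :: "nat set"
  assumes part: "sigma_partition \<sigma>"
    and D_iff: "\<And>x. x \<in> D \<longleftrightarrow> pi_elt G \<pi> x"
    and D_sub: "subgroup D G"
    and D_comm: "\<And>a b. a \<in> D \<Longrightarrow> b \<in> D \<Longrightarrow> a \<otimes> b = b \<otimes> a"
    and D_normal: "\<And>V. subgroup V G \<Longrightarrow> V \<subseteq> D \<Longrightarrow> V \<lhd> G"
    and cm_D: "\<And>s x y. s \<in> \<sigma> \<Longrightarrow> pi_elt G s x \<Longrightarrow> pi_elt G (- s) y \<Longrightarrow> cm G x y \<in> D"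
    and cm_s: "\<And>s x y. s \<in> \<sigma> \<Longrightarrow> pi_elt G s x \<Longrightarrow> pi_elt G (- \<pi>) x \<Longrightarrow> pi_elt G (- s) y \<Longrightarrow> pi_elt G (- s) (cm G x y)"
begin

text \<open>Elementwise substitute for \<sigma>-quasinormality, in which no Hall subgroup occurs.
  Only elements prime to \<open>\<pi>\<close> are tested, since the \<open>\<pi>\<close>-elements
  form \<open>D\<close>, all of whose subgroups are normal.\<close>

definition absorbs :: "'a set \<Rightarrow> bool" where
  "absorbs A \<longleftrightarrow> (\<forall>s\<in>\<sigma>. \<forall>a\<in>A. \<forall>y. pi_elt G s a \<and> pi_elt G (- \<pi>) a \<and> pi_elt G (- s) y \<longrightarrow> cm G a y \<in> A)"

lemma sigma_T_subgroup:
  assumes H: "subgroup H G"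
  shows "sigma_T (G\<lparr>carrier := H\<rparr>) \<sigma> (D \<inter> H) \<pi>"
proof -
  interpret H: fin_group "G\<lparr>carrier := H\<rparr>" by (rule fin_group_subgroup[OF H])
  note pe = pi_elt_subgroup[OF H]
  have DH: "subgroup (D \<inter> H) G" by (rule subgroups_Inter_pair[OF D_sub H])
  show ?thesis
  proof (rule sigma_T.intro[OF H.fin_group_axioms sigma_T_axioms.intro])
    fix V assume V: "subgroup V (G\<lparr>carrier := H\<rparr>)" "V \<subseteq> D \<inter> H"
    have "V \<lhd> G" using D_normal[OF incl_subgroup[OF H V(1)]] V(2) by blast
    then show "V \<lhd> G\<lparr>carrier := H\<rparr>" using normal_restrict_supergroup[OF H] V(2) by blast
  next
    show "subgroup (D \<inter> H) (G\<lparr>carrier := H\<rparr>)" by (rule subgroup_incl[OF DH H]) simp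
  next
    fix s x y assume s: "s \<in> \<sigma>" and "pi_elt (G\<lparr>carrier := H\<rparr>) s x" "pi_elt (G\<lparr>carrier := H\<rparr>) (- s) y"
    then have xy: "pi_elt G s x" "pi_elt G (- s) y" "x \<in> H" "y \<in> H" using pe by auto
    have cH: "cm G x y \<in> H" unfolding cm_def cj_def using xy subgroup.m_closed[OF H] subgroup.m_inv_closed[OF H] by simp
    then show "cm (G\<lparr>carrier := H\<rparr>) x y \<in> D \<inter> H" using cm_D[OF s xy(1,2)] cm_subgroup[OF H xy(3,4)] by simp
    assume "pi_elt (G\<lparr>carrier := H\<rparr>) (- \<pi>) x"
    then show "pi_elt (G\<lparr>carrier := H\<rparr>) (- s) (cm (G\<lparr>carrier := H\<rparr>) x y)"
      using cm_s[OF s xy(1) _ xy(2)] cm_subgroup[OF H xy(3,4)] cH pe by simp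
  qed (use part D_iff D_comm pe in auto)
qed

lemma D_normal_self: "D \<lhd> G"
  using D_normal[OF D_sub] by simp

text \<open>Stands in for conjugacy of Hall subgroups. The product of \<open>Q\<close> and
  \<open>D\<close> is normalised by \<open>Q\<close> and by every \<open>- s\<close>-element, so it
  is normal and contains all \<open>s\<close>-elements. The \<open>s\<close>-part of the factor from
  \<open>D\<close> is then moved into \<open>Q\<close>, which contains the normal
  \<open>s\<close>-subgroup \<open>pi_part G s D\<close>.\<close>

lemma pi_elt_decompose:
  assumes s: "s \<in> \<sigma>" and Q: "hall_sigma_subgroup s G Q" and a: "pi_elt G s a"
  obtains q d where "q \<in> Q" "d \<in> D" "pi_elt G (- s) d" "a = q \<otimes> d"
proof -
  note h = hall_subgroupD[OF Q]
  note sm = set_mult_normal_subgroup[OF D_normal_self h(1)]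
  let ?B = "Q <#> D"
  have "normalizer_of G ?B = carrier G"
  proof (rule subgroup_eq_carrierI[OF normalizer_of_subgroup[OF subgroup.subset[OF sm(1)]] h(1) _ h(3)])
    show "Q \<subseteq> normalizer_of G ?B" using sm(2) subgroup_le_normalizer[OF sm(1)] by blast
    fix y assume y: "pi_elt G (- s) y"
    have yc: "y \<in> carrier G" by (rule pi_elt_carrier[OF y])
    have "cj G b y \<in> ?B" if b: "b \<in> ?B" for b
    proof -
      obtain q d where qd: "q \<in> Q" "d \<in> D" "b = q \<otimes> d" by (rule set_mult_memE[OF b])
      have c: "q \<in> carrier G" "d \<in> carrier G"
        using subgroup.mem_carrier[OF h(1) qd(1)] subgroup.mem_carrier[OF D_sub qd(2)] .
      have "cm G q y \<in> D" by (rule cm_D[OF s pi_elt_mem_subgroup[OF h(1,2) qd(1)] y])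
      moreover have "cj G d y \<in> D" using D_normal_self qd(2) yc by (auto simp: normal_iff_cj)
      ultimately have "q \<otimes> (cm G q y \<otimes> cj G d y) \<in> ?B"
        using set_mult_memI[OF qd(1)] subgroup.m_closed[OF D_sub] by blast
      moreover have "cj G b y = q \<otimes> (cm G q y \<otimes> cj G d y)"
        unfolding qd(3) using c yc by (simp add: cj_mult cj_eq_cm[of q] m_assoc)
      ultimately show ?thesis by simp
    qed
    then show "y \<in> normalizer_of G ?B" unfolding normalizer_of_def using yc by simp
  qed
  then have nB: "?B \<lhd> G" by (rule normal_if_normalizer[OF sm(1)])
  have "order G div card ?B dvd order G div card Q"
    using index_dvd_index[OF card_subgroup_mono_dvd[OF h(1) sm(1,2)] card_subgroup_dvd[OF sm(1)] card_subgroup_pos[OF sm(1)]] .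
  then have "prime_factors (order G div card ?B) \<subseteq> - s"
    using subset_trans[OF prime_factors_mono_dvd h(3)] index_pos[OF h(1)] by simp
  then have "a \<in> ?B" using normal_contains_coprime[OF nB a] by simp
  then obtain q d where qd: "q \<in> Q" "d \<in> D" "a = q \<otimes> d" by (rule set_mult_memE)
  obtain u v where uv: "u \<in> pi_part G s D" "v \<in> pi_part G (- s) D" "d = u \<otimes> v"
    by (rule pi_parts_product[OF D_sub qd(2)])
  have ps: "subgroup (pi_part G s D) G" by (rule pi_part_subgroup[OF D_sub D_comm])
  have "pi_part G s D \<lhd> G" by (rule D_normal[OF ps]) (auto simp: pi_part_def)
  then have "pi_part G s D \<subseteq> Q"
    using normal_pi_subgroup_le[OF h(1,3)] pi_part_prime_factors[OF D_sub D_comm] by blast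
  then have uQ: "u \<in> Q" using uv(1) by blast
  show ?thesis
  proof (rule that)
    show "q \<otimes> u \<in> Q" by (rule subgroup.m_closed[OF h(1) qd(1) uQ])
    show "v \<in> D" "pi_elt G (- s) v" using uv(2) unfolding pi_part_def by auto
    then show "a = q \<otimes> u \<otimes> v"
      unfolding qd(3) uv(3) using subgroup.mem_carrier[OF h(1)] qd(1) uQ by (simp add: m_assoc pi_elt_carrier)
  qed
qed

text \<open>With N the intersection of A and the \<open>- s\<close>-part of D, every conjugate of a
  lies in QN. Taking the conjugates by 1 and by y puts [a, y] into QN, and being a
  \<open>- s\<close>-element it lies in N.\<close>

lemma quasinormal_absorbs:
  assumes qn: "sigma_quasinormal \<sigma> G A"
  shows "absorbs A"
  unfolding absorbs_def
proof (intro ballI allI impI, elim conjE)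
  fix s a y assume s: "s \<in> \<sigma>" and aA: "a \<in> A" and a: "pi_elt G s a" "pi_elt G (- \<pi>) a" and y: "pi_elt G (- s) y"
  have ac: "a \<in> carrier G" and yc: "y \<in> carrier G" using a y by (auto dest: pi_elt_carrier)
  have A: "subgroup A G" using qn unfolding sigma_quasinormal_def by blast
  obtain Q where Q: "hall_sigma_subgroup s G Q"
    and perm: "\<And>x. x \<in> carrier G \<Longrightarrow> A <#> conj_set G Q x = conj_set G Q x <#> A"
    using qn s unfolding sigma_quasinormal_iff[OF part] by blast
  note h = hall_subgroupD[OF Q]
  let ?K = "pi_part G (- s) D"
  have K: "subgroup ?K G" by (rule pi_part_subgroup[OF D_sub D_comm])
  let ?N = "A \<inter> ?K"
  have sN: "subgroup ?N G" by (rule subgroups_Inter_pair[OF A K])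
  have N: "?N \<lhd> G" by (rule D_normal[OF sN]) (auto simp: pi_part_def)
  note B0 = set_mult_normal_subgroup[OF N h(1)]
  have conj: "cj G a x \<in> Q <#> ?N" if x: "x \<in> carrier G" for x
  proof -
    \<comment> \<open>The conjugate by the inverse of \<open>x\<close> is chosen so that conjugating
      the decomposition of \<open>a\<close> by \<open>x\<close> brings its first factor back into
      \<open>Q\<close>.\<close>
    let ?x = "inv x" let ?Q = "conj_set G Q ?x"
    have xi: "?x \<in> carrier G" using x by simp
    have Q': "hall_sigma_subgroup s G ?Q" by (rule hall_conj[OF Q xi])
    note h' = hall_subgroupD[OF Q']
    obtain q d where qd: "q \<in> ?Q" "d \<in> D" "pi_elt G (- s) d" "a = q \<otimes> d"
      by (rule pi_elt_decompose[OF s Q' a(1)])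
    let ?B = "A <#> ?Q"
    have B: "subgroup ?B G" by (rule set_mult_subgroup[OF A h'(1) perm[OF xi]])
    have qc: "q \<in> carrier G" "d \<in> carrier G" using subgroup.mem_carrier[OF h'(1) qd(1)] qd(3) by (auto dest: pi_elt_carrier)
    have "d = inv q \<otimes> a" unfolding qd(4) using qc by (simp add: word_simps)
    then have "d \<in> ?Q <#> A" using set_mult_memI[OF subgroup.m_inv_closed[OF h'(1) qd(1)] aA] by simp
    then have dB: "d \<in> ?B" using perm[OF xi] by simp
    interpret B: fin_group "G\<lparr>carrier := ?B\<rparr>" by (rule fin_group_subgroup[OF B])
    let ?T = "?B \<inter> ?K"
    have sT: "subgroup ?T G" by (rule subgroups_Inter_pair[OF B K])
    have T: "?T \<lhd> G" by (rule D_normal[OF sT]) (auto simp: pi_part_def)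
    have AB: "A \<subseteq> ?B"
    proof
      fix u assume u: "u \<in> A"
      have "u \<otimes> \<one> \<in> ?B" by (rule set_mult_memI[OF u subgroup.one_closed[OF h'(1)]])
      then show "u \<in> ?B" using subgroup.mem_carrier[OF A u] by simp
    qed
    \<comment> \<open>\<open>A\<close> has \<open>s\<close>-index in \<open>?B\<close> while
      \<open>?T\<close> is a normal subgroup of order prime to \<open>s\<close>; this places
      \<open>d\<close> in \<open>A\<close>.\<close>
    have "?T \<subseteq> A"
    proof (rule B.normal_pi_subgroup_le[of A "- s"])
      show "subgroup A (G\<lparr>carrier := ?B\<rparr>)" by (rule subgroup_incl[OF A B AB])
      have "card ?B div card A dvd card ?Q" by (rule card_set_mult_dvd(2)[OF A h'(1) B])
      then show "prime_factors (order (G\<lparr>carrier := ?B\<rparr>) div card A) \<subseteq> - (- s)"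
        using subset_trans[OF prime_factors_mono_dvd h'(2)] card_subgroup_pos[OF h'(1)] by (simp add: order_def)
      show "?T \<lhd> G\<lparr>carrier := ?B\<rparr>" by (rule normal_restrict_supergroup[OF B T]) blast
      show "prime_factors (card ?T) \<subseteq> - s"
        by (rule prime_factors_card_subgroupI[OF sT]) (simp add: pi_part_def)
    qed
    then have dN: "d \<in> ?N" using dB qd unfolding pi_part_def by auto
    obtain q' where q': "q' \<in> Q" "q = cj G q' ?x"
      using qd(1) conj_set_eq_image[OF subgroup.subset[OF h(1)] xi] by auto
    have q'c: "q' \<in> carrier G" using subgroup.mem_carrier[OF h(1) q'(1)] .
    have "cj G a x = q' \<otimes> cj G d x" unfolding qd(4) q'(2) using q'c qc x by (simp add: cj_mult)
    moreover have "cj G d x \<in> ?N" using N dN x unfolding normal_iff_cj by blast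
    ultimately show ?thesis using set_mult_memI[OF q'(1)] by simp
  qed
  have "a \<in> Q <#> ?N" using conj[OF one_closed] ac by simp
  then have cB: "cm G a y \<in> Q <#> ?N" unfolding cm_def
    using conj[OF yc] subgroup.m_closed[OF B0(1)] subgroup.m_inv_closed[OF B0(1)] by blast
  interpret B: fin_group "G\<lparr>carrier := Q <#> ?N\<rparr>" by (rule fin_group_subgroup[OF B0(1)])
  have "cm G a y \<in> ?N"
  proof (rule B.normal_contains_coprime)
    show "?N \<lhd> G\<lparr>carrier := Q <#> ?N\<rparr>" by (rule normal_restrict_supergroup[OF B0(1) N B0(3)])
    show "pi_elt (G\<lparr>carrier := Q <#> ?N\<rparr>) (- s) (cm G a y)"
      using cm_s[OF s a y] cB pi_elt_subgroup[OF B0(1)] by blast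
    have eq: "Q <#> ?N = ?N <#> Q" by (rule commut_normal[OF h(1) N])
    have "card (?N <#> Q) div card ?N dvd card Q"
      by (rule card_set_mult_dvd(2)[OF sN h(1)]) (use B0(1) eq in simp)
    then show "prime_factors (order (G\<lparr>carrier := Q <#> ?N\<rparr>) div card ?N) \<subseteq> - (- s)"
      using subset_trans[OF prime_factors_mono_dvd h(2)] card_subgroup_pos[OF h(1)] by (simp add: order_def eq)
  qed
  then show "cm G a y \<in> A" by blast
qed

text \<open>Absorption in \<open>H\<close> gives z = [k, y] in H, and absorption by K inside H gives
  [k, z] in K. So k and z commute modulo the intersection of K and D. Since kz = k^y has the order
  of k, this intersection contains z^n for an \<open>s\<close>-number n, and hence z.\<close>

lemma absorbs_trans:
  assumes H: "subgroup H G" and aH: "absorbs H"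
    and K: "subgroup K (G\<lparr>carrier := H\<rparr>)" and aK: "sigma_T.absorbs (G\<lparr>carrier := H\<rparr>) \<sigma> \<pi> K"
  shows "absorbs K"
  unfolding absorbs_def
proof (intro ballI allI impI, elim conjE)
  fix s k y assume s: "s \<in> \<sigma>" and kK: "k \<in> K" and k: "pi_elt G s k" "pi_elt G (- \<pi>) k" and y: "pi_elt G (- s) y"
  interpret H: sigma_T "G\<lparr>carrier := H\<rparr>" \<sigma> "D \<inter> H" \<pi> by (rule sigma_T_subgroup[OF H])
  have kc: "k \<in> carrier G" and yc: "y \<in> carrier G" using k y by (auto dest: pi_elt_carrier)
  have KG: "subgroup K G" by (rule incl_subgroup[OF H K])
  have kH: "k \<in> H" using subgroup.subset[OF K] kK by auto
  let ?z = "cm G k y"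
  have zH: "?z \<in> H" using aH s kH k y unfolding absorbs_def by blast
  have zD: "?z \<in> D" by (rule cm_D[OF s k(1) y])
  have zs: "pi_elt G (- s) ?z" by (rule cm_s[OF s k y])
  have zc: "?z \<in> carrier G" by (rule pi_elt_carrier[OF zs])
  let ?N = "K \<inter> D"
  have sN: "subgroup ?N G" by (rule subgroups_Inter_pair[OF KG D_sub])
  have N: "?N \<lhd> G" by (rule D_normal[OF sN]) blast
  have "cm (G\<lparr>carrier := H\<rparr>) k ?z \<in> K"
    using aK s kK k zs kH zH unfolding H.absorbs_def pi_elt_subgroup[OF H] by blast
  then have "cm G k ?z \<in> K" using cm_subgroup[OF H kH zH] by simp
  moreover have "cm G k ?z \<in> D" by (rule cm_D[OF s k(1) zs])
  ultimately have c: "cm G k ?z \<in> ?N" by blast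
  obtain n where n: "0 < n" "prime_factors n \<subseteq> s" "k [^] (n::nat) = \<one>" using k(1) unfolding pi_elt_def by blast
  have "(k \<otimes> ?z) [^] n = \<one>"
    using cj_eq_cm[OF kc yc] cj_pow[OF kc yc, of n] n(3) yc by simp
  then have "?z [^] n \<in> ?N"
    using pow_commute_mod[OF N kc zc c, of n] n(3) subgroup.one_closed[OF sN] by simp
  then have "?z \<in> ?N" using pi_elt_pow_mem[OF sN zs] n by simp
  then show "?z \<in> K" by blast
qed

text \<open>It suffices that A normalises B = Q(A \<inter> D), because then qa = a q^a with q^a in B
  = (A \<inter> D)Q. This is tested on prime power parts: those for primes in \<open>\<pi>\<close>
  lie in A \<inter> D, those of class \<open>t\<close> lie in B, and for other classes the
  commutators with Q lie in A \<inter> D.\<close>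

lemma absorbs_permutes:
  assumes A: "subgroup A G" and P: "absorbs A" and t: "t \<in> \<sigma>" and Q: "hall_sigma_subgroup t G Q"
  shows "A <#> Q = Q <#> A"
proof -
  note h = hall_subgroupD[OF Q]
  let ?N = "A \<inter> D"
  have sN: "subgroup ?N G" by (rule subgroups_Inter_pair[OF A D_sub])
  have N: "?N \<lhd> G" by (rule D_normal[OF sN]) blast
  let ?B = "Q <#> ?N"
  note B = set_mult_normal_subgroup[OF N h(1)]
  have nz: "subgroup (normalizer_of G ?B) G" by (rule normalizer_of_subgroup[OF subgroup.subset[OF B(1)]])
  note Bnz = subgroup_le_normalizer[OF B(1)]
  have norm: "a \<in> normalizer_of G ?B" if a: "a \<in> A" for a
  proof (rule prime_parts_mem[OF nz subgroup.mem_carrier[OF A a]])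
    fix p and k :: nat assume p: "prime p" and pk: "pi_elt G {p} (a [^] k)"
    let ?a = "a [^] k"
    have aA: "?a \<in> A" by (rule subgroup_pow_closed[OF A a])
    have ac: "?a \<in> carrier G" by (rule subgroup.mem_carrier[OF A aA])
    show "?a \<in> normalizer_of G ?B"
    proof (cases "p \<in> \<pi>")
      case True
      then have "?a \<in> D" using D_iff pi_elt_mono[OF pk, of \<pi>] by blast
      then show ?thesis using aA B(3) Bnz by blast
    next
      case False
      obtain s where s: "s \<in> \<sigma>" "p \<in> s" using sigma_partition_cover[OF part p] by blast
      have a1: "pi_elt G s ?a" "pi_elt G (- \<pi>) ?a" using pi_elt_mono[OF pk] s False by auto
      show ?thesis
      proof (cases "s = t")
        case True
        obtain q d where qd: "q \<in> Q" "d \<in> D" "pi_elt G (- s) d" "?a = q \<otimes> d"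
          by (rule pi_elt_decompose[OF s(1) Q[folded True] a1(1)])
        have qc: "q \<in> carrier G" "d \<in> carrier G" using subgroup.mem_carrier[OF h(1) qd(1)] qd(3) by (auto dest: pi_elt_carrier)
        \<comment> \<open>The element \<open>inv d\<close> is used because multiplying it by
          \<open>?a\<close> gives \<open>q\<close>, an \<open>s\<close>-element. As
          \<open>?a\<close> and \<open>inv d\<close> commute modulo \<open>?N\<close>, an exponent
          annihilating both \<open>?a\<close> and \<open>q\<close> sends \<open>inv d\<close> into
          \<open>?N\<close>.\<close>
        have ds: "pi_elt G (- s) (inv d)" by (rule pi_elt_inv[OF qd(3)])
        have "cm G ?a (inv d) \<in> A" using P s(1) aA a1 ds unfolding absorbs_def by blast
        moreover have "cm G ?a (inv d) \<in> D" by (rule cm_D[OF s(1) a1(1) ds])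
        ultimately have c: "cm G ?a (inv d) \<in> ?N" by blast
        obtain n where n: "0 < n" "prime_factors n \<subseteq> s" "?a [^] (n::nat) = \<one>" using a1(1) unfolding pi_elt_def by blast
        let ?m = "n * card Q"
        have "?a \<otimes> inv d = q" unfolding qd(4) using qc by (simp add: m_assoc)
        moreover have "q [^] ?m = \<one>"
        proof -
          have "q [^] ?m = (q [^] card Q) [^] n" using qc by (simp add: nat_pow_pow mult.commute)
          then show ?thesis using pow_card_subgroup[OF h(1) qd(1)] by simp
        qed
        moreover have "?a [^] ?m = \<one>"
        proof -
          have "?a [^] ?m = (?a [^] n) [^] card Q" by (rule nat_pow_pow[OF ac, symmetric])
          then show ?thesis using n(3) by simp
        qed
        ultimately have "inv d [^] ?m \<in> ?N"
          using pow_commute_mod[OF N ac inv_closed[OF qc(2)] c, of ?m] subgroup.one_closed[OF sN] by simp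
        moreover have "0 < ?m" "prime_factors ?m \<subseteq> - (- s)"
          using n h(2) True card_subgroup_pos[OF h(1)] by (auto simp: prime_factors_mult_nat)
        ultimately have "inv d \<in> ?N" using pi_elt_pow_mem[OF sN ds] by blast
        then have "d \<in> ?N" using subgroup.m_inv_closed[OF sN] qc(2) by (metis inv_inv)
        then have "?a \<in> ?B" unfolding qd(4) by (rule set_mult_memI[OF qd(1)])
        then show ?thesis using Bnz by blast
      next
        case False
        have ts: "t \<subseteq> - s" using sigma_partition_disjoint[OF part s(1) t] False by auto
        have "cj G b ?a \<in> ?B" if b: "b \<in> ?B" for b
        proof -
          obtain q n where qn: "q \<in> Q" "n \<in> ?N" "b = q \<otimes> n" by (rule set_mult_memE[OF b])
          have c: "q \<in> carrier G" "n \<in> carrier G"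
            using subgroup.mem_carrier[OF h(1) qn(1)] subgroup.mem_carrier[OF sN qn(2)] .
          have qs: "pi_elt G (- s) q" by (rule pi_elt_mono[OF pi_elt_mem_subgroup[OF h(1,2) qn(1)] ts])
          have "cm G ?a q \<in> A" using P s(1) aA a1 qs unfolding absorbs_def by blast
          moreover have "cm G ?a q \<in> D" by (rule cm_D[OF s(1) a1(1) qs])
          ultimately have "cm G ?a q \<in> ?N" by blast
          then have "cm G q ?a \<in> ?N" using subgroup.m_inv_closed[OF sN] cm_inv[OF ac c(1)] by metis
          moreover have "cj G n ?a \<in> ?N" using N qn(2) ac unfolding normal_iff_cj by blast
          ultimately have "q \<otimes> (cm G q ?a \<otimes> cj G n ?a) \<in> ?B"
            using set_mult_memI[OF qn(1)] subgroup.m_closed[OF sN] by blast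
          moreover have "cj G b ?a = q \<otimes> (cm G q ?a \<otimes> cj G n ?a)"
            unfolding qn(3) using c ac by (simp add: cj_mult cj_eq_cm[of q] m_assoc)
          ultimately show ?thesis by simp
        qed
        then show ?thesis unfolding normalizer_of_def using ac by simp
      qed
    qed
  qed
  have QB: "Q \<subseteq> ?B" by (rule B(2))
  have eq: "?B = ?N <#> Q" by (rule commut_normal[OF h(1) N])
  show ?thesis
  proof
    show "A <#> Q \<subseteq> Q <#> A"
    proof
      fix x assume "x \<in> A <#> Q"
      then obtain a q where aq: "a \<in> A" "q \<in> Q" "x = a \<otimes> q" by (rule set_mult_memE)
      have c: "a \<in> carrier G" "q \<in> carrier G" using subgroup.mem_carrier[OF A aq(1)] subgroup.mem_carrier[OF h(1) aq(2)] .
      have "cj G q (inv a) \<in> ?B"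
        using norm[OF subgroup.m_inv_closed[OF A aq(1)]] QB aq(2) unfolding normalizer_of_def by blast
      then obtain q' n where qn: "q' \<in> Q" "n \<in> ?N" "cj G q (inv a) = q' \<otimes> n" by (rule set_mult_memE)
      have "x = cj G q (inv a) \<otimes> a" unfolding aq(3) cj_def using c by (simp add: word_simps)
      also have "\<dots> = q' \<otimes> (n \<otimes> a)"
        unfolding qn(3) using c subgroup.mem_carrier[OF h(1) qn(1)] subgroup.mem_carrier[OF sN qn(2)] by (simp add: m_assoc)
      also have "\<dots> \<in> Q <#> A" using set_mult_memI[OF qn(1)] subgroup.m_closed[OF A _ aq(1), of n] qn(2) by simp
      finally show "x \<in> Q <#> A" .
    qed
    show "Q <#> A \<subseteq> A <#> Q"
    proof
      fix x assume "x \<in> Q <#> A"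
      then obtain q a where aq: "q \<in> Q" "a \<in> A" "x = q \<otimes> a" by (rule set_mult_memE)
      have c: "a \<in> carrier G" "q \<in> carrier G" using subgroup.mem_carrier[OF A aq(2)] subgroup.mem_carrier[OF h(1) aq(1)] .
      have "cj G q a \<in> ?B"
        using norm[OF aq(2)] QB aq(1) unfolding normalizer_of_def by blast
      then have "cj G q a \<in> ?N <#> Q" using eq by simp
      then obtain n q' where qn: "n \<in> ?N" "q' \<in> Q" "cj G q a = n \<otimes> q'" by (rule set_mult_memE)
      have "x = a \<otimes> cj G q a" unfolding aq(3) cj_def using c by (simp add: word_simps)
      also have "\<dots> = (a \<otimes> n) \<otimes> q'"
        unfolding qn(3) using c subgroup.mem_carrier[OF h(1) qn(2)] subgroup.mem_carrier[OF sN qn(1)] by (simp add: m_assoc)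
      also have "\<dots> \<in> A <#> Q" using set_mult_memI[OF _ qn(2)] subgroup.m_closed[OF A aq(2), of n] qn(1) by simp
      finally show "x \<in> A <#> Q" .
    qed
  qed
qed

theorem PsigmaT:
  assumes hall: "\<And>s. s \<in> \<sigma> \<Longrightarrow> \<exists>H. hall_sigma_subgroup s G H"
  shows "PsigmaT_group \<sigma> G"
  unfolding PsigmaT_group_def
proof (intro allI impI, elim conjE)
  fix H K assume K: "sigma_quasinormal \<sigma> (G\<lparr>carrier := H\<rparr>) K" and H: "sigma_quasinormal \<sigma> G H"
  have sH: "subgroup H G" using H unfolding sigma_quasinormal_def by blast
  have sK: "subgroup K (G\<lparr>carrier := H\<rparr>)" using K unfolding sigma_quasinormal_def by blast
  interpret H: sigma_T "G\<lparr>carrier := H\<rparr>" \<sigma> "D \<inter> H" \<pi> by (rule sigma_T_subgroup[OF sH])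
  have "absorbs K" by (rule absorbs_trans[OF sH quasinormal_absorbs[OF H] sK H.quasinormal_absorbs[OF K]])
  then show "sigma_quasinormal \<sigma> G K"
    by (intro sigma_quasinormalI[OF part incl_subgroup[OF sH sK] hall] absorbs_permutes[OF incl_subgroup[OF sH sK]])
qed

end


section \<open>From special quotients to the axioms of \<open>sigma_T\<close>\<close>

context fin_group
begin

lemma comm_subgroup:
  assumes "comm_group (G\<lparr>carrier := D\<rparr>)" "a \<in> D" "b \<in> D"
  shows "a \<otimes> b = b \<otimes> a"
proof -
  interpret C: comm_group "G\<lparr>carrier := D\<rparr>" by (rule assms(1))
  show ?thesis using C.m_comm[of a b] assms(2,3) by simp
qed

text \<open>Supplies the axiom \<open>cm_s\<close>. In the quotient the normal Hall subgroup E is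
  the direct product of the image of D and S; elements of order prime to the order of D map into S.
  This applies to x and to its conjugate by y, so the image of their quotient [x, y] lies in both
  factors and vanishes.\<close>

lemma special_cm_pi_elt:
  assumes \<sigma>: "sigma_partition \<sigma>" and hall: "\<And>s. s \<in> \<sigma> \<Longrightarrow> \<exists>H. hall_sigma_subgroup s G H"
    and D_def: "D = sigma_comm \<sigma> G"
    and ab: "\<And>a b. a \<in> D \<Longrightarrow> b \<in> D \<Longrightarrow> a \<otimes> b = b \<otimes> a"
    and s: "s \<in> sigma_of \<sigma> (card D)"
    and spec: "special_PsigmaT_group \<sigma> (G Mod (pi_part G (- s) D))"
    and x: "pi_elt G s x" "pi_elt G (- prime_factors (card D)) x" and y: "pi_elt G (- s) y"
  shows "pi_elt G (- s) (cm G x y)"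
proof -
  let ?\<pi> = "prime_factors (card D)" and ?K = "pi_part G (- s) D"
  have s\<sigma>: "s \<in> \<sigma>" using s by (simp add: sigma_of_iff)
  have nD: "D \<lhd> G" unfolding D_def by (rule sigma_comm_normal)
  note sD = normal_imp_subgroup[OF nD]
  have nK: "?K \<lhd> G" by (rule pi_part_normal[OF nD ab])
  let ?X = "G Mod ?K" and ?f = "(#>) ?K"
  interpret e: fin_epi G ?X ?f by (rule fin_epi_Mod[OF nK])
  have fD: "?f ` D = sigma_comm \<sigma> ?X"
    using e.image_sigma_comm[of \<sigma>] unfolding D_def .
  have R: "sigma_nilp_residual \<sigma> ?X = ?f ` D"
    unfolding fD by (rule e.sigma_nilp_residual_image[OF \<sigma> hall])
  obtain t E S where t: "t \<in> \<sigma>" and E: "hall_sigma_subgroup t ?X E" and DE: "?f ` D \<subseteq> E"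
    and S: "S \<lhd> ?X\<lparr>carrier := E\<rparr>" "?f ` D \<inter> S = {\<one>\<^bsub>?X\<^esub>}" "?f ` D <#>\<^bsub>?X\<^esub> S = E"
    using spec unfolding special_PsigmaT_group_def R by (elim bexE exE conjE) (rule that)
  note hE = e.H.hall_subgroupD[OF E]
  \<comment> \<open>The class provided by the special quotient could a priori differ from
    \<open>s\<close>. Then the \<open>s\<close>-part of \<open>D\<close> would have images that are
    both \<open>s\<close>- and \<open>t\<close>-elements, so it would lie in the kernel, contrary to
    \<open>s\<close> meeting the order of \<open>D\<close>.\<close>
  have ts: "t = s"
  proof (rule ccontr)
    assume "t \<noteq> s"
    then have dis: "s \<inter> t = {}" using sigma_partition_disjoint[OF \<sigma> s\<sigma> t] by blast
    have "prime_factors (card D) \<subseteq> - s"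
    proof (rule prime_factors_card_subgroupI[OF sD])
      fix d assume d: "d \<in> D"
      obtain u v where uv: "u \<in> pi_part G s D" "v \<in> ?K" "d = u \<otimes> v" by (rule pi_parts_product[OF sD d])
      have u: "u \<in> D" "pi_elt G s u" using uv(1) unfolding pi_part_def by auto
      have "pi_elt ?X t (?f u)" using e.H.pi_elt_mem_subgroup[OF hE(1,2)] DE u(1) by blast
      then have "?f u = \<one>\<^bsub>?X\<^esub>" using e.H.pi_elt_disjoint[OF e.pi_elt_hom[OF u(2)] _ dis] by blast
      then have "u \<in> ?K" using rcos_eq_one_iff[OF nK pi_elt_carrier[OF u(2)]] by blast
      then have "d \<in> ?K" unfolding uv(3) using uv(2) by (rule subgroup.m_closed[OF normal_imp_subgroup[OF nK]])
      then show "pi_elt G (- s) d" unfolding pi_part_def by blast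
    qed
    then show False using s by (auto simp: sigma_of_iff)
  qed
  have nE: "E \<lhd> ?X"
    using e.H.hall_normal_if_residual_le[OF s\<sigma> E[unfolded ts]] DE unfolding fD by blast
  have nfD: "?f ` D \<lhd> ?X" by (rule e.image_normal[OF nD])
  interpret E: fin_group "?X\<lparr>carrier := E\<rparr>" by (rule e.H.fin_group_subgroup[OF hE(1)])
  have nfDE: "?f ` D \<lhd> ?X\<lparr>carrier := E\<rparr>" by (rule e.H.normal_restrict_supergroup[OF hE(1) nfD DE])
  have sS: "subgroup S ?X" by (rule e.H.incl_subgroup[OF hE(1) normal_imp_subgroup[OF S(1)]])
  have inS: "?f x \<in> S" if x: "pi_elt G s x" "pi_elt G (- ?\<pi>) x" for x
  proof -
    have "?f x \<in> E" using e.H.normal_hall_mem[OF E[unfolded ts] nE e.pi_elt_hom[OF x(1)]] .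
    then have "?f x \<in> ?f ` D <#>\<^bsub>?X\<^esub> S" using S(3) by simp
    then obtain r c where rc: "r \<in> ?f ` D" "c \<in> S" "?f x = r \<otimes>\<^bsub>?X\<^esub> c" by (rule e.H.set_mult_memE)
    have cc: "r \<in> carrier ?X" "c \<in> carrier ?X"
      using subgroup.mem_carrier[OF normal_imp_subgroup[OF nfD] rc(1)] subgroup.mem_carrier[OF sS rc(2)] .
    have comm: "r \<otimes>\<^bsub>?X\<^esub> c = c \<otimes>\<^bsub>?X\<^esub> r"
      using E.normal_disjoint_commute[OF nfDE S(1) _ rc(1,2)] S(2) by simp
    obtain n where n: "0 < n" "prime_factors n \<subseteq> - ?\<pi>" "?f x [^]\<^bsub>?X\<^esub> (n::nat) = \<one>\<^bsub>?X\<^esub>"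
      using e.pi_elt_hom[OF x(2)] unfolding pi_elt_def by blast
    \<comment> \<open>The exponent \<open>n\<close> kills the product of two commuting factors, so
      it sends \<open>r\<close> into the trivial intersection. Thus \<open>r\<close> has order prime
      to \<open>?\<pi>\<close>, while the order of an element of the image of \<open>D\<close>
      involves only primes of \<open>?\<pi>\<close>.\<close>
    have "r [^]\<^bsub>?X\<^esub> n \<otimes>\<^bsub>?X\<^esub> c [^]\<^bsub>?X\<^esub> n = \<one>\<^bsub>?X\<^esub>"
      using n(3) unfolding rc(3) e.H.pow_mult_distrib[OF comm cc] .
    then have "r [^]\<^bsub>?X\<^esub> n = inv\<^bsub>?X\<^esub> (c [^]\<^bsub>?X\<^esub> n)"
      using e.H.inv_equality[of "r [^]\<^bsub>?X\<^esub> n" "c [^]\<^bsub>?X\<^esub> n"] cc e.H.nat_pow_closed by blast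
    then have "r [^]\<^bsub>?X\<^esub> n \<in> S"
      using subgroup.m_inv_closed[OF sS e.H.subgroup_pow_closed[OF sS rc(2)]] by simp
    moreover have "r [^]\<^bsub>?X\<^esub> n \<in> ?f ` D"
      by (rule e.H.subgroup_pow_closed[OF normal_imp_subgroup[OF nfD] rc(1)])
    ultimately have "r [^]\<^bsub>?X\<^esub> n = \<one>\<^bsub>?X\<^esub>" using S(2) by blast
    then have "pi_elt ?X (- ?\<pi>) r" using n cc unfolding pi_elt_def by blast
    moreover have "pi_elt ?X ?\<pi> r"
    proof -
      obtain d where d: "d \<in> D" "r = ?f d" using rc(1) by blast
      then show ?thesis using e.pi_elt_hom[OF pi_elt_mem_subgroup[OF sD subset_refl d(1)]] by simp
    qed
    ultimately have "r = \<one>\<^bsub>?X\<^esub>" using e.H.pi_elt_disjoint[of "- ?\<pi>" r ?\<pi>] by simp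
    then have "?f x = c" using rc(3) e.H.l_one[OF cc(2)] by (simp only:)
    then show ?thesis using rc(2) by simp
  qed
  have xc: "x \<in> carrier G" and yc: "y \<in> carrier G" using x y by (auto dest: pi_elt_carrier)
  have cD: "cm G x y \<in> D" unfolding D_def by (rule cm_mem_sigma_comm[OF s\<sigma> x(1) y])
  have "?f (cj G x y) \<in> S" by (rule inS[OF pi_elt_cj[OF x(1) yc] pi_elt_cj[OF x(2) yc]])
  then have "inv\<^bsub>?X\<^esub> ?f x \<otimes>\<^bsub>?X\<^esub> ?f (cj G x y) \<in> S"
    using subgroup.m_closed[OF sS subgroup.m_inv_closed[OF sS inS[OF x]]] by blast
  moreover have "?f (cm G x y) = inv\<^bsub>?X\<^esub> ?f x \<otimes>\<^bsub>?X\<^esub> ?f (cj G x y)"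
    unfolding cm_def using e.hom_mult[OF inv_closed[OF xc] cj_closed[OF xc yc]] e.hom_inv[OF xc] by (simp only:)
  ultimately have "?f (cm G x y) \<in> S" by (simp only:)
  then have "?f (cm G x y) = \<one>\<^bsub>?X\<^esub>" using S(2) cD by blast
  then have "cm G x y \<in> ?K" using rcos_eq_one_iff[OF nK cm_closed[OF xc yc]] by blast
  then show ?thesis unfolding pi_part_def by blast
qed

lemma PsigmaT_if:
  assumes \<sigma>: "sigma_partition \<sigma>" and hall: "\<And>s. s \<in> \<sigma> \<Longrightarrow> \<exists>H. hall_sigma_subgroup s G H"
    and D_def: "D = sigma_nilp_residual \<sigma> G"
    and comm: "comm_group (G\<lparr>carrier := D\<rparr>)" and hD: "hall_subgroup G D"
    and pow: "\<And>g. g \<in> carrier G \<Longrightarrow> induces_power_aut G g D"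
    and spec: "\<And>s. s \<in> sigma_of \<sigma> (card D) \<Longrightarrow> special_PsigmaT_group \<sigma> (G Mod (O_upper s G D))"
  shows "PsigmaT_group \<sigma> G"
proof -
  note ab = comm_subgroup[OF comm]
  let ?\<pi> = "prime_factors (card D)"
  have D': "D = sigma_comm \<sigma> G" unfolding D_def by (rule sigma_nilp_residual_eq[OF \<sigma> hall])
  have nD: "D \<lhd> G" unfolding D' by (rule sigma_comm_normal)
  note sD = normal_imp_subgroup[OF nD]
  have idx: "prime_factors (order G div card D) \<subseteq> - ?\<pi>"
  proof
    fix p assume p: "p \<in> prime_factors (order G div card D)"
    show "p \<in> - ?\<pi>"
    proof
      assume "p \<in> ?\<pi>"
      then have "is_unit p" using p hD unfolding hall_subgroup_def
        by (meson coprime_common_divisor in_prime_factors_imp_dvd)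
      then show False using in_prime_factors_imp_prime[OF p] by auto
    qed
  qed
  have "sigma_T G \<sigma> D ?\<pi>"
  proof (rule sigma_T.intro[OF fin_group_axioms sigma_T_axioms.intro])
    show "x \<in> D \<longleftrightarrow> pi_elt G ?\<pi> x" for x
      using pi_elt_mem_subgroup[OF sD subset_refl] normal_contains_coprime[OF nD _ idx] by blast
    show "V \<lhd> G" if V: "subgroup V G" "V \<subseteq> D" for V
      unfolding normal_iff_cj
    proof (intro conjI ballI V(1))
      fix g v assume g: "g \<in> carrier G" "v \<in> V"
      have "(\<lambda>x. inv g \<otimes> x \<otimes> g) ` V = V" using pow[OF g(1)] V unfolding induces_power_aut_def by blast
      then show "cj G v g \<in> V" using g(2) unfolding cj_def by blast
    qed
    show "cm G x y \<in> D" if "s \<in> \<sigma>" "pi_elt G s x" "pi_elt G (- s) y" for s x y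
      unfolding D' by (rule cm_mem_sigma_comm[OF that])
    then show "pi_elt G (- s) (cm G x y)" if s: "s \<in> \<sigma>" and x: "pi_elt G s x" "pi_elt G (- ?\<pi>) x" and y: "pi_elt G (- s) y" for s x y
    proof (cases "s \<in> sigma_of \<sigma> (card D)")
      case True
      then show ?thesis
        using special_cm_pi_elt[OF \<sigma> hall D' ab True _ x y] spec[OF True] O_upper_eq[OF sD ab, of s] by simp
    next
      case False
      \<comment> \<open>For a class not meeting the order of \<open>D\<close> every element of
        \<open>D\<close> is a \<open>- s\<close>-element.\<close>
      then have "?\<pi> \<subseteq> - s" using s by (auto simp: sigma_of_iff)
      moreover have "pi_elt G ?\<pi> (cm G x y)"
        using pi_elt_mem_subgroup[OF sD subset_refl] cm_mem_sigma_comm[OF s x(1) y] unfolding D' by blast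
      ultimately show ?thesis by (rule pi_elt_mono[rotated])
    qed
  qed (use \<sigma> sD ab in auto)
  then interpret sigma_T G \<sigma> D ?\<pi> .
  show ?thesis by (rule PsigmaT[OF hall])
qed

end


section \<open>Coprime power automorphisms\<close>

lemma prime_power_of_prime_factors:
  fixes q m :: nat
  assumes q: "prime q" and m: "0 < m" "prime_factors m \<subseteq> {q}"
  shows "\<exists>k. m = q ^ k"
proof -
  have "m = (\<Prod>p\<in>prime_factors m. p ^ multiplicity p m)" using m(1) prime_factorization_nat by simp
  also have "\<dots> = (\<Prod>p\<in>{q}. p ^ multiplicity p m)"
    by (rule prod.mono_neutral_left) (use m q in \<open>auto simp: prime_factors_multiplicity\<close>)
  finally show ?thesis by auto
qed

text \<open>Uniqueness of lifting for n-th roots: \<open>B ^ n - C ^ n\<close> is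
  \<open>B - C\<close> times the sum \<open>?S\<close>, which modulo \<open>q\<close> is
  \<open>n * C ^ (n - 1)\<close> and hence a unit.\<close>

lemma cong_of_power_cong:
  fixes B C :: int and n o' q :: nat
  assumes q: "prime q" and o: "0 < o'" "prime_factors o' \<subseteq> {q}" and n: "\<not> q dvd n" "0 < n"
    and BC: "[B = C] (mod int q)" and C: "\<not> int q dvd C" and pw: "[B ^ n = C ^ n] (mod int o')"
  shows "[B = C] (mod int o')"
proof -
  let ?S = "\<Sum>i<n. C ^ (n - Suc i) * B ^ i"
  have "[?S = (\<Sum>i<n. C ^ (n - Suc i) * C ^ i)] (mod int q)"
    by (intro cong_sum cong_mult cong_refl cong_pow BC)
  also have "(\<Sum>i<n. C ^ (n - Suc i) * C ^ i) = (\<Sum>i<n. C ^ (n - 1))"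
    by (intro sum.cong refl) (simp flip: power_add)
  also have "\<dots> = int n * C ^ (n - 1)" by simp
  finally have S: "[?S = int n * C ^ (n - 1)] (mod int q)" .
  have pq: "prime (int q)" using q by simp
  have "\<not> int q dvd int n * C ^ (n - 1)"
  proof
    assume "int q dvd int n * C ^ (n - 1)"
    then have "int q dvd int n \<or> int q dvd C ^ (n - 1)" by (rule prime_dvd_multD[OF pq])
    then show False using n C prime_dvd_power[OF pq, of C "n - 1"] by auto
  qed
  then have "\<not> int q dvd ?S" using S by (simp add: cong_dvd_iff)
  then have "coprime (int q) ?S" using pq by (simp add: prime_imp_coprime)
  then have "coprime (int o') ?S"
    using prime_power_of_prime_factors[OF q o] by auto
  moreover have "int o' dvd (B - C) * ?S"
    using pw unfolding cong_iff_dvd_diff power_diff_sumr2 .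
  ultimately show ?thesis unfolding cong_iff_dvd_diff by (simp add: coprime_dvd_mult_left_iff)
qed

context group
begin

lemma cj_int_pow: "x \<in> carrier G \<Longrightarrow> y \<in> carrier G \<Longrightarrow> cj G (x [^] (i::int)) y = cj G x y [^] i"
  by (cases i rule: int_cases2) (simp_all add: int_pow_neg_int cj_inv cj_pow int_pow_int)

lemma cj_cj_cj:
  "x \<in> carrier G \<Longrightarrow> v \<in> carrier G \<Longrightarrow> y \<in> carrier G \<Longrightarrow> cj G (cj G x v) y = cj G (cj G x y) (cj G v y)"
  by (simp add: cj_def word_simps)

lemma pow_eq_iff_cong:
  assumes "x \<in> carrier G"
  shows "x [^] (i::int) = x [^] (j::int) \<longleftrightarrow> [i = j] (mod int (ord x))"
proof -
  have "x [^] i = x [^] j \<longleftrightarrow> x [^] (i - j) = \<one>"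
    using assms by (simp add: int_pow_diff) (metis int_pow_closed inv_closed inv_equality inv_inv r_inv)
  also have "\<dots> \<longleftrightarrow> int (ord x) dvd i - j" using assms by (rule int_pow_eq_id)
  finally show ?thesis by (simp add: cong_iff_dvd_diff)
qed

lemma inv_mult_pow:
  assumes "x \<in> carrier G"
  shows "inv x \<otimes> x [^] (n::nat) = x [^] (int n - 1)"
proof -
  have "x [^] (int n - 1) = x [^] (- 1 + int n)" by (simp add: algebra_simps)
  also have "\<dots> = x [^] (- 1 :: int) \<otimes> x [^] int n" using assms by (rule int_pow_mult)
  finally show ?thesis using assms by (simp add: int_pow_neg int_pow_int)
qed

lemma int_pow_diff_eq:
  assumes x: "x \<in> carrier G" and y: "y \<in> carrier G"
    and e: "x [^] (i::int) \<otimes> y [^] (j::int) = x [^] (k::int) \<otimes> y [^] (l::int)"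
  shows "x [^] (i - k) = y [^] (l - j)"
proof -
  have "x [^] (i - k) = x [^] (- k + i)" by (simp add: algebra_simps)
  also have "\<dots> = x [^] (- k) \<otimes> x [^] i" using x by (rule int_pow_mult)
  also have "\<dots> = inv (x [^] k) \<otimes> (x [^] i \<otimes> y [^] j) \<otimes> inv (y [^] j)"
    using x y by (simp add: int_pow_neg m_assoc)
  also have "\<dots> = y [^] (l - j)" unfolding e using x y by (simp add: int_pow_diff word_simps)
  finally show ?thesis .
qed

lemma commute_pow:
  assumes "x \<in> carrier G" "y \<in> carrier G" "x \<otimes> y = y \<otimes> x"
  shows "x [^] (n::nat) \<otimes> y = y \<otimes> x [^] n"
  using assms cj_eq_iff_commute[of x y] cj_eq_iff_commute[of "x [^] n" y] by (simp add: cj_pow)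

lemma cm_mult_right:
  "x \<in> carrier G \<Longrightarrow> a \<in> carrier G \<Longrightarrow> b \<in> carrier G \<Longrightarrow> cm G x (a \<otimes> b) = cm G x b \<otimes> cj G (cm G x a) b"
  by (simp add: cm_def cj_def word_simps)

lemma mem_normalizer_singleton: "g \<in> normalizer_of G {x} \<longleftrightarrow> g \<in> carrier G \<and> cj G x g = x"
  unfolding normalizer_of_def by blast

end

section \<open>Conjugation acting on cyclic subgroups\<close>

context fin_group
begin

lemma ord_positive: "x \<in> carrier G \<Longrightarrow> 0 < ord x"
  using ord_ge_1[OF fin] by fastforce

lemma pi_elt_iff_ord: "pi_elt G T x \<longleftrightarrow> x \<in> carrier G \<and> prime_factors (ord x) \<subseteq> T"
proof
  assume x: "pi_elt G T x"
  then obtain n where n: "0 < n" "prime_factors n \<subseteq> T" "x [^] (n::nat) = \<one>" unfolding pi_elt_def by blast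
  have xc: "x \<in> carrier G" by (rule pi_elt_carrier[OF x])
  have "ord x dvd n" using n(3) pow_eq_id[OF xc] by simp
  then show "x \<in> carrier G \<and> prime_factors (ord x) \<subseteq> T"
    using subset_trans[OF prime_factors_mono_dvd n(2)] n(1) xc by simp
next
  assume x: "x \<in> carrier G \<and> prime_factors (ord x) \<subseteq> T"
  then show "pi_elt G T x" unfolding pi_elt_def using ord_positive by (intro conjI exI[of _ "ord x"]) auto
qed

lemma ord_cj: "x \<in> carrier G \<Longrightarrow> y \<in> carrier G \<Longrightarrow> ord (cj G x y) = ord x"
proof -
  assume x: "x \<in> carrier G" and y: "y \<in> carrier G"
  have "cj G x y [^] n = \<one> \<longleftrightarrow> x [^] n = \<one>" for n :: nat
    using cj_inj[of "x [^] n" \<one> y] x y by (simp add: cj_pow)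
  then have "ord (cj G x y) dvd n \<longleftrightarrow> ord x dvd n" for n
    using pow_eq_id[of "cj G x y" n] pow_eq_id[OF x, of n] x y by simp
  then show ?thesis by (metis dvd_antisym dvd_refl)
qed

lemma powers_normalizer:
  assumes x: "x \<in> carrier G" and g: "g \<in> carrier G" and e: "cj G x g = x [^] (k::nat)"
  shows "g \<in> normalizer_of G (range (\<lambda>n::nat. x [^] n))"
  unfolding normalizer_of_def using g x e by (auto simp: cj_pow nat_pow_pow)

lemma normalizer_powers:
  assumes x: "x \<in> carrier G" and g: "g \<in> normalizer_of G (range (\<lambda>n::nat. x [^] n))"
  obtains k :: nat where "cj G x g = x [^] k"
proof -
  have "cj G (x [^] (1::nat)) g \<in> range (\<lambda>n::nat. x [^] n)" using g unfolding normalizer_of_def by blast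
  then have "cj G x g \<in> range (\<lambda>n::nat. x [^] n)" using x by simp
  then show ?thesis using that by blast
qed

lemma normalizer_powers_subgroup:
  assumes "x \<in> carrier G"
  shows "subgroup (normalizer_of G (range (\<lambda>n::nat. x [^] n))) G"
  by (rule normalizer_of_subgroup) (use assms in auto)

lemma cj_iterate:
  assumes x: "x \<in> carrier G" and y: "y \<in> carrier G" and e: "cj G x y = x [^] (b::nat)"
  shows "cj G x (y [^] (n::nat)) = x [^] (b ^ n)"
proof (induction n)
  case (Suc n)
  have "cj G x (y [^] Suc n) = cj G (cj G x (y [^] n)) y" using x y by (simp add: cj_cj)
  also have "\<dots> = (x [^] b) [^] (b ^ n)" unfolding Suc using x y e by (simp add: cj_pow)
  finally show ?case using x by (simp add: nat_pow_pow mult.commute)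
qed (use x in simp)

end

text \<open>The exponent may depend on \<open>v\<close>: the hypothesis only expresses that
  \<open>- s\<close>-elements normalise every cyclic subgroup of \<open>M\<close>.\<close>

locale power_action = fin_group +
  fixes s :: "nat set" and M :: "'a set"
  assumes M_normal: "M \<lhd> G" and M_primes: "prime_factors (card M) \<subseteq> s"
    and power: "\<And>v y. v \<in> M \<Longrightarrow> pi_elt G (- s) y \<Longrightarrow> \<exists>b::nat. cj G v y = v [^] b"
begin

lemma M_sub: "subgroup M G"
  by (rule normal_imp_subgroup[OF M_normal])

lemma M_carrier: "v \<in> M \<Longrightarrow> v \<in> carrier G"
  by (rule subgroup.mem_carrier[OF M_sub])

lemma M_cj: "v \<in> M \<Longrightarrow> y \<in> carrier G \<Longrightarrow> cj G v y \<in> M"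
  using M_normal unfolding normal_iff_cj by blast

lemma M_pi_elt: "v \<in> M \<Longrightarrow> pi_elt G s v"
  by (rule pi_elt_mem_subgroup[OF M_sub M_primes])

lemma prime_mem_s:
  assumes "v \<in> M" "pi_elt G {q} v" "v \<noteq> \<one>"
  shows "q \<in> s"
  using pi_elt_disjoint[OF assms(2) M_pi_elt[OF assms(1)]] assms(3) by auto

text \<open>\<open>n\<close> annihilates \<open>y\<close>, so \<open>b ^ n\<close> acts as 1 on
  \<open>v\<close>; it is prime to \<open>q\<close> because \<open>q\<close> lies in
  \<open>s\<close>. The congruence also makes \<open>b\<close> a unit modulo
  \<open>q\<close>.\<close>

lemma exponent_power_cong:
  assumes v: "v \<in> M" "pi_elt G {q} v" "v \<noteq> \<one>" and q: "prime q"
    and y: "pi_elt G (- s) y" and b: "cj G v y = v [^] (b::nat)"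
  obtains n where "0 < n" "\<not> q dvd n" "y [^] (n::nat) = \<one>" "[int b ^ n = 1] (mod int (ord v))"
    "\<not> int q dvd int b" "q dvd ord v"
proof -
  obtain n where n: "0 < n" "prime_factors n \<subseteq> - s" "y [^] (n::nat) = \<one>" using y unfolding pi_elt_def by blast
  have vc: "v \<in> carrier G" and yc: "y \<in> carrier G" using v y by (auto dest: pi_elt_carrier)
  have "v [^] (b ^ n) = v" using cj_iterate[OF vc yc b, of n] n(3) vc by simp
  then have "v [^] (int b ^ n) = v [^] (1::int)" using vc by (simp flip: int_pow_int)
  then have c: "[int b ^ n = 1] (mod int (ord v))" using pow_eq_iff_cong[OF vc] by blast
  have "ord v \<noteq> 1" using ord_eq_1[OF vc] v(3) by simp
  then obtain p where p: "prime p" "p dvd ord v" using prime_factor_nat by blast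
  have "p = q" using p v(2) ord_positive[OF vc] unfolding pi_elt_iff_ord by (auto simp: prime_factors_dvd)
  then have qd: "q dvd ord v" using p by simp
  have "[int b ^ n = 1] (mod int q)" by (rule cong_dvd_modulus[OF c]) (use qd in simp)
  then have nb: "\<not> int q dvd int b"
    using q n(1) by (metis cong_dvd_iff dvd_power_same dvd_trans dvd_power not_prime_unit prime_nat_int_transfer)
  have "\<not> q dvd n" using prime_mem_s[OF v] n(1,2) q by (auto simp: prime_factors_dvd)
  then show ?thesis using that n c nb qd by blast
qed

text \<open>If \<open>b\<close> were 1 modulo \<open>q\<close>, then \<open>b\<close> and 1 would be
  two roots of the same power congruence agreeing modulo \<open>q\<close>, hence equal modulo
  \<open>ord v\<close>, and \<open>v\<close> would be fixed.\<close>

lemma moved_coprime: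
  assumes v: "v \<in> M" "pi_elt G {q} v" and q: "prime q"
    and y: "pi_elt G (- s) y" and b: "cj G v y = v [^] (b::nat)" and mv: "cj G v y \<noteq> v"
  shows "\<not> int q dvd int b - 1"
proof
  assume d: "int q dvd int b - 1"
  have vc: "v \<in> carrier G" and yc: "y \<in> carrier G" using v y by (auto dest: pi_elt_carrier)
  have v1: "v \<noteq> \<one>" using mv yc by auto
  obtain n where n: "0 < n" "\<not> q dvd n" "[int b ^ n = 1] (mod int (ord v))"
    by (rule exponent_power_cong[OF v v1 q y b])
  have "[int b = 1] (mod int (ord v))"
  proof (rule cong_of_power_cong[OF q ord_positive[OF vc] _ n(2,1)])
    show "prime_factors (ord v) \<subseteq> {q}" using v(2) unfolding pi_elt_iff_ord by blast
    show "[int b = 1] (mod int q)" using d by (simp add: cong_iff_dvd_diff)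
    show "\<not> int q dvd 1" using q by (simp add: prime_nat_iff)
    show "[int b ^ n = 1 ^ n] (mod int (ord v))" using n(3) by simp
  qed
  then have "v [^] int b = v [^] (1::int)" using pow_eq_iff_cong[OF vc] by blast
  then have "v [^] b = v" using vc by (simp add: int_pow_int)
  then show False using mv b by simp
qed

lemma coprime_ord:
  assumes v: "pi_elt G {q} v" and q: "prime q" and i: "\<not> int q dvd i"
  obtains j where "v [^] (i * j) = v"
proof -
  have vc: "v \<in> carrier G" by (rule pi_elt_carrier[OF v])
  have pq: "prime (int q)" using q by simp
  obtain k where "ord v = q ^ k"
    using prime_power_of_prime_factors[OF q ord_positive[OF vc]] v unfolding pi_elt_iff_ord by blast
  then have "coprime i (int (ord v))"
    using prime_imp_coprime[OF pq i] by (simp add: coprime_commute)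
  then obtain j where "[i * j = 1] (mod int (ord v))" using cong_solve_coprime_int by blast
  then have "v [^] (i * j) = v [^] (1::int)" using pow_eq_iff_cong[OF vc] by blast
  then show ?thesis using that vc by simp
qed

text \<open>The commutator of \<open>v\<close> and \<open>y\<close> is the power of \<open>v\<close>
  with exponent b - 1, which is prime to \<open>q\<close>; so it generates the same cyclic group as
  \<open>v\<close>.\<close>

lemma moved_mem:
  assumes v: "v \<in> M" "pi_elt G {q} v" and q: "prime q"
    and y: "pi_elt G (- s) y" and mv: "cj G v y \<noteq> v"
    and B: "subgroup B G" "cm G v y \<in> B"
  shows "v \<in> B"
proof -
  have vc: "v \<in> carrier G" by (rule M_carrier[OF v(1)])
  obtain b :: nat where b: "cj G v y = v [^] b" using power[OF v(1) y] by blast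
  obtain j where j: "v [^] ((int b - 1) * j) = v"
    by (rule coprime_ord[OF v(2) q moved_coprime[OF v q y b mv]])
  have "cm G v y = v [^] (int b - 1)"
    unfolding cm_def b by (rule inv_mult_pow[OF vc])
  then have "cm G v y [^] j = v" using j vc by (simp add: int_pow_pow)
  then show ?thesis using subgroup_int_pow_closed[OF B] by metis
qed

text \<open>On the cyclic group of a moved \<open>v\<close> the action of \<open>y\<close> has no
  nontrivial fixed points, again because b - 1 is invertible modulo \<open>ord v\<close>.\<close>

lemma moved_pow_fixed:
  assumes v: "v \<in> M" "pi_elt G {q} v" and q: "prime q"
    and y: "pi_elt G (- s) y" and mv: "cj G v y \<noteq> v" and fx: "cj G (v [^] (m::int)) y = v [^] m"
  shows "v [^] m = \<one>"
proof -
  have vc: "v \<in> carrier G" and yc: "y \<in> carrier G" using v y by (auto dest: pi_elt_carrier)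
  obtain b :: nat where b: "cj G v y = v [^] b" using power[OF v(1) y] by blast
  obtain j where j: "v [^] ((int b - 1) * j) = v"
    by (rule coprime_ord[OF v(2) q moved_coprime[OF v q y b mv]])
  have "v [^] (int b * m) = v [^] m"
    using fx b vc yc by (simp add: cj_int_pow int_pow_pow flip: int_pow_int)
  then have "[int b * m = m] (mod int (ord v))" using pow_eq_iff_cong[OF vc] by blast
  then have "int (ord v) dvd (int b - 1) * m" by (simp add: cong_iff_dvd_diff algebra_simps)
  then have "v [^] ((int b - 1) * m) = \<one>" using int_pow_eq_id[OF vc] by blast
  moreover have "v [^] m = (v [^] ((int b - 1) * m)) [^] j"
  proof -
    have "v [^] m = (v [^] ((int b - 1) * j)) [^] m" using j by simp
    also have "\<dots> = (v [^] ((int b - 1) * m)) [^] j" using vc by (simp add: int_pow_pow mult.assoc mult.commute mult.left_commute)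
    finally show ?thesis .
  qed
  ultimately show ?thesis by (simp add: int_pow_one)
qed

text \<open>Conjugating u^v by y in two ways, with v^y = vw, shows that w normalises the cyclic
  group of u^v. By \<open>moved_mem\<close> v is a power of w, so v normalises that group too, and
  conjugating back by v gives the claim.\<close>

lemma moved_normalizes:
  assumes v: "v \<in> M" "pi_elt G {q} v" and q: "prime q"
    and y: "pi_elt G (- s) y" and mv: "cj G v y \<noteq> v" and u: "u \<in> M"
  obtains t :: nat where "cj G u v = u [^] t"
proof -
  have vc: "v \<in> carrier G" and yc: "y \<in> carrier G" and uc: "u \<in> carrier G"
    using v y u M_carrier by (auto dest: pi_elt_carrier)
  let ?w = "cm G v y" and ?u = "cj G u v"
  have wc: "?w \<in> carrier G" and u1: "?u \<in> M" and u1c: "?u \<in> carrier G" using vc yc uc M_cj[OF u vc] by auto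
  obtain a :: nat where a: "cj G u y = u [^] a" using power[OF u y] by blast
  obtain c :: nat where c: "cj G ?u y = ?u [^] c" using power[OF u1 y] by blast
  have "cj G ?u y = cj G (cj G u y) (cj G v y)" using uc vc yc by (rule cj_cj_cj)
  also have "\<dots> = cj G u (v \<otimes> ?w) [^] a" unfolding a cj_eq_cm[OF vc yc] using uc vc wc by (simp add: cj_pow)
  also have "cj G u (v \<otimes> ?w) = cj G ?u ?w" using uc vc wc by (simp add: cj_cj)
  finally have e: "cj G ?u ?w [^] a = ?u [^] c" using c by simp
  \<comment> \<open>\<open>a ^ (n - 1)\<close> inverts \<open>a\<close> on the cyclic group of
    \<open>u\<close>, as \<open>y [^] n = \<one>\<close> acts with exponent
    \<open>a ^ n\<close>.\<close>
  obtain a' :: nat where a': "u [^] (a * a') = u"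
  proof -
    obtain n where n: "y [^] (n::nat) = \<one>" "0 < n" using y unfolding pi_elt_def by blast
    have "u [^] (a ^ n) = u" using cj_iterate[OF uc yc a, of n] n(1) uc by simp
    then have "u [^] (a * a ^ (n - 1)) = u" using n(2) by (metis power_eq_if not_gr_zero)
    then show ?thesis by (rule that)
  qed
  have "cj G ?u ?w [^] (a * a') = cj G (cj G (u [^] (a * a')) v) ?w" using uc vc wc by (simp add: cj_pow)
  then have "cj G ?u ?w = (cj G ?u ?w [^] a) [^] a'" using a' u1c wc by (simp add: nat_pow_pow)
  also have "\<dots> = ?u [^] (c * a')" unfolding e using u1c by (simp add: nat_pow_pow)
  finally have "?w \<in> normalizer_of G (range (\<lambda>n::nat. ?u [^] n))" by (rule powers_normalizer[OF u1c wc])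
  then have "v \<in> normalizer_of G (range (\<lambda>n::nat. ?u [^] n))"
    by (rule moved_mem[OF v q y mv normalizer_powers_subgroup[OF u1c]])
  then obtain t :: nat where t: "cj G ?u v = ?u [^] t" by (rule normalizer_powers[OF u1c])
  then have "cj G (cj G ?u v) (inv v) = cj G (?u [^] t) (inv v)" by simp
  then have "?u = u [^] t" using uc vc u1c by (simp add: cj_pow)
  then show ?thesis by (rule that)
qed

text \<open>If \<open>y\<close> moves both \<open>u\<close> and \<open>v\<close>, these normalise each other's cyclic group, so \<open>z = [u, v]\<close> commutes
  with both; comparing the exponents of \<open>y\<close> on \<open>u\<close>, \<open>v\<close> and \<open>z\<close> forces \<open>z = 1\<close>.\<close>
lemma moved_commute:
  assumes v: "v \<in> M" "pi_elt G {q} v" and q: "prime q"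
    and y: "pi_elt G (- s) y" and mv: "cj G v y \<noteq> v"
    and u: "u \<in> M" "pi_elt G {r} u" and r: "prime r"
  shows "u \<otimes> v = v \<otimes> u"
proof -
  have vc: "v \<in> carrier G" and yc: "y \<in> carrier G" and uc: "u \<in> carrier G"
    using v y u M_carrier by (auto dest: pi_elt_carrier)
  obtain t :: nat where t: "cj G u v = u [^] t" by (rule moved_normalizes[OF v q y mv u(1)])
  show ?thesis
  proof (cases "cj G u y = u")
    case True
    let ?w = "cm G v y" and ?u = "cj G u v"
    have wc: "?w \<in> carrier G" and u1c: "?u \<in> carrier G" using vc yc uc by auto
    \<comment> \<open>When \<open>y\<close> fixes \<open>u\<close> it fixes the power
      \<open>?u\<close>, and the same double conjugation shows that \<open>?w\<close>, hence
      \<open>v\<close>, centralises \<open>?u\<close>.\<close>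
    have "cj G ?u ?w = cj G u (cj G v y)" unfolding cj_eq_cm[OF vc yc] using uc vc wc by (simp add: cj_cj)
    also have "\<dots> = cj G ?u y" using cj_cj_cj[OF uc vc yc] True by simp
    also have "\<dots> = ?u" unfolding t using uc yc True by (simp add: cj_pow)
    finally have "?w \<in> normalizer_of G {?u}" using wc by (simp add: mem_normalizer_singleton)
    moreover have "subgroup (normalizer_of G {?u}) G" by (rule normalizer_of_subgroup) (use u1c in simp)
    ultimately have "v \<in> normalizer_of G {?u}" using moved_mem[OF v q y mv] by blast
    then have "cj G ?u v = ?u" by (simp add: mem_normalizer_singleton)
    then have "?u = u" using cj_inj[OF u1c uc vc] by simp
    then show ?thesis using cj_eq_iff_commute[OF uc vc] by simp
  next
    case False
    obtain t' :: nat where t': "cj G v u = v [^] t'" by (rule moved_normalizes[OF u r y False v(1)])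
    obtain a :: nat where a: "cj G u y = u [^] a" using power[OF u(1) y] by blast
    obtain b :: nat where b: "cj G v y = v [^] b" using power[OF v(1) y] by blast
    let ?z = "cm G u v"
    have zc: "?z \<in> carrier G" using uc vc by simp
    have zu: "?z = u [^] (int t - 1)"
      unfolding cm_def t by (rule inv_mult_pow[OF uc])
    have "cm G v u = v [^] (int t' - 1)"
      unfolding cm_def t' by (rule inv_mult_pow[OF vc])
    \<comment> \<open>The commutator is a power of \<open>u\<close> and of \<open>v\<close>, so it
      commutes with both, and \<open>y\<close> acts on it with either exponent \<open>a\<close> or
      \<open>b\<close>.\<close>
    then have zv: "?z = v [^] (1 - int t')"
      using cm_inv[OF vc uc] vc by (metis int_pow_neg minus_diff_eq)
    have zv_comm: "?z \<otimes> v = v \<otimes> ?z" unfolding zv using vc by (metis int_pow_1 int_pow_mult add.commute)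
    have zu_comm: "u \<otimes> ?z = ?z \<otimes> u" unfolding zu using uc by (metis int_pow_1 int_pow_mult add.commute)
    have za: "cj G ?z y = ?z [^] a" unfolding zu using uc yc a
      by (simp add: cj_int_pow int_pow_pow mult.commute flip: int_pow_int)
    have zb: "cj G ?z y = ?z [^] b" unfolding zv using vc yc b
      by (simp add: cj_int_pow int_pow_pow mult.commute flip: int_pow_int)
    have uv: "cj G u v = u \<otimes> ?z" by (rule cj_eq_cm[OF uc vc])
    have uvb: "cj G u (v [^] n) = u \<otimes> ?z [^] n" for n :: nat
    proof (induction n)
      case (Suc n)
      have "cj G u (v [^] Suc n) = cj G (cj G u (v [^] n)) v" using uc vc by (simp add: cj_cj)
      also have "\<dots> = cj G u v \<otimes> cj G ?z v [^] n" unfolding Suc using uc vc zc by (simp add: cj_mult cj_pow)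
      also have "cj G ?z v = ?z" using cj_eq_iff_commute[OF zc vc] zv_comm by simp
      also have "cj G u v \<otimes> ?z [^] n = u \<otimes> ?z [^] Suc n"
        unfolding uv using uc zc by (simp add: m_assoc commute_pow)
      finally show ?case .
    qed (use uc in simp)
    have "u [^] a \<otimes> ?z [^] a = cj G (u \<otimes> ?z) y" using uc zc yc a za by (simp add: cj_mult)
    also have "\<dots> = cj G (cj G u y) (cj G v y)" unfolding uv[symmetric] by (rule cj_cj_cj[OF uc vc yc])
    also have "\<dots> = cj G u (v [^] b) [^] a" unfolding a b using uc vc by (simp add: cj_pow)
    also have "\<dots> = u [^] a \<otimes> (?z [^] b) [^] a" unfolding uvb
      by (rule pow_mult_distrib) (use commute_pow[OF zc uc zu_comm[symmetric], of b] uc zc in auto)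
    finally have "?z [^] a = (?z [^] b) [^] a" using uc zc by simp
    \<comment> \<open>The last equation says that z^a, which is the image of z under y, is fixed by
      y. Being a power of the moved element \<open>v\<close>, it is trivial.\<close>
    then have fz: "cj G (cj G ?z y) y = cj G ?z y"
      using cj_pow[OF zc yc, of a] unfolding za[symmetric] zb[symmetric] by simp
    have "(v [^] (1 - int t')) [^] b = v [^] ((1 - int t') * int b)" using vc by (simp add: int_pow_pow flip: int_pow_int)
    then have "cj G ?z y = v [^] ((1 - int t') * int b)" using zb zv by (simp only:)
    then have "cj G ?z y = \<one>" using moved_pow_fixed[OF v q y mv, of "(1 - int t') * int b"] fz by simp
    then have "?z = \<one>" using cj_inj[OF zc one_closed yc] yc by simp
    then show ?thesis using cm_eq_one_iff[OF uc vc] by simp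
  qed
qed

lemma moved_central:
  assumes v: "v \<in> M" "pi_elt G {q} v" and q: "prime q"
    and y: "pi_elt G (- s) y" and mv: "cj G v y \<noteq> v" and u: "u \<in> M"
  shows "u \<otimes> v = v \<otimes> u"
proof -
  have vc: "v \<in> carrier G" and uc: "u \<in> carrier G" using v u M_carrier by auto
  have "u \<in> normalizer_of G {v}"
  proof (rule prime_parts_mem[OF normalizer_of_subgroup uc])
    fix p and k :: nat assume p: "prime p" and pk: "pi_elt G {p} (u [^] k)"
    have "u [^] k \<otimes> v = v \<otimes> u [^] k"
      by (rule moved_commute[OF v q y mv subgroup_pow_closed[OF M_sub u] pk p])
    then show "u [^] k \<in> normalizer_of G {v}"
      using cj_eq_iff_commute[OF vc, of "u [^] k"] uc by (simp add: mem_normalizer_singleton)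
  qed (use vc in simp)
  then show ?thesis using cj_eq_iff_commute[OF vc uc] by (simp add: mem_normalizer_singleton)
qed

end


section \<open>Equality of exponents on conjugates, and its consequences\<close>

context power_action
begin

text \<open>A \<open>-s\<close>-element acts on all conjugate elements of prime power order with the same exponent: an exponent
  of order prime to \<open>q\<close> is determined modulo \<open>q\<close>, and modulo \<open>q\<close> one compares with the exponent on the product.\<close>
lemma conj_acts_alike:
  assumes u: "u \<in> M" "pi_elt G {q} u" and q: "prime q"
    and y: "pi_elt G (- s) y" and x: "x \<in> carrier G"
  shows "cj G u (cj G y x) = cj G u y"
proof -
  let ?u = "cj G u (inv x)"
  have uc: "u \<in> carrier G" and yc: "y \<in> carrier G" using u y by (auto dest: pi_elt_carrier)
  have xi: "inv x \<in> carrier G" using x by simp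
  have u': "?u \<in> M" "pi_elt G {q} ?u" using M_cj[OF u(1) xi] pi_elt_cj[OF u(2) xi] by auto
  have uc': "?u \<in> carrier G" by (rule M_carrier[OF u'(1)])
  have oo: "ord ?u = ord u" by (rule ord_cj[OF uc xi])
  obtain a :: nat where a: "cj G u y = u [^] a" using power[OF u(1) y] by blast
  obtain c :: nat where c: "cj G ?u y = ?u [^] c" using power[OF u'(1) y] by blast
  have "cj G u (cj G y x) = cj G (cj G ?u x) (cj G y x)" using uc x by simp
  also have "\<dots> = cj G (cj G ?u y) x" by (rule cj_cj_cj[OF uc' yc x, symmetric])
  also have "\<dots> = u [^] c" unfolding c using uc uc' x by (simp add: cj_pow)
  finally have e1: "cj G u (cj G y x) = u [^] c" .
  have "u [^] c = u [^] a"
  proof (cases "u = \<one>")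
    case False
    have u1: "?u \<noteq> \<one>" using False cj_inj[OF uc one_closed xi] xi by simp
    have key: "u [^] c = u [^] a" if "[int c = int a] (mod int (ord u))"
      using that pow_eq_iff_cong[OF uc, of "int c" "int a"] by (simp add: int_pow_int)
    have key': "[int c = int a] (mod int (ord u))" if ca: "[int c = int a] (mod int q)"
    proof -
      obtain n where n: "0 < n" "\<not> q dvd n" "y [^] (n::nat) = \<one>" "[int a ^ n = 1] (mod int (ord u))"
        "\<not> int q dvd int a" "q dvd ord u"
        by (rule exponent_power_cong[OF u False q y a])
      have "?u [^] (c ^ n) = ?u" using cj_iterate[OF uc' yc c, of n] n(3) uc' by simp
      then have "?u [^] (int c ^ n) = ?u [^] (1::int)" using uc' by (simp flip: int_pow_int)
      then have "[int c ^ n = 1] (mod int (ord u))" using pow_eq_iff_cong[OF uc'] oo by simp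
      then have "[int c ^ n = int a ^ n] (mod int (ord u))" using n(4) by (meson cong_sym cong_trans)
      moreover have "prime_factors (ord u) \<subseteq> {q}" using u(2) unfolding pi_elt_iff_ord by blast
      ultimately show ?thesis using cong_of_power_cong[OF q ord_positive[OF uc] _ n(2,1) ca n(5)] by blast
    qed
    show ?thesis
    proof (cases "cj G u y = u \<and> cj G ?u y = ?u")
      case True
      then have "?u [^] (int c) = ?u [^] (1::int)" "u [^] (int a) = u [^] (1::int)" using a c uc uc' by (auto simp: int_pow_int)
      then have "[int c = 1] (mod int (ord u))" "[int a = 1] (mod int (ord u))"
        using pow_eq_iff_cong[OF uc] pow_eq_iff_cong[OF uc'] oo by auto
      then show ?thesis using key by (meson cong_sym cong_trans)
    next
      case False
      \<comment> \<open>At least one of \<open>u\<close> and \<open>?u\<close> is moved by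
        \<open>y\<close>, and a moved element is central in \<open>M\<close>.\<close>
      then have comm: "u \<otimes> ?u = ?u \<otimes> u"
        using moved_central[OF u q y _ u'(1)] moved_central[OF u' q y _ u(1)] by metis
      have wM: "u \<otimes> ?u \<in> M" by (rule subgroup.m_closed[OF M_sub u(1) u'(1)])
      obtain e :: nat where e: "cj G (u \<otimes> ?u) y = (u \<otimes> ?u) [^] e" using power[OF wM y] by blast
      have "u [^] e \<otimes> ?u [^] e = u [^] a \<otimes> ?u [^] c"
        using e pow_mult_distrib[OF comm uc uc', of e] cj_mult[OF uc uc' yc] a c by simp
      then have "u [^] int e \<otimes> ?u [^] int e = u [^] int a \<otimes> ?u [^] int c" by (simp add: int_pow_int)
      then have eq: "u [^] (int e - int a) = ?u [^] (int c - int e)"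
        by (rule int_pow_diff_eq[OF uc uc'])
      show ?thesis
      \<comment> \<open>If q divides e - a, raising \<open>eq\<close> to the power \<open>m\<close>
        shows that it divides c - e as well, so a and c agree modulo q. Otherwise u is a power of
        its conjugate, and y acts on it with exponent c.\<close>
      proof (cases "int q dvd int e - int a")
        case True
        obtain n where qo: "q dvd ord u" by (rule exponent_power_cong[OF u \<open>u \<noteq> \<one>\<close> q y a])
        then obtain m where m: "ord u = q * m" by (elim dvdE)
        have m0: "0 < m" using m ord_positive[OF uc] by (auto intro: gr0I)
        have "int (ord u) dvd (int e - int a) * int m" unfolding m using True by simp
        then have "u [^] ((int e - int a) * int m) = \<one>" using int_pow_eq_id[OF uc] by blast
        then have "(?u [^] (int c - int e)) [^] int m = \<one>" using uc by (simp add: int_pow_pow flip: eq)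
        then have "int (ord u) dvd (int c - int e) * int m" using int_pow_eq_id[OF uc'] oo uc' by (simp add: int_pow_pow)
        then have "int q dvd int c - int e" unfolding m using m0 by simp
        then have "int q dvd (int c - int e) + (int e - int a)" using True by (rule dvd_add)
        then show ?thesis using key key' by (simp add: cong_iff_dvd_diff)
      next
        case False
        obtain j where "u [^] ((int e - int a) * j) = u" by (rule coprime_ord[OF u(2) q False])
        then have u2: "u = ?u [^] ((int c - int e) * j)" using uc uc' eq by (metis int_pow_pow)
        have "cj G u y = cj G (?u [^] ((int c - int e) * j)) y" using u2 by simp
        also have "\<dots> = (?u [^] ((int c - int e) * j)) [^] int c"
          using uc' yc c by (simp add: cj_int_pow int_pow_pow mult.commute flip: int_pow_int)
        also have "\<dots> = u [^] c" using u2 by (simp add: int_pow_int)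
        finally show ?thesis using a by simp
      qed
    qed
  qed simp
  then show ?thesis using e1 a by simp
qed

text \<open>[y, x] is the quotient of y and its conjugate by x, and \<open>conj_acts_alike\<close>
  says that these two act in the same way on elements of prime power order.\<close>

lemma cm_centralizes:
  assumes y: "pi_elt G (- s) y" and x: "x \<in> carrier G" and m: "m \<in> M"
  shows "m \<otimes> cm G y x = cm G y x \<otimes> m"
proof -
  have yc: "y \<in> carrier G" and mc: "m \<in> carrier G" using y M_carrier[OF m] by (auto dest: pi_elt_carrier)
  let ?g = "cm G y x"
  have gc: "?g \<in> carrier G" using yc x by simp
  have "m \<in> normalizer_of G {?g}"
  proof (rule prime_parts_mem[OF normalizer_of_subgroup mc])
    fix p and k :: nat assume p: "prime p" and pk: "pi_elt G {p} (m [^] k)"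
    let ?u = "m [^] k" let ?v = "cj G ?u (inv y)"
    have uM: "?u \<in> M" by (rule subgroup_pow_closed[OF M_sub m])
    have yi: "inv y \<in> carrier G" and uc: "?u \<in> carrier G" using yc mc by auto
    have "cj G ?u ?g = cj G ?v (cj G y x)" unfolding cm_def using uc yc x by (simp add: cj_cj)
    also have "\<dots> = cj G ?v y" by (rule conj_acts_alike[OF M_cj[OF uM yi] pi_elt_cj[OF pk yi] p y x])
    also have "\<dots> = ?u" using uc yc by simp
    finally have "?u \<otimes> ?g = ?g \<otimes> ?u" using cj_eq_iff_commute[OF uc gc] by simp
    then show "?u \<in> normalizer_of G {?g}"
      using cj_eq_iff_commute[OF gc uc] uc by (simp add: mem_normalizer_singleton)
  qed (use gc in simp)
  then show ?thesis using cj_eq_iff_commute[OF gc mc] by (simp add: mem_normalizer_singleton)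
qed

text \<open>In each generating commutator at least one entry is a \<open>- s\<close>-element: the
  second if its class is \<open>s\<close>, the first otherwise.\<close>

lemma sigma_comm_centralizes:
  assumes \<sigma>: "sigma_partition \<sigma>" and s: "s \<in> \<sigma>" and g: "g \<in> sigma_comm \<sigma> G" and m: "m \<in> M"
  shows "m \<otimes> g = g \<otimes> m"
proof -
  have mc: "m \<in> carrier G" by (rule M_carrier[OF m])
  have "sigma_comm \<sigma> G \<subseteq> normalizer_of G {m}"
  proof (rule sigma_comm_minimal[OF normalizer_of_subgroup])
    fix t x y assume t: "t \<in> \<sigma>" "pi_elt G t x" "pi_elt G (- t) y"
    have c: "x \<in> carrier G" "y \<in> carrier G" using t by (auto dest: pi_elt_carrier)
    have "m \<otimes> cm G x y = cm G x y \<otimes> m"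
    proof (cases "t = s")
      case True
      have yx: "m \<otimes> cm G y x = cm G y x \<otimes> m" using cm_centralizes[OF _ c(1) m] t(3) True by simp
      have "cm G y x \<in> normalizer_of G {m}" using yx cj_eq_iff_commute[OF mc, of "cm G y x"] c by (simp add: mem_normalizer_singleton)
      then have "inv (cm G y x) \<in> normalizer_of G {m}"
        using subgroup.m_inv_closed[OF normalizer_of_subgroup, of "{m}"] mc by simp
      then show ?thesis using cj_eq_iff_commute[OF mc, of "cm G x y"] c by (simp add: cm_inv mem_normalizer_singleton)
    next
      case False
      then have "t \<subseteq> - s" using sigma_partition_disjoint[OF \<sigma> s t(1)] by blast
      then show ?thesis using cm_centralizes[OF pi_elt_mono[OF t(2)] c(2) m] by simp
    qed
    then show "cm G x y \<in> normalizer_of G {m}"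
      using cj_eq_iff_commute[OF mc, of "cm G x y"] c by (simp add: mem_normalizer_singleton)
  qed (use mc in simp)
  then have "cj G m g = m" "g \<in> carrier G" using g by (auto simp: mem_normalizer_singleton subset_iff)
  then show ?thesis using cj_eq_iff_commute[OF mc] by simp
qed

text \<open>Look at the exponent c of y on vu, which is moved too. Comparing powers gives u^(c - 1)
  as a power of v; as c - 1 is prime to q, u itself is a power of v, and a fixed power of v is
  trivial.\<close>

lemma moved_all:
  assumes v: "v \<in> M" "pi_elt G {q} v" and q: "prime q"
    and y: "pi_elt G (- s) y" and mv: "cj G v y \<noteq> v"
    and u: "u \<in> M" "pi_elt G {q} u" and fx: "cj G u y = u"
  shows "u = \<one>"
proof -
  have vc: "v \<in> carrier G" and yc: "y \<in> carrier G" and uc: "u \<in> carrier G"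
    using v y u M_carrier by (auto dest: pi_elt_carrier)
  have comm: "v \<otimes> u = u \<otimes> v" using moved_central[OF v q y mv u(1)] by simp
  have wM: "v \<otimes> u \<in> M" by (rule subgroup.m_closed[OF M_sub v(1) u(1)])
  have wq: "pi_elt G {q} (v \<otimes> u)" by (rule pi_elt_mult_commute[OF v(2) u(2) comm])
  obtain b :: nat where b: "cj G v y = v [^] b" using power[OF v(1) y] by blast
  obtain c :: nat where c: "cj G (v \<otimes> u) y = (v \<otimes> u) [^] c" using power[OF wM y] by blast
  have "cj G (v \<otimes> u) y \<noteq> v \<otimes> u" using cj_mult[OF vc uc yc] fx mv vc uc yc by simp
  then have nd: "\<not> int q dvd int c - 1" by (rule moved_coprime[OF wM wq q y c])
  obtain j where j: "u [^] ((int c - 1) * j) = u" by (rule coprime_ord[OF u(2) q nd])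
  have "v [^] b \<otimes> u = v [^] c \<otimes> u [^] c"
    using c pow_mult_distrib[OF comm vc uc, of c] cj_mult[OF vc uc yc] b fx by simp
  then have "v [^] int b \<otimes> u [^] (1::int) = v [^] int c \<otimes> u [^] int c" using uc by (simp add: int_pow_int)
  then have "u [^] (int c - 1) = v [^] (int b - int c)" using int_pow_diff_eq[OF vc uc] by simp
  then have u2: "u = v [^] ((int b - int c) * j)" using j uc vc by (metis int_pow_pow)
  then show ?thesis using moved_pow_fixed[OF v q y mv, of "(int b - int c) * j"] fx by simp
qed

definition moved_primes :: "nat set" where
  "moved_primes = {q. prime q \<and>
     (\<exists>v y. v \<in> M \<and> pi_elt G {q} v \<and> pi_elt G (- s) y \<and> cj G v y \<noteq> v)}"

lemma moved_primesE:
  assumes "q \<in> moved_primes"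
  obtains v y where "v \<in> M" "pi_elt G {q} v" "pi_elt G (- s) y" "cj G v y \<noteq> v" "prime q" "q \<in> s"
proof -
  obtain v y where vy: "v \<in> M" "pi_elt G {q} v" "pi_elt G (- s) y" "cj G v y \<noteq> v" "prime q"
    using assms unfolding moved_primes_def by blast
  have "v \<noteq> \<one>" using vy(3,4) by (auto dest: pi_elt_carrier)
  then show ?thesis using that vy prime_mem_s[OF vy(1,2)] by blast
qed

text \<open>Both the exponent \<open>b\<close> and b - 1 would have to be odd. This is the origin of
  the odd order of D.\<close>

lemma two_not_moved: "2 \<notin> moved_primes"
proof
  assume "2 \<in> moved_primes"
  then obtain v y where v: "v \<in> M" "pi_elt G {2} v" and y: "pi_elt G (- s) y" and mv: "cj G v y \<noteq> v"
    and p: "prime (2::nat)" by (rule moved_primesE)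
  obtain b :: nat where b: "cj G v y = v [^] b" using power[OF v(1) y] by blast
  have "v \<noteq> \<one>" using mv y by (auto dest: pi_elt_carrier)
  then have "\<not> int 2 dvd int b" by (rule exponent_power_cong[OF v _ p y b])
  then show False using moved_coprime[OF v p y b mv] by simp
qed

end


section \<open>Necessity\<close>

context fin_group
begin

lemma powers_subgroup:
  assumes v: "v \<in> carrier G"
  shows "subgroup (range (\<lambda>n::nat. v [^] n)) G"
proof (rule subgroupI)
  fix x assume "x \<in> range (\<lambda>n::nat. v [^] n)"
  then obtain n :: nat where n: "x = v [^] n" by blast
  \<comment> \<open>The exponent \<open>order G - 1\<close> acts as -1, so natural powers are closed
    under inverses.\<close>
  have "v [^] (n * (order G - 1)) \<otimes> v [^] n = v [^] (n * order G)"
  proof -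
    have "n * (order G - 1) + n = n * order G" using order_pos by (cases "order G") auto
    then show ?thesis using v by (simp add: nat_pow_mult)
  qed
  also have "\<dots> = \<one>" using pow_order_eq_1[of "v [^] n"] v by (simp add: nat_pow_pow)
  finally have "inv x = v [^] (n * (order G - 1))" unfolding n using v by (intro inv_equality) auto
  then show "inv x \<in> range (\<lambda>n::nat. v [^] n)" by blast
next
  fix x y assume "x \<in> range (\<lambda>n::nat. v [^] n)" "y \<in> range (\<lambda>n::nat. v [^] n)"
  then show "x \<otimes> y \<in> range (\<lambda>n::nat. v [^] n)" using v by (auto simp: nat_pow_mult)
qed (use v in auto)

lemma hall_subgroupI:
  assumes D: "subgroup D G" and el: "\<And>q x. q \<in> prime_factors (card D) \<Longrightarrow> pi_elt G {q} x \<Longrightarrow> x \<in> D"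
  shows "hall_subgroup G D"
  unfolding hall_subgroup_def
proof (intro conjI D, rule ccontr)
  assume "\<not> coprime (card D) (order G div card D)"
  then have "gcd (card D) (order G div card D) \<noteq> 1" by (simp add: coprime_iff_gcd_eq_1)
  then obtain q where q: "prime q" "q dvd gcd (card D) (order G div card D)" using prime_factor_nat by blast
  then have "q \<in> prime_factors (card D)" using card_subgroup_pos[OF D] by (simp add: prime_factors_dvd)
  then have "\<not> q dvd order G div card D" using sylow_index[OF D q(1)] el by blast
  then show False using q(2) by simp
qed

lemma power_aut_of_normal:
  assumes V: "V \<lhd> G" and g: "g \<in> carrier G"
  shows "(\<lambda>x. inv g \<otimes> x \<otimes> g) ` V = V"
proof
  note sV = normal_imp_subgroup[OF V]
  show "(\<lambda>x. inv g \<otimes> x \<otimes> g) ` V \<subseteq> V" using V g unfolding normal_iff_cj cj_def by blast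
  show "V \<subseteq> (\<lambda>x. inv g \<otimes> x \<otimes> g) ` V"
  proof
    fix v assume v: "v \<in> V"
    have "cj G v (inv g) \<in> V" using V g v unfolding normal_iff_cj by simp
    moreover have "v = cj G (cj G v (inv g)) g" using subgroup.mem_carrier[OF sV v] g by simp
    ultimately show "v \<in> (\<lambda>x. inv g \<otimes> x \<otimes> g) ` V" unfolding cj_def[of G _ g] by blast
  qed
qed

text \<open>The index of the intersection in \<open>M\<close> equals the index of \<open>Q\<close>
  in the product of \<open>Q\<close> and \<open>M\<close>, which divides the index of
  \<open>Q\<close> in the group.\<close>

lemma hall_Int_normal:
  assumes Q: "hall_sigma_subgroup t G Q" and M: "M \<lhd> G"
  shows "hall_sigma_subgroup t (G\<lparr>carrier := M\<rparr>) (Q \<inter> M)"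
proof -
  note h = hall_subgroupD[OF Q] and sM = normal_imp_subgroup[OF M]
  note sm = set_mult_normal_subgroup[OF M h(1)]
  have i: "subgroup (Q \<inter> M) G" by (rule subgroups_Inter_pair[OF h(1) sM])
  have "card (Q \<inter> M) dvd card Q" by (rule card_subgroup_mono_dvd[OF i h(1)]) blast
  then have 1: "prime_factors (card (Q \<inter> M)) \<subseteq> t"
    using subset_trans[OF prime_factors_mono_dvd h(2)] card_subgroup_pos[OF h(1)] by simp
  have "card (Q \<inter> M) dvd card M" by (rule card_subgroup_mono_dvd[OF i sM]) blast
  then obtain k where k: "card M = card (Q \<inter> M) * k" by (elim dvdE)
  have pos: "0 < card (Q \<inter> M)" "0 < card Q" using card_subgroup_pos[OF i] card_subgroup_pos[OF h(1)] by auto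
  have "card (Q <#> M) = card Q * k" using card_set_mult[OF h(1) sM] k pos by simp
  then have "card Q * k dvd order G" using card_subgroup_dvd[OF sm(1)] by simp
  then have "k dvd order G div card Q" using pos by (metis dvd_mult_imp_div mult.commute)
  then have "prime_factors k \<subseteq> - t"
    using subset_trans[OF prime_factors_mono_dvd h(3)] index_pos[OF h(1)] by simp
  moreover have "order (G\<lparr>carrier := M\<rparr>) div card (Q \<inter> M) = k" using k pos by (simp add: order_def)
  ultimately show ?thesis unfolding hall_sigma_subgroup_def
    using 1 subgroup_incl[OF i sM] by auto
qed

lemma hall_times_normal:
  assumes H: "hall_sigma_subgroup s G H" and N: "N \<lhd> G" "prime_factors (order G div card N) \<subseteq> s"
  shows "H <#> N = carrier G"
proof (rule ccontr)
  note h = hall_subgroupD[OF H] and sN = normal_imp_subgroup[OF N(1)]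
  note sm = set_mult_normal_subgroup[OF N(1) h(1)]
  assume ne: "H <#> N \<noteq> carrier G"
  let ?k = "order G div card (H <#> N)"
  have "?k \<noteq> 1"
  proof
    assume "?k = 1"
    then have "card (H <#> N) = card (carrier G)" using order_eq_index[OF sm(1)] by (simp add: order_def)
    then show False using ne card_subset_eq[OF fin subgroup.subset[OF sm(1)]] by blast
  qed
  then obtain p where p: "prime p" "p dvd ?k" using prime_factor_nat by blast
  have "?k dvd order G div card H" "?k dvd order G div card N"
    using index_dvd_index[OF card_subgroup_mono_dvd[OF h(1) sm(1,2)] card_subgroup_dvd[OF sm(1)] card_subgroup_pos[OF sm(1)]]
      index_dvd_index[OF card_subgroup_mono_dvd[OF sN sm(1,3)] card_subgroup_dvd[OF sm(1)] card_subgroup_pos[OF sm(1)]] by auto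
  then have "p \<in> prime_factors (order G div card H)" "p \<in> prime_factors (order G div card N)"
    using p index_pos[OF h(1)] index_pos[OF sN] by (auto simp: prime_factors_dvd intro: dvd_trans)
  then show False using h(3) N(2) by blast
qed

lemma set_mult_absorb:
  assumes V: "subgroup V G" and H: "subgroup H G" "H \<subseteq> V"
  shows "V <#> H = V" "H <#> V = V"
proof -
  have "V <#> H \<subseteq> V <#> V" "H <#> V \<subseteq> V <#> V" using H(2) by (auto intro: mono_set_mult[THEN subsetD, rotated -1])
  then have 1: "V <#> H \<subseteq> V" "H <#> V \<subseteq> V" using subgroup_mult_id[OF V] by auto
  show "V <#> H = V"
  proof
    show "V \<subseteq> V <#> H"
    proof
      fix v assume v: "v \<in> V"
      have "v \<otimes> \<one> \<in> V <#> H" by (rule set_mult_memI[OF v subgroup.one_closed[OF H(1)]])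
      then show "v \<in> V <#> H" using subgroup.mem_carrier[OF V v] by simp
    qed
  qed (rule 1)
  show "H <#> V = V"
  proof
    show "V \<subseteq> H <#> V"
    proof
      fix v assume v: "v \<in> V"
      have "\<one> \<otimes> v \<in> H <#> V" by (rule set_mult_memI[OF subgroup.one_closed[OF H(1)] v])
      then show "v \<in> H <#> V" using subgroup.mem_carrier[OF V v] by simp
    qed
  qed (rule 1)
qed

text \<open>Inside \<open>M\<close> a Hall \<open>s\<close>-subgroup together with \<open>K\<close>
  gives all of \<open>M\<close>, and the other Hall subgroups lie in \<open>K\<close>; both cases
  permute with \<open>V\<close>. The normal subgroup \<open>M\<close> is \<sigma>-quasinormal in G,
  and transitivity does the rest.\<close>

lemma PsigmaT_section_quasinormal:
  assumes \<sigma>: "sigma_partition \<sigma>" and P: "PsigmaT_group \<sigma> G"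
    and hall: "\<And>s. s \<in> \<sigma> \<Longrightarrow> \<exists>H. hall_sigma_subgroup s G H" and s: "s \<in> \<sigma>"
    and K: "K \<lhd> G" and M: "M \<lhd> G" "prime_factors (card M div card K) \<subseteq> s"
    and V: "subgroup V G" "K \<subseteq> V" "V \<subseteq> M"
  shows "sigma_quasinormal \<sigma> G V"
proof -
  note sM = normal_imp_subgroup[OF M(1)] and sK = normal_imp_subgroup[OF K]
  interpret M: fin_group "G\<lparr>carrier := M\<rparr>" by (rule fin_group_subgroup[OF sM])
  have KM: "K \<lhd> G\<lparr>carrier := M\<rparr>" by (rule normal_restrict_supergroup[OF sM K]) (use V in blast)
  have VM: "subgroup V (G\<lparr>carrier := M\<rparr>)" by (rule subgroup_incl[OF V(1) sM V(3)])
  have "sigma_quasinormal \<sigma> (G\<lparr>carrier := M\<rparr>) V"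
  proof (rule M.sigma_quasinormalI[OF \<sigma> VM])
    fix t assume t: "t \<in> \<sigma>"
    obtain Q where "hall_sigma_subgroup t G Q" using hall[OF t] by blast
    then have "hall_sigma_subgroup t (G\<lparr>carrier := M\<rparr>) (Q \<inter> M)" by (rule hall_Int_normal[OF _ M(1)])
    then show "\<exists>H. hall_sigma_subgroup t (G\<lparr>carrier := M\<rparr>) H" ..
  next
    fix t H assume t: "t \<in> \<sigma>" and H: "hall_sigma_subgroup t (G\<lparr>carrier := M\<rparr>) H"
    note h = M.hall_subgroupD[OF H]
    have idx: "prime_factors (order (G\<lparr>carrier := M\<rparr>) div card K) \<subseteq> s" using M(2) by (simp add: order_def)
    show "V <#>\<^bsub>G\<lparr>carrier := M\<rparr>\<^esub> H = H <#>\<^bsub>G\<lparr>carrier := M\<rparr>\<^esub> V"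
    proof (cases "t = s")
      case True
      have HK: "H <#> K = M" using M.hall_times_normal[OF H[unfolded True] KM idx] by simp
      then have KH: "K <#> H = M" using M.commut_normal[OF h(1) KM] by simp
      have "M \<subseteq> V <#> H" "M \<subseteq> H <#> V"
        using mono_set_mult[OF V(2) subset_refl[of H], of G] mono_set_mult[OF subset_refl[of H] V(2), of G] HK KH by auto
      moreover have "V <#> H \<subseteq> M" "H <#> V \<subseteq> M"
        using M.setmult_subset_G[of V H] M.setmult_subset_G[of H V] V(3) subgroup.subset[OF h(1)] by auto
      ultimately show ?thesis by simp
    next
      case False
      then have st: "s \<subseteq> - t" using sigma_partition_disjoint[OF \<sigma> s t] by blast
      have "H \<subseteq> K"
      proof
        fix x assume "x \<in> H"
        then have "pi_elt (G\<lparr>carrier := M\<rparr>) t x" by (rule M.pi_elt_mem_subgroup[OF h(1,2)])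
        then show "x \<in> K" by (rule M.normal_contains_coprime[OF KM]) (use idx st in blast)
      qed
      then show ?thesis using M.set_mult_absorb[OF VM h(1)] V(2) by blast
    qed
  qed
  moreover have "sigma_quasinormal \<sigma> G M"
    by (rule sigma_quasinormalI[OF \<sigma> sM hall]) (auto simp: commut_normal[OF hall_subgroupD(1) M(1)])
  ultimately show ?thesis using P unfolding PsigmaT_group_def by blast
qed

text \<open>The set is the normal core of \<open>B\<close>.\<close>

lemma core_normal:
  assumes B: "subgroup B G"
  shows "{g \<in> carrier G. \<forall>x\<in>carrier G. cj G g x \<in> B} \<lhd> G"
  unfolding normal_iff_cj
proof (intro conjI ballI)
  show "subgroup {g \<in> carrier G. \<forall>x\<in>carrier G. cj G g x \<in> B} G"
  proof (rule subgroupI)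
    have "\<one> \<in> {g \<in> carrier G. \<forall>x\<in>carrier G. cj G g x \<in> B}" using subgroup.one_closed[OF B] by simp
    then show "{g \<in> carrier G. \<forall>x\<in>carrier G. cj G g x \<in> B} \<noteq> {}" by blast
  qed (auto simp: cj_inv cj_mult subgroup.m_inv_closed[OF B] subgroup.m_closed[OF B])
qed (auto simp: cj_cj)

text \<open>The Hall subgroups permuting with \<open>V\<close> depend on \<open>V\<close>, but the normal closure of those for \<open>t \<noteq> s\<close> has
  index an \<open>s\<close>-number, so it contains all elements of order prime to \<open>s\<close>.\<close>
lemma PsigmaT_normalizes:
  assumes \<sigma>: "sigma_partition \<sigma>" and P: "PsigmaT_group \<sigma> G"
    and hall: "\<And>s. s \<in> \<sigma> \<Longrightarrow> \<exists>H. hall_sigma_subgroup s G H" and s: "s \<in> \<sigma>"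
    and K: "K \<lhd> G" and M: "M \<lhd> G" "prime_factors (card M div card K) \<subseteq> s"
    and V: "subgroup V G" "K \<subseteq> V" "V \<subseteq> M" and y: "pi_elt G (- s) y" and v: "v \<in> V"
  shows "cj G v y \<in> V"
proof -
  note sM = normal_imp_subgroup[OF M(1)]
  have qn: "sigma_quasinormal \<sigma> G V" by (rule PsigmaT_section_quasinormal[OF \<sigma> P hall s K M V])
  interpret M: fin_group "G\<lparr>carrier := M\<rparr>" by (rule fin_group_subgroup[OF sM])
  have KM: "K \<lhd> G\<lparr>carrier := M\<rparr>" by (rule normal_restrict_supergroup[OF sM K]) (use V in blast)
  have Vc: "V \<subseteq> carrier G" by (rule subgroup.subset[OF V(1)])
  \<comment> \<open>The core of the normalizer plays the part of the normal closure: it contains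
    each of the Hall subgroups in question because all their conjugates normalise
    \<open>V\<close>.\<close>
  let ?B = "normalizer_of G V" let ?C = "{g \<in> carrier G. \<forall>x\<in>carrier G. cj G g x \<in> ?B}"
  have B: "subgroup ?B G" by (rule normalizer_of_subgroup[OF Vc])
  have nC: "?C \<lhd> G" by (rule core_normal[OF B])
  note sC = normal_imp_subgroup[OF nC]
  have "prime_factors (order G div card ?C) \<subseteq> s"
  proof
    fix p assume p: "p \<in> prime_factors (order G div card ?C)"
    show "p \<in> s"
    proof (rule ccontr)
      assume ps: "p \<notin> s"
      obtain t where t: "t \<in> \<sigma>" "p \<in> t"
        using sigma_partition_cover[OF \<sigma> in_prime_factors_imp_prime[OF p]] by blast
      then have st: "s \<subseteq> - t" using sigma_partition_disjoint[OF \<sigma> s t(1)] ps by blast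
      obtain H where H: "hall_sigma_subgroup t G H"
        and perm: "\<And>x. x \<in> carrier G \<Longrightarrow> V <#> conj_set G H x = conj_set G H x <#> V"
        using qn t(1) unfolding sigma_quasinormal_iff[OF \<sigma>] by blast
      note h = hall_subgroupD[OF H]
      have "H \<subseteq> ?C"
      proof
        fix g assume g: "g \<in> H"
        have gc: "g \<in> carrier G" by (rule subgroup.mem_carrier[OF h(1) g])
        have "cj G g x \<in> ?B" if x: "x \<in> carrier G" for x
        proof -
          let ?H = "conj_set G H x" and ?g = "cj G g x"
          note h' = hall_subgroupD[OF hall_conj[OF H x]]
          have gH: "?g \<in> ?H" using conj_set_eq_image[OF subgroup.subset[OF h(1)] x] g by simp
          have gc': "?g \<in> carrier G" using gc x by simp
          have VH: "subgroup (V <#> ?H) G" by (rule set_mult_subgroup[OF V(1) h'(1) perm[OF x]])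
          have "cj G w ?g \<in> V" if w: "w \<in> V" for w
          proof -
            have wc: "w \<in> carrier G" using Vc w by blast
            have "inv ?g \<otimes> w \<in> ?H <#> V" by (rule set_mult_memI[OF subgroup.m_inv_closed[OF h'(1) gH] w])
            then have 1: "inv ?g \<otimes> w \<in> V <#> ?H" using perm[OF x] by simp
            have "\<one> \<otimes> ?g \<in> V <#> ?H" by (rule set_mult_memI[OF subgroup.one_closed[OF V(1)] gH])
            then have "inv ?g \<otimes> w \<otimes> ?g \<in> V <#> ?H" using subgroup.m_closed[OF VH 1] gc' by simp
            then obtain a b where ab: "a \<in> V" "b \<in> ?H" "inv ?g \<otimes> w \<otimes> ?g = a \<otimes> b" by (rule set_mult_memE)
            have c: "a \<in> carrier G" "b \<in> carrier G" using Vc ab(1) subgroup.mem_carrier[OF h'(1) ab(2)] by auto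
            have e: "cj G w ?g = a \<otimes> b" using ab(3) unfolding cj_def[of G w] .
            have "cj G w ?g \<in> M" using M(1) V(3) w gc' unfolding normal_iff_cj by blast
            moreover have "b = inv a \<otimes> cj G w ?g" unfolding e using c by (simp add: word_simps)
            moreover have "inv a \<in> M" using subgroup.m_inv_closed[OF sM] ab(1) V(3) by blast
            ultimately have "b \<in> M" using subgroup.m_closed[OF sM] by blast
            \<comment> \<open>A \<open>t\<close>-element of \<open>M\<close> with \<open>t\<close>
              disjoint from \<open>s\<close> lies in \<open>K\<close>, as \<open>K\<close> has
              \<open>s\<close>-index in \<open>M\<close>. So the factor \<open>b\<close> from
              \<open>?H\<close> belongs to \<open>V\<close>.\<close>
            then have "pi_elt (G\<lparr>carrier := M\<rparr>) t b"
              using pi_elt_subgroup[OF sM] pi_elt_mem_subgroup[OF h'(1,2) ab(2)] by blast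
            then have "b \<in> K"
              by (rule M.normal_contains_coprime[OF KM]) (use M(2) st in \<open>simp add: order_def; blast\<close>)
            then show ?thesis unfolding e using subgroup.m_closed[OF V(1) ab(1)] V(2) by blast
          qed
          then show ?thesis unfolding normalizer_of_def using gc' by blast
        qed
        then show "g \<in> ?C" using gc by blast
      qed
      then have "order G div card ?C dvd order G div card H"
        using index_dvd_index[OF card_subgroup_mono_dvd[OF h(1) sC] card_subgroup_dvd[OF sC] card_subgroup_pos[OF sC]] by blast
      then have "p \<in> prime_factors (order G div card H)"
        using p prime_factors_mono_dvd[of "order G div card ?C" "order G div card H"] index_pos[OF h(1)] by blast
      then show False using h(3) t(2) by blast
    qed
  qed
  then have "y \<in> ?C" using normal_contains_coprime[OF nC y] by simp
  then have "cj G y \<one> \<in> ?B" using one_closed by blast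
  then have "y \<in> ?B" using pi_elt_carrier[OF y] by simp
  then show ?thesis using v unfolding normalizer_of_def by blast
qed

text \<open>Suppose the center N of D is proper and L/N is a chief factor of G inside D; it is an
  s-group for some class s. A Hall s-subgroup R of L satisfies L = RN with N central in L, so R is
  normal in L and then in G. By \<open>cen\<close> it centralises D, so L is contained in N, a
  contradiction.\<close>

lemma residual_abelian:
  assumes \<sigma>: "sigma_partition \<sigma>" and sol: "sigma_soluble \<sigma> G"
    and hall: "\<And>s. s \<in> \<sigma> \<Longrightarrow> \<exists>H. hall_sigma_subgroup s G H"
    and D: "D \<lhd> G"
    and cen: "\<And>s M g m. s \<in> \<sigma> \<Longrightarrow> M \<lhd> G \<Longrightarrow> prime_factors (card M) \<subseteq> s \<Longrightarrow> g \<in> D \<Longrightarrow> m \<in> M \<Longrightarrow> m \<otimes> g = g \<otimes> m"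
    and a: "a \<in> D" and b: "b \<in> D"
  shows "a \<otimes> b = b \<otimes> a"
proof -
  note sD = normal_imp_subgroup[OF D]
  note Dc = subgroup.mem_carrier[OF sD]
  define N where "N = {d \<in> D. \<forall>g\<in>D. d \<otimes> g = g \<otimes> d}"
  have Neq: "N = D \<inter> \<Inter>((\<lambda>g. normalizer_of G {g}) ` D)"
    unfolding N_def using Dc by (auto simp: mem_normalizer_singleton cj_eq_iff_commute)
  have sN: "subgroup N G"
  proof -
    have "subgroup (\<Inter>(insert D ((\<lambda>g. normalizer_of G {g}) ` D))) G"
      by (rule subgroups_Inter) (use sD Dc normalizer_of_subgroup in auto)
    then show ?thesis unfolding Neq by simp
  qed
  have N: "N \<lhd> G" unfolding normal_iff_cj
  proof (intro conjI ballI sN)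
    fix x d assume x: "x \<in> carrier G" and d: "d \<in> N"
    have dD: "d \<in> D" using d unfolding N_def by blast
    have "cj G d x \<otimes> g = g \<otimes> cj G d x" if g: "g \<in> D" for g
    proof -
      have "cj G g (inv x) \<in> D" using D g x unfolding normal_iff_cj by simp
      then have "d \<otimes> cj G g (inv x) = cj G g (inv x) \<otimes> d" using d unfolding N_def by blast
      then have "cj G (d \<otimes> cj G g (inv x)) x = cj G (cj G g (inv x) \<otimes> d) x" by simp
      then show ?thesis using Dc[OF g] Dc[OF dD] x by (simp add: cj_mult)
    qed
    then show "cj G d x \<in> N" unfolding N_def using D dD x unfolding normal_iff_cj by blast
  qed
  have "N = D"
  proof (rule ccontr)
    assume "N \<noteq> D"
    then have ND: "N \<subset> D" unfolding N_def by blast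
    let ?P = "\<lambda>L. L \<lhd> G \<and> N \<subset> L \<and> L \<subseteq> D"
    have "?P D" using D ND by blast
    from ex_has_least_nat[where P = ?P and m = card, OF this]
    \<comment> \<open>Least cardinality among the normal subgroups strictly above \<open>N\<close>
      in \<open>D\<close> makes \<open>L\<close> over \<open>N\<close> a chief factor.\<close>
    obtain L where L: "L \<lhd> G" "N \<subset> L" "L \<subseteq> D" and least: "\<And>L'. ?P L' \<Longrightarrow> card L \<le> card L'" by blast
    note sL = normal_imp_subgroup[OF L(1)]
    have "chief_factor G L N" unfolding chief_factor_def
    proof (intro conjI allI impI N L(1,2))
      fix N' assume N': "N' \<lhd> G \<and> N \<subseteq> N' \<and> N' \<subseteq> L"
      show "N' = N \<or> N' = L"
      proof (rule disjCI)
        assume "N' \<noteq> L"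
        show "N' = N"
        proof (rule ccontr)
          assume "N' \<noteq> N"
          then have "card L \<le> card N'" using least[of N'] N' L(3) by blast
          then have "N' = L" using card_seteq[OF finite_subgroup[OF sL]] N' by blast
          then show False using \<open>N' \<noteq> L\<close> by blast
        qed
      qed
    qed
    then have prim: "sigma_primary \<sigma> ((G\<lparr>carrier := L\<rparr>) Mod N)" using sol unfolding sigma_soluble_def by blast
    interpret L: fin_group "G\<lparr>carrier := L\<rparr>" by (rule fin_group_subgroup[OF sL])
    have NL: "N \<lhd> G\<lparr>carrier := L\<rparr>" by (rule normal_restrict_supergroup[OF sL N]) (use L in blast)
    let ?k = "order (G\<lparr>carrier := L\<rparr>) div card N"
    have k1: "?k \<noteq> 1"
    proof
      assume "?k = 1"
      then have "card L = card N" using L.order_eq_index[OF normal_imp_subgroup[OF NL]] by (simp add: order_def)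
      then show False using L(2) psubset_card_mono[OF finite_subgroup[OF sL] L(2)] by simp
    qed
    obtain p where p: "prime p" "p dvd ?k" using prime_factor_nat[OF k1] by blast
    have kpos: "0 < ?k" by (rule L.index_pos[OF normal_imp_subgroup[OF NL]])
    obtain s where s: "s \<in> \<sigma>" "p \<in> s" using sigma_partition_cover[OF \<sigma> p(1)] by blast
    have so: "s \<in> sigma_of \<sigma> ?k" using s p kpos unfolding sigma_of_iff by (auto simp: prime_factors_dvd)
    have ks: "prime_factors ?k \<subseteq> s"
    proof
      fix r assume r: "r \<in> prime_factors ?k"
      obtain t where t: "t \<in> \<sigma>" "r \<in> t"
        using sigma_partition_cover[OF \<sigma> in_prime_factors_imp_prime[OF r]] by blast
      have "t \<in> sigma_of \<sigma> ?k" using t r unfolding sigma_of_iff by blast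
      moreover have "card (sigma_of \<sigma> ?k) \<le> 1" using prim unfolding sigma_primary_def L.order_Mod[OF NL] .
      ultimately have "t = s" using so finite_sigma_of[OF \<sigma>] by (metis card_le_Suc0_iff_eq One_nat_def)
      then show "r \<in> s" using t by blast
    qed
    obtain Q where Q: "hall_sigma_subgroup s G Q" using hall[OF s(1)] by blast
    let ?R = "Q \<inter> L"
    have HR: "hall_sigma_subgroup s (G\<lparr>carrier := L\<rparr>) ?R" by (rule hall_Int_normal[OF Q L(1)])
    note hR = L.hall_subgroupD[OF HR]
    have RN: "?R <#> N = L" using L.hall_times_normal[OF HR NL ks] by simp
    have Ncomm: "n \<otimes> g = g \<otimes> n" if "n \<in> N" "g \<in> L" for n g using that L(3) unfolding N_def by blast
    have RG: "subgroup ?R G" by (rule incl_subgroup[OF sL hR(1)])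
    have nRL: "?R \<lhd> G\<lparr>carrier := L\<rparr>" unfolding L.normal_iff_cj
    proof (intro conjI ballI hR(1))
      fix x r assume "x \<in> carrier (G\<lparr>carrier := L\<rparr>)" and r: "r \<in> ?R"
      then have xL: "x \<in> L" by simp
      then have "x \<in> ?R <#> N" using RN by simp
      then obtain r' n where rn: "r' \<in> ?R" "n \<in> N" "x = r' \<otimes> n" by (rule set_mult_memE)
      have c: "r \<in> carrier G" "r' \<in> carrier G" "n \<in> carrier G"
        using subgroup.mem_carrier[OF RG] subgroup.mem_carrier[OF sN] r rn by auto
      have rr: "cj G r r' \<in> ?R" unfolding cj_def
        using subgroup.m_closed[OF RG] subgroup.m_inv_closed[OF RG] r rn(1) by simp
      have "cj G r x = cj G (cj G r r') n" unfolding rn(3) using c by (simp add: cj_cj)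
      also have "\<dots> = cj G r r'" using cj_eq_iff_commute[of "cj G r r'" n] c Ncomm[OF rn(2), of "cj G r r'"] rr by simp
      finally show "cj (G\<lparr>carrier := L\<rparr>) r x \<in> ?R" using rr cj_subgroup[OF sL xL] by simp
    qed
    have "?R \<lhd> G" unfolding normal_iff_cj
    proof (intro conjI ballI RG)
      fix x r assume x: "x \<in> carrier G" and r: "r \<in> ?R"
      have "cj G r x \<in> L" using L(1) x r unfolding normal_iff_cj by blast
      moreover have "pi_elt G s (cj G r x)" by (rule pi_elt_cj[OF pi_elt_mem_subgroup[OF RG hR(2) r] x])
      ultimately have "pi_elt (G\<lparr>carrier := L\<rparr>) s (cj G r x)" using pi_elt_subgroup[OF sL] by blast
      then show "cj G r x \<in> ?R" by (rule L.normal_hall_mem[OF HR nRL])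
    qed
    then have Rcomm: "r \<otimes> g = g \<otimes> r" if "r \<in> ?R" "g \<in> D" for r g using cen[OF s(1) _ hR(2)] that by blast
    have "L \<subseteq> N"
    proof
      fix l assume lL: "l \<in> L"
      then have "l \<in> ?R <#> N" using RN by simp
      then obtain r n where rn: "r \<in> ?R" "n \<in> N" "l = r \<otimes> n" by (rule set_mult_memE)
      have "l \<otimes> g = g \<otimes> l" if g: "g \<in> D" for g
      proof -
        have c: "r \<in> carrier G" "n \<in> carrier G" "g \<in> carrier G"
          using subgroup.mem_carrier[OF RG] subgroup.mem_carrier[OF sN] rn Dc[OF g] by auto
        have "n \<otimes> g = g \<otimes> n" using rn(2) g unfolding N_def by blast
        then have "l \<otimes> g = r \<otimes> g \<otimes> n" unfolding rn(3) using c by (simp add: m_assoc)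
        also have "\<dots> = g \<otimes> l" unfolding rn(3) Rcomm[OF rn(1) g] using c by (simp add: m_assoc)
        finally show ?thesis .
      qed
      then show "l \<in> N" unfolding N_def using lL L(3) by blast
    qed
    then show False using L(2) by blast
  qed
  then show ?thesis using a b unfolding N_def by blast
qed

end

text \<open>\<open>PsigmaT_normalizes\<close> is applied in the source group, with the preimages of
  the trivial group, of the cyclic group of \<open>v\<close> and of \<open>M\<close>;
  \<open>y\<close> is lifted to a \<open>- s\<close>-element.\<close>

lemma (in fin_epi) PsigmaT_power_action:
  assumes \<sigma>: "sigma_partition \<sigma>" and P: "PsigmaT_group \<sigma> G"
    and hall: "\<And>s. s \<in> \<sigma> \<Longrightarrow> \<exists>A. hall_sigma_subgroup s G A" and s: "s \<in> \<sigma>"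
    and M: "M \<lhd> H" "prime_factors (card M) \<subseteq> s"
  shows "power_action H s M"
proof (rule power_action.intro[OF H.fin_group_axioms power_action_axioms.intro[OF M]])
  fix v y assume v: "v \<in> M" and y: "pi_elt H (- s) y"
  have vc: "v \<in> carrier H" using v subgroup.mem_carrier[OF normal_imp_subgroup[OF M(1)]] by blast
  let ?pre = "\<lambda>B. {x \<in> carrier G. h x \<in> B}"
  let ?V = "range (\<lambda>n::nat. v [^]\<^bsub>H\<^esub> n)"
  have V: "subgroup ?V H" by (rule H.powers_subgroup[OF vc])
  have VM: "?V \<subseteq> M" using H.subgroup_pow_closed[OF normal_imp_subgroup[OF M(1)] v] by blast
  obtain x where x: "x \<in> carrier G" "h x = v" using vc unfolding surj[symmetric] by blast
  obtain y' where y': "pi_elt G (- s) y'" "h y' = y" by (rule pi_elt_lift[OF y])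
  have vV: "v \<in> ?V" using vc by (intro image_eqI[of _ _ 1]) auto
  have K: "?pre {\<one>\<^bsub>H\<^esub>} \<lhd> G" by (rule vimage_normal[OF H.one_is_normal])
  have pos: "0 < card (?pre {\<one>\<^bsub>H\<^esub>})" by (rule G.card_subgroup_pos[OF normal_imp_subgroup[OF K]])
  have "cj G x y' \<in> ?pre ?V"
  proof (rule G.PsigmaT_normalizes[OF \<sigma> P hall s K vimage_normal[OF M(1)] _ vimage_subgroup[OF V] _ _ y'(1)])
    have "card (?pre M) = card M * card (?pre {\<one>\<^bsub>H\<^esub>})"
      using card_vimage[OF normal_imp_subgroup[OF M(1)]] by simp
    then show "prime_factors (card (?pre M) div card (?pre {\<one>\<^bsub>H\<^esub>})) \<subseteq> s" using M(2) pos by simp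
    show "?pre {\<one>\<^bsub>H\<^esub>} \<subseteq> ?pre ?V" using subgroup.one_closed[OF V] by auto
    show "?pre ?V \<subseteq> ?pre M" using VM by blast
    show "x \<in> ?pre ?V" using x vV by simp
  qed
  then have "cj H v y \<in> ?V" using cj_hom[OF x(1) pi_elt_carrier[OF y'(1)]] x y' by simp
  then show "\<exists>b::nat. cj H v y = v [^]\<^bsub>H\<^esub> b" by blast
qed


text \<open>The situation in the quotient by \<open>O_upper s G D\<close>, where \<open>M\<close> is
  the image of a Hall \<open>s\<close>-subgroup.\<close>

locale normal_hall_action = power_action +
  fixes \<sigma> :: "nat set set"
  assumes part: "sigma_partition \<sigma>" and s_mem: "s \<in> \<sigma>"
    and hall_M: "hall_sigma_subgroup s G M" and D_le_M: "sigma_comm \<sigma> G \<subseteq> M"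
begin

abbreviation D :: "'a set" where
  "D \<equiv> sigma_comm \<sigma> G"

definition Fix :: "'a set" where
  "Fix = {m \<in> M. \<forall>y. pi_elt G (- s) y \<longrightarrow> cj G m y = m}"

text \<open>By \<open>moved_elt\<close> this contains every element of \<open>M\<close> of moved
  prime power order, so it is the Hall subgroup of \<open>M\<close> for the moved primes. Centrality
  is built in to make closure under products immediate.\<close>

definition Mov :: "'a set" where
  "Mov = {m \<in> M. pi_elt G moved_primes m \<and> (\<forall>u\<in>M. u \<otimes> m = m \<otimes> u)}"

lemma D_sub: "subgroup D G"
  by (rule normal_imp_subgroup[OF sigma_comm_normal])

lemma Fix_normal: "Fix \<lhd> G"
  unfolding normal_iff_cj
proof (intro conjI ballI)
  show "subgroup Fix G"
  proof (rule subgroupI)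
    show "Fix \<subseteq> carrier G" unfolding Fix_def using M_carrier by blast
    have "\<one> \<in> Fix" unfolding Fix_def using subgroup.one_closed[OF M_sub] by (auto dest: pi_elt_carrier)
    then show "Fix \<noteq> {}" by blast
  qed (auto simp: Fix_def M_carrier cj_inv cj_mult pi_elt_carrier subgroup.m_inv_closed[OF M_sub] subgroup.m_closed[OF M_sub])
  fix x m assume x: "x \<in> carrier G" and "m \<in> Fix"
  then have m: "m \<in> M" "\<And>y. pi_elt G (- s) y \<Longrightarrow> cj G m y = m" unfolding Fix_def by auto
  have "cj G (cj G m x) y = cj G m x" if y: "pi_elt G (- s) y" for y
  proof -
    have yc: "y \<in> carrier G" by (rule pi_elt_carrier[OF y])
    let ?y = "cj G y (inv x)"
    have "cj G (cj G m x) y = cj G (cj G m x) (cj G ?y x)" using yc x by simp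
    also have "\<dots> = cj G (cj G m ?y) x" by (rule cj_cj_cj[symmetric]) (use M_carrier[OF m(1)] yc x in auto)
    also have "cj G m ?y = m" using m(2)[OF pi_elt_cj[OF y]] x by simp
    finally show ?thesis .
  qed
  then show "cj G m x \<in> Fix" unfolding Fix_def using M_cj[OF m(1) x] by blast
qed

lemma Mov_normal: "Mov \<lhd> G"
  unfolding normal_iff_cj
proof (intro conjI ballI)
  show "subgroup Mov G"
  proof (rule subgroupI)
    show "Mov \<subseteq> carrier G" unfolding Mov_def using M_carrier by blast
    have "\<one> \<in> Mov" unfolding Mov_def using subgroup.one_closed[OF M_sub] M_carrier by auto
    then show "Mov \<noteq> {}" by blast
  next
    fix a assume "a \<in> Mov"
    then have a: "a \<in> M" "pi_elt G moved_primes a" "\<And>u. u \<in> M \<Longrightarrow> u \<otimes> a = a \<otimes> u" unfolding Mov_def by auto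
    have ac: "a \<in> carrier G" by (rule M_carrier[OF a(1)])
    have "u \<otimes> inv a = inv a \<otimes> u" if u: "u \<in> M" for u
      using a(3)[OF u] cj_eq_iff_commute[OF ac M_carrier[OF u]] cj_eq_iff_commute[of "inv a" u] ac M_carrier[OF u]
      by (simp add: cj_inv)
    then show "inv a \<in> Mov" unfolding Mov_def using subgroup.m_inv_closed[OF M_sub a(1)] pi_elt_inv[OF a(2)] by blast
    fix b assume "b \<in> Mov"
    then have b: "b \<in> M" "pi_elt G moved_primes b" "\<And>u. u \<in> M \<Longrightarrow> u \<otimes> b = b \<otimes> u" unfolding Mov_def by auto
    have bc: "b \<in> carrier G" by (rule M_carrier[OF b(1)])
    have "u \<otimes> (a \<otimes> b) = (a \<otimes> b) \<otimes> u" if u: "u \<in> M" for u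
    proof -
      have "u \<otimes> (a \<otimes> b) = a \<otimes> (u \<otimes> b)" using a(3)[OF u] ac bc M_carrier[OF u] by (simp flip: m_assoc)
      then show ?thesis using b(3)[OF u] ac bc M_carrier[OF u] by (simp add: m_assoc)
    qed
    then show "a \<otimes> b \<in> Mov" unfolding Mov_def
      using subgroup.m_closed[OF M_sub a(1) b(1)] pi_elt_mult_commute[OF a(2) b(2) b(3)[OF a(1)]] by blast
  qed
  fix x m assume x: "x \<in> carrier G" and "m \<in> Mov"
  then have m: "m \<in> M" "pi_elt G moved_primes m" "\<And>u. u \<in> M \<Longrightarrow> u \<otimes> m = m \<otimes> u" unfolding Mov_def by auto
  have "u \<otimes> cj G m x = cj G m x \<otimes> u" if u: "u \<in> M" for u
  proof -
    have "cj G (cj G u (inv x) \<otimes> m) x = cj G (m \<otimes> cj G u (inv x)) x"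
      using m(3)[OF M_cj[OF u, of "inv x"]] x by simp
    then show ?thesis using M_carrier[OF u] M_carrier[OF m(1)] x by (simp add: cj_mult)
  qed
  then show "cj G m x \<in> Mov" unfolding Mov_def using M_cj[OF m(1) x] pi_elt_cj[OF m(2) x] by blast
qed

lemmas Mov_sub = normal_imp_subgroup[OF Mov_normal]
lemmas Fix_sub = normal_imp_subgroup[OF Fix_normal]

text \<open>If one \<open>q\<close>-element is moved by \<open>y\<close>, then by
  \<open>moved_all\<close> so is every nontrivial one. Hence \<open>u\<close> is central in
  \<open>M\<close>, and it lies in \<open>D\<close> because its commutator with \<open>y\<close>
  does.\<close>

lemma moved_elt:
  assumes q: "q \<in> moved_primes" and u: "u \<in> M" "pi_elt G {q} u"
  shows "u \<in> Mov" "u \<in> D"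
proof -
  obtain v y where v: "v \<in> M" "pi_elt G {q} v" and y: "pi_elt G (- s) y" and mv: "cj G v y \<noteq> v"
    and pq: "prime q" by (rule moved_primesE[OF q])
  have "u \<in> Mov \<and> u \<in> D"
  proof (cases "u = \<one>")
    case True
    then show ?thesis using subgroup.one_closed[OF Mov_sub] subgroup.one_closed[OF D_sub] by simp
  next
    case False
    then have mu: "cj G u y \<noteq> u" using moved_all[OF v pq y mv u] by blast
    have "u \<in> Mov" unfolding Mov_def
      using u pi_elt_mono[OF u(2), of moved_primes] q moved_central[OF u pq y mu] by blast
    moreover have "u \<in> D"
      by (rule moved_mem[OF u pq y mu D_sub cm_mem_sigma_comm[OF s_mem M_pi_elt[OF u(1)] y]])
    ultimately show ?thesis by blast
  qed
  then show "u \<in> Mov" "u \<in> D" by auto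
qed

lemma Mov_Fix: "Mov <#> Fix = M"
proof
  note sm = set_mult_normal_subgroup[OF Fix_normal Mov_sub]
  show "Mov <#> Fix \<subseteq> M"
  proof
    fix x assume "x \<in> Mov <#> Fix"
    then obtain a b where "a \<in> Mov" "b \<in> Fix" "x = a \<otimes> b" by (rule set_mult_memE)
    then show "x \<in> M" using subgroup.m_closed[OF M_sub, of a b] unfolding Mov_def Fix_def by blast
  qed
  show "M \<subseteq> Mov <#> Fix"
  proof
    fix m assume m: "m \<in> M"
    show "m \<in> Mov <#> Fix"
    proof (rule prime_parts_mem[OF sm(1) M_carrier[OF m]])
      fix p and k :: nat assume p: "prime p" and pk: "pi_elt G {p} (m [^] k)"
      have mM: "m [^] k \<in> M" by (rule subgroup_pow_closed[OF M_sub m])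
      show "m [^] k \<in> Mov <#> Fix"
      proof (cases "p \<in> moved_primes")
        case True
        then show ?thesis using moved_elt(1)[OF True mM pk] sm(2) by blast
      next
        case False
        then have "m [^] k \<in> Fix" unfolding Fix_def using mM pk p unfolding moved_primes_def by blast
        then show ?thesis using sm(3) by blast
      qed
    qed
  qed
qed

lemma Mov_Int_Fix: "Mov \<inter> Fix = {\<one>}"
proof
  show "Mov \<inter> Fix \<subseteq> {\<one>}"
  proof
    fix m assume m: "m \<in> Mov \<inter> Fix"
    have mM: "m \<in> M" and mp: "pi_elt G moved_primes m" using m unfolding Mov_def by auto
    show "m \<in> {\<one>}"
    proof (rule prime_parts_mem[OF triv_subgroup M_carrier[OF mM]])
      fix p and k :: nat assume p: "prime p" and pk: "pi_elt G {p} (m [^] k)"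
      show "m [^] k \<in> {\<one>}"
      proof (cases "p \<in> moved_primes")
        case True
        obtain v y where v: "v \<in> M" "pi_elt G {p} v" and y: "pi_elt G (- s) y" and mv: "cj G v y \<noteq> v"
          by (rule moved_primesE[OF True])
        have "m [^] k \<in> Fix" using subgroup_pow_closed[OF Fix_sub] m by blast
        then have "cj G (m [^] k) y = m [^] k" using y unfolding Fix_def by blast
        then show ?thesis using moved_all[OF v p y mv subgroup_pow_closed[OF M_sub mM] pk] by simp
      next
        case False
        then show ?thesis using pi_elt_disjoint[OF pk pi_elt_pow[OF mp, of k]] by simp
      qed
    qed
  qed
  show "{\<one>} \<subseteq> Mov \<inter> Fix" using subgroup.one_closed[OF Mov_sub] subgroup.one_closed[OF Fix_sub] by simp
qed

text \<open>Write x as zc with z in \<open>Mov\<close> and c fixed by y; since z is central in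
  \<open>M\<close>, [x, y] reduces to [z, y].\<close>

lemma cm_mem_Mov:
  assumes x: "x \<in> M" and y: "pi_elt G (- s) y"
  shows "cm G x y \<in> Mov"
proof -
  have yc: "y \<in> carrier G" by (rule pi_elt_carrier[OF y])
  have "x \<in> Mov <#> Fix" using x Mov_Fix by simp
  then obtain z c where zc: "z \<in> Mov" "c \<in> Fix" "x = z \<otimes> c" by (rule set_mult_memE)
  have cM: "c \<in> M" "cj G c y = c" using zc(2) y unfolding Fix_def by auto
  have zy: "cj G z y \<in> Mov" using Mov_normal zc(1) yc unfolding normal_iff_cj by blast
  have w: "inv z \<otimes> cj G z y \<in> Mov"
    by (rule subgroup.m_closed[OF Mov_sub subgroup.m_inv_closed[OF Mov_sub zc(1)] zy])
  have c: "z \<in> carrier G" "c \<in> carrier G" "cj G z y \<in> carrier G"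
    using subgroup.mem_carrier[OF Mov_sub zc(1)] M_carrier[OF cM(1)] yc by auto
  have "cm G x y = inv c \<otimes> ((inv z \<otimes> cj G z y) \<otimes> c)"
    unfolding cm_def zc(3) cj_mult[OF c(1,2) yc] cM(2) using c by (simp add: word_simps)
  also have "(inv z \<otimes> cj G z y) \<otimes> c = c \<otimes> (inv z \<otimes> cj G z y)" using w cM(1) unfolding Mov_def by simp
  also have "inv c \<otimes> (c \<otimes> (inv z \<otimes> cj G z y)) = inv z \<otimes> cj G z y" using c by (simp add: inv_m_cancel)
  finally show ?thesis using w by simp
qed

text \<open>For generators of another class x is a \<open>- s\<close>-element, and y is split into
  its \<open>s\<close>- and \<open>- s\<close>-parts. The first part is covered by
  \<open>cm_mem_Mov\<close>. For the second, w = [x, z] lies in D and so is an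
  \<open>s\<close>-element of \<open>M\<close>; since [x, w] is in \<open>Mov\<close> and xw = x^z,
  the coprime argument modulo \<open>Mov\<close> yields w.\<close>

lemma D_le_Mov: "D \<subseteq> Mov"
proof (rule sigma_comm_minimal[OF Mov_sub])
  fix t x y assume t: "t \<in> \<sigma>" and x: "pi_elt G t x" and y: "pi_elt G (- t) y"
  have xc: "x \<in> carrier G" and yc: "y \<in> carrier G" using x y by (auto dest: pi_elt_carrier)
  show "cm G x y \<in> Mov"
  proof (cases "t = s")
    case True
    have "x \<in> M" using normal_hall_mem[OF hall_M M_normal] x True by simp
    then show ?thesis using cm_mem_Mov y True by simp
  next
    case False
    then have "t \<subseteq> - s" using sigma_partition_disjoint[OF part s_mem t] by blast
    then have xs: "pi_elt G (- s) x" by (rule pi_elt_mono[OF x])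
    show ?thesis
    proof (rule ex_part_exponent[of s])
      fix k l :: nat
      assume kl: "\<And>x. x \<in> carrier G \<Longrightarrow> x = x [^] k \<otimes> x [^] l"
        "\<And>x. x \<in> carrier G \<Longrightarrow> pi_elt G s (x [^] k)" "\<And>x. x \<in> carrier G \<Longrightarrow> pi_elt G (- s) (x [^] l)"
      let ?y = "y [^] k" and ?z = "y [^] l"
      have c: "?y \<in> carrier G" "?z \<in> carrier G" using yc by auto
      have "?y \<in> M" by (rule normal_hall_mem[OF hall_M M_normal kl(2)[OF yc]])
      then have "cm G ?y x \<in> Mov" by (rule cm_mem_Mov[OF _ xs])
      then have "cm G x ?y \<in> Mov" using subgroup.m_inv_closed[OF Mov_sub] cm_inv[OF c(1) xc] by metis
      then have 1: "cj G (cm G x ?y) ?z \<in> Mov" using Mov_normal c(2) unfolding normal_iff_cj by blast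
      let ?w = "cm G x ?z"
      have "?w \<in> D" by (rule cm_mem_sigma_comm[OF t x pi_elt_pow[OF y]])
      then have wM: "?w \<in> M" using D_le_M by blast
      have wc: "?w \<in> carrier G" by (rule M_carrier[OF wM])
      have "inv (cm G ?w x) \<in> Mov" by (rule subgroup.m_inv_closed[OF Mov_sub cm_mem_Mov[OF wM xs]])
      then have c3: "cm G x ?w \<in> Mov" using cm_inv[OF wc xc] by simp
      obtain n where n: "0 < n" "prime_factors n \<subseteq> - s" "x [^] (n::nat) = \<one>" using xs unfolding pi_elt_def by blast
      have "(x \<otimes> ?w) [^] n = cj G x ?z [^] n" using cj_eq_cm[OF xc c(2)] by simp
      also have "\<dots> = \<one>" using cj_pow[OF xc c(2), of n, symmetric] n(3) c(2) by simp
      finally have "?w [^] n \<in> Mov"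
        using pow_commute_mod[OF Mov_normal xc wc c3, of n] n(3) subgroup.one_closed[OF Mov_sub] by simp
      then have 2: "?w \<in> Mov" by (rule pi_elt_pow_mem[OF Mov_sub M_pi_elt[OF wM] _ n(1,2)])
      have "cm G x (?y \<otimes> ?z) \<in> Mov"
        unfolding cm_mult_right[OF xc c] by (rule subgroup.m_closed[OF Mov_sub 2 1])
      then show ?thesis using kl(1)[OF yc] by simp
    qed
  qed
qed

lemma Mov_eq_D: "Mov = D"
proof
  show "Mov \<subseteq> D"
  proof
    fix m assume m: "m \<in> Mov"
    then have mM: "m \<in> M" and mp: "pi_elt G moved_primes m" unfolding Mov_def by auto
    show "m \<in> D"
    proof (rule prime_parts_mem[OF D_sub M_carrier[OF mM]])
      fix p and k :: nat assume p: "prime p" and pk: "pi_elt G {p} (m [^] k)"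
      show "m [^] k \<in> D"
      proof (cases "p \<in> moved_primes")
        case True
        then show ?thesis by (rule moved_elt(2)[OF _ subgroup_pow_closed[OF M_sub mM] pk])
      next
        case False
        then have "m [^] k = \<one>" using pi_elt_disjoint[OF pk pi_elt_pow[OF mp, of k]] by simp
        then show ?thesis using subgroup.one_closed[OF D_sub] by simp
      qed
    qed
  qed
qed (rule D_le_Mov)

lemma prime_factors_D: "prime_factors (card D) \<subseteq> moved_primes"
  by (rule prime_factors_card_subgroupI[OF D_sub]) (simp add: Mov_eq_D[symmetric] Mov_def)

lemma D_contains:
  assumes q: "q \<in> prime_factors (card D)" and x: "pi_elt G {q} x"
  shows "x \<in> D"
proof -
  have qm: "q \<in> moved_primes" using q prime_factors_D by blast
  then have "q \<in> s" by (rule moved_primesE)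
  then have "x \<in> M" using normal_hall_mem[OF hall_M M_normal pi_elt_mono[OF x, of s]] by simp
  then show ?thesis by (rule moved_elt(2)[OF qm _ x])
qed

lemma D_odd: "2 \<notin> prime_factors (card D)"
  using prime_factors_D two_not_moved by blast

lemma hall_D: "hall_subgroup G D"
  by (rule hall_subgroupI[OF D_sub D_contains])

text \<open>\<open>M\<close> centralises \<open>D\<close>, which equals \<open>Mov\<close>, and the
  \<open>- s\<close>-elements act by powers; together they leave no room in the index of the
  normalizer.\<close>

lemma D_subgroups_normal:
  assumes V: "subgroup V G" "V \<subseteq> D"
  shows "V \<lhd> G"
proof -
  note h = hall_subgroupD[OF hall_M]
  have VM: "V \<subseteq> M" using V(2) D_le_M by blast
  have "normalizer_of G V = carrier G"
  proof (rule subgroup_eq_carrierI[OF normalizer_of_subgroup[OF subgroup.subset[OF V(1)]] h(1) _ h(3)])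
    show "M \<subseteq> normalizer_of G V"
    proof
      fix m assume m: "m \<in> M"
      have "cj G v m = v" if v: "v \<in> V" for v
      proof -
        have "v \<in> Mov" using v V(2) Mov_eq_D by blast
        then have "v \<otimes> m = m \<otimes> v" using m unfolding Mov_def by simp
        then show ?thesis using cj_eq_iff_commute[OF subgroup.mem_carrier[OF V(1) v] M_carrier[OF m]] by simp
      qed
      then show "m \<in> normalizer_of G V" unfolding normalizer_of_def using M_carrier[OF m] by simp
    qed
    fix y assume y: "pi_elt G (- s) y"
    have "cj G v y \<in> V" if v: "v \<in> V" for v
    proof -
      obtain b :: nat where "cj G v y = v [^] b" using power[OF _ y] VM v by blast
      then show ?thesis using subgroup_pow_closed[OF V(1) v] by simp
    qed
    then show "y \<in> normalizer_of G V" unfolding normalizer_of_def using pi_elt_carrier[OF y] by simp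
  qed
  then show ?thesis by (rule normal_if_normalizer[OF V(1)])
qed

lemma special:
  assumes res: "sigma_nilp_residual \<sigma> G = D"
  shows "special_PsigmaT_group \<sigma> G"
  unfolding special_PsigmaT_group_def res
proof (rule bexI[OF _ s_mem], rule exI[of _ M], intro exI[of _ Fix] conjI ballI hall_M D_le_M hall_D)
  show "induces_power_aut G g D" if g: "g \<in> carrier G" for g
    unfolding induces_power_aut_def using power_aut_of_normal[OF D_subgroups_normal _] g by blast
  show "Fix \<lhd> G\<lparr>carrier := M\<rparr>"
    by (rule normal_restrict_supergroup[OF M_sub Fix_normal]) (auto simp: Fix_def)
  show "D \<inter> Fix = {\<one>}" using Mov_Int_Fix Mov_eq_D by simp
  show "D <#> Fix = M" using Mov_Fix Mov_eq_D by simp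
qed

end

section \<open>Transfer from the quotients back to G\<close>

context fin_group
begin

text \<open>Each claim about D is reduced to one prime q at a time and read off in the quotient by
  the subgroup \<open>O_upper s G D\<close> for the class s of q. Nothing about q is lost there,
  since the order of the kernel is prime to s.\<close>

lemma PsigmaT_only_if:
  assumes \<sigma>: "sigma_partition \<sigma>" and sol: "sigma_soluble \<sigma> G"
    and hall: "\<And>s. s \<in> \<sigma> \<Longrightarrow> \<exists>H. hall_sigma_subgroup s G H"
    and D_def: "D = sigma_nilp_residual \<sigma> G" and P: "PsigmaT_group \<sigma> G"
  shows "comm_group (G\<lparr>carrier := D\<rparr>)" "hall_subgroup G D" "odd (card D)"
    "\<And>g. g \<in> carrier G \<Longrightarrow> induces_power_aut G g D"
    "\<And>s. s \<in> sigma_of \<sigma> (card D) \<Longrightarrow> special_PsigmaT_group \<sigma> (G Mod (O_upper s G D))"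
proof -
  have D': "D = sigma_comm \<sigma> G" unfolding D_def by (rule sigma_nilp_residual_eq[OF \<sigma> hall])
  have nD: "D \<lhd> G" unfolding D' by (rule sigma_comm_normal)
  note sD = normal_imp_subgroup[OF nD]
  \<comment> \<open>With the identity as epimorphism, the power action is available for normal
    subgroups of G itself, which \<open>residual_abelian\<close> asks for.\<close>
  have id: "fin_epi G G (\<lambda>x. x)"
    by (simp add: fin_epi_def fin_epi_axioms_def group_hom_def group_hom_axioms_def is_group fin hom_def)
  have ab: "a \<otimes> b = b \<otimes> a" if "a \<in> D" "b \<in> D" for a b
  proof (rule residual_abelian[OF \<sigma> sol hall nD _ that])
    fix s M g m assume s: "s \<in> \<sigma>" "M \<lhd> G" "prime_factors (card M) \<subseteq> s" and g: "g \<in> D" and m: "m \<in> M"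
    interpret power_action G s M by (rule fin_epi.PsigmaT_power_action[OF id \<sigma> P hall s])
    show "m \<otimes> g = g \<otimes> m"
      using sigma_comm_centralizes[OF \<sigma> s(1) _ m] g unfolding D' by blast
  qed
  show "comm_group (G\<lparr>carrier := D\<rparr>)"
    by (rule group.group_comm_groupI[OF subgroup_imp_group[OF sD]]) (simp add: ab)
  let ?K = "\<lambda>s. pi_part G (- s) D"
  have nK: "?K s \<lhd> G" for s by (rule pi_part_normal[OF nD ab])
  have epi: "fin_epi G (G Mod ?K s) ((#>) (?K s))" for s by (rule fin_epi_Mod[OF nK])
  have fD: "(#>) (?K s) ` D = sigma_comm \<sigma> (G Mod ?K s)" for s
    using fin_epi.image_sigma_comm[OF epi] unfolding D' .
  \<comment> \<open>The image of \<open>D\<close> is a normal \<open>s\<close>-subgroup, represented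
    by \<open>s\<close>-parts, so it lies in the image of any Hall \<open>s\<close>-subgroup, and
    this makes that image normal.\<close>
  have local: "\<exists>M. normal_hall_action (G Mod ?K s) s M \<sigma>" if s: "s \<in> \<sigma>" for s
  proof -
    interpret e: fin_epi G "G Mod ?K s" "(#>) (?K s)" by (rule epi)
    obtain Q where Q: "hall_sigma_subgroup s G Q" using hall[OF s] by blast
    let ?M = "(#>) (?K s) ` Q"
    have hM: "hall_sigma_subgroup s (G Mod ?K s) ?M" by (rule e.hall_image[OF Q])
    note h = e.H.hall_subgroupD[OF hM]
    have nfD: "(#>) (?K s) ` D \<lhd> G Mod ?K s" by (rule e.image_normal[OF nD])
    have "prime_factors (card ((#>) (?K s) ` D)) \<subseteq> s"
    proof (rule e.H.prime_factors_card_subgroupI[OF normal_imp_subgroup[OF nfD]])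
      fix z assume "z \<in> (#>) (?K s) ` D"
      then obtain d where d: "d \<in> D" "z = ?K s #> d" by blast
      obtain u v where uv: "u \<in> pi_part G s D" "v \<in> ?K s" "d = u \<otimes> v" by (rule pi_parts_product[OF sD d(1)])
      have u: "u \<in> D" "pi_elt G s u" and v: "v \<in> D" using uv(1,2) unfolding pi_part_def by auto
      have c: "u \<in> carrier G" "v \<in> carrier G" using subgroup.mem_carrier[OF sD] u v by auto
      have "?K s #> v = \<one>\<^bsub>G Mod ?K s\<^esub>" using rcos_eq_one_iff[OF nK c(2)] uv(2) by blast
      then have "z = ?K s #> u"
        unfolding d(2) uv(3) using e.hom_mult[OF c] e.H.r_one[OF e.hom_closed[OF c(1)]] by (simp only:)
      then show "pi_elt (G Mod ?K s) s z" using e.pi_elt_hom[OF u(2)] by simp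
    qed
    then have DM: "sigma_comm \<sigma> (G Mod ?K s) \<subseteq> ?M"
      unfolding fD[symmetric] by (rule e.H.normal_pi_subgroup_le[OF h(1,3) nfD])
    have nM: "?M \<lhd> G Mod ?K s" by (rule e.H.hall_normal_if_residual_le[OF s hM DM])
    have "power_action (G Mod ?K s) s ?M" by (rule e.PsigmaT_power_action[OF \<sigma> P hall s nM h(2)])
    then have "normal_hall_action (G Mod ?K s) s ?M \<sigma>"
      by (rule normal_hall_action.intro[OF _ normal_hall_action_axioms.intro[OF \<sigma> s hM DM]])
    then show ?thesis ..
  qed
  have qD: "q \<in> prime_factors (card ((#>) (?K s) ` D))" if q: "q \<in> prime_factors (card D)" "q \<in> s" for q s
  proof -
    interpret e: fin_epi G "G Mod ?K s" "(#>) (?K s)" by (rule epi)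
    have "{x \<in> D. ?K s #> x = \<one>\<^bsub>G Mod ?K s\<^esub>} = ?K s"
      using rcos_eq_one_iff[OF nK] subgroup.mem_carrier[OF sD] unfolding pi_part_def by blast
    then have "card D = card ((#>) (?K s) ` D) * card (?K s)"
      using e.card_subgroup_image_kernel[OF sD finite_subgroup[OF sD]] by simp
    moreover have "q \<notin> prime_factors (card (?K s))" using pi_part_prime_factors[OF sD ab, of "- s"] q(2) by blast
    ultimately show ?thesis using q(1) card_subgroup_pos[OF sD] prime_factors_mult_nat
      by (metis Un_iff gr0I mult_is_0 less_irrefl)
  qed
  have ex_s: "\<exists>s\<in>\<sigma>. q \<in> s" if "q \<in> prime_factors (card D)" for q
    using sigma_partition_cover[OF \<sigma> in_prime_factors_imp_prime[OF that]] .
  have contains: "x \<in> D" if q: "q \<in> prime_factors (card D)" and x: "pi_elt G {q} x" for q x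
  proof -
    obtain s where s: "s \<in> \<sigma>" "q \<in> s" using ex_s[OF q] by blast
    interpret e: fin_epi G "G Mod ?K s" "(#>) (?K s)" by (rule epi)
    obtain M where "normal_hall_action (G Mod ?K s) s M \<sigma>" using local[OF s(1)] ..
    then interpret l: normal_hall_action "G Mod ?K s" s M \<sigma> .
    \<comment> \<open>As \<open>?K s\<close> is contained in \<open>D\<close>, membership of
      \<open>x\<close> in \<open>D\<close> can be decided on its coset.\<close>
    have "?K s #> x \<in> (#>) (?K s) ` D"
      using l.D_contains[OF _ e.pi_elt_hom[OF x]] qD[OF q s(2)] unfolding fD by blast
    then obtain d where d: "d \<in> D" "?K s #> x = ?K s #> d" by blast
    have c: "x \<in> carrier G" "d \<in> carrier G" using pi_elt_carrier[OF x] subgroup.mem_carrier[OF sD d(1)] .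
    have "x \<in> ?K s #> d" using rcos_self[OF c(1) normal_imp_subgroup[OF nK]] d(2) by blast
    then obtain k where k: "k \<in> ?K s" "x = k \<otimes> d" unfolding r_coset_def by blast
    then show ?thesis using subgroup.m_closed[OF sD _ d(1), of k] unfolding pi_part_def by blast
  qed
  show "hall_subgroup G D" by (rule hall_subgroupI[OF sD contains])
  show "odd (card D)"
  proof
    assume "even (card D)"
    then have two: "2 \<in> prime_factors (card D)" using card_subgroup_pos[OF sD] by (simp add: prime_factors_dvd)
    obtain s where s: "s \<in> \<sigma>" "2 \<in> s" using ex_s[OF two] by blast
    obtain M where "normal_hall_action (G Mod ?K s) s M \<sigma>" using local[OF s(1)] ..
    then interpret l: normal_hall_action "G Mod ?K s" s M \<sigma> .
    show False using l.D_odd qD[OF two s(2)] unfolding fD by blast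
  qed
  have cj_prime: "\<exists>k::nat. cj G d g = d [^] k"
    if d: "d \<in> D" "pi_elt G {q} d" and q: "prime q" and g: "g \<in> carrier G" for d q g
  proof -
    obtain s where s: "s \<in> \<sigma>" "q \<in> s" using sigma_partition_cover[OF \<sigma> q] by blast
    interpret e: fin_epi G "G Mod ?K s" "(#>) (?K s)" by (rule epi)
    obtain M where "normal_hall_action (G Mod ?K s) s M \<sigma>" using local[OF s(1)] ..
    then interpret l: normal_hall_action "G Mod ?K s" s M \<sigma> .
    have dc: "d \<in> carrier G" by (rule subgroup.mem_carrier[OF sD d(1)])
    let ?V = "range (\<lambda>n::nat. d [^] n)" let ?W = "(#>) (?K s) ` ?V"
    have W: "subgroup ?W (G Mod ?K s)" by (rule e.subgroup_img_is_subgroup[OF powers_subgroup[OF dc]])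
    have "?V \<subseteq> D" using subgroup_pow_closed[OF sD d(1)] by blast
    then have "?W \<subseteq> (#>) (?K s) ` D" by blast
    then have nW: "?W \<lhd> G Mod ?K s" unfolding fD by (rule l.D_subgroups_normal[OF W])
    have "d \<in> ?V" using dc by (intro image_eqI[of _ _ 1]) auto
    then have "?K s #> d \<in> ?W" by (rule imageI)
    then have "cj (G Mod ?K s) (?K s #> d) (?K s #> g) \<in> ?W"
      using bspec[OF conjunct2[OF nW[unfolded e.H.normal_iff_cj]] e.hom_closed[OF g]] by (rule bspec[rotated])
    then have "?K s #> cj G d g \<in> ?W" using e.cj_hom[OF dc g] by (simp only:)
    then obtain k :: nat where k: "?K s #> cj G d g = ?K s #> d [^] k" by (elim imageE) simp
    have c: "cj G d g \<in> carrier G" "d [^] k \<in> carrier G" using dc g by auto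
    have cD: "cj G d g \<in> D" "d [^] k \<in> D" using nD d(1) g subgroup_pow_closed[OF sD d(1)] unfolding normal_iff_cj by auto
    have "cj G d g \<in> ?K s #> d [^] k" using rcos_self[OF c(1) normal_imp_subgroup[OF nK]] k by blast
    then obtain z where z: "z \<in> ?K s" "cj G d g = z \<otimes> d [^] k" unfolding r_coset_def by blast
    have zc: "z \<in> carrier G" by (rule subgroup.mem_carrier[OF normal_imp_subgroup[OF nK] z(1)])
    have "z = cj G d g \<otimes> inv (d [^] k)" unfolding z(2) using zc c(2) by (simp add: m_assoc)
    moreover have "pi_elt G {q} (cj G d g \<otimes> inv (d [^] k))"
      by (rule pi_elt_mult_commute[OF pi_elt_cj[OF d(2) g] pi_elt_inv[OF pi_elt_pow[OF d(2)]]])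
        (rule ab[OF cD(1) subgroup.m_inv_closed[OF sD cD(2)]])
    ultimately have "pi_elt G {q} z" by simp
    moreover have "pi_elt G (- s) z" using z(1) unfolding pi_part_def by blast
    \<comment> \<open>The equation in the quotient holds up to \<open>z\<close> in
      \<open>?K s\<close>. Since \<open>D\<close> is abelian, \<open>z\<close> is also a
      \<open>q\<close>-element, and \<open>q\<close> lies in \<open>s\<close>, so the equation lifts
      exactly.\<close>
    ultimately have "z = \<one>" using pi_elt_disjoint[of "{q}" z "- s"] s(2) by simp
    then show ?thesis using z(2) c(2) by auto
  qed
  have V_normal: "V \<lhd> G" if V: "subgroup V G" "V \<subseteq> D" for V
    unfolding normal_iff_cj
  proof (intro conjI ballI V(1))
    fix g v assume g: "g \<in> carrier G" and v: "v \<in> V"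
    let ?B = "{x \<in> carrier G. cj G x g \<in> V}"
    have "subgroup ?B G"
    proof (rule subgroupI)
      have "\<one> \<in> ?B" using subgroup.one_closed[OF V(1)] g by simp
      then show "?B \<noteq> {}" by blast
    qed (auto simp: g cj_inv cj_mult subgroup.m_inv_closed[OF V(1)] subgroup.m_closed[OF V(1)])
    \<comment> \<open>Different prime parts of \<open>v\<close> are handled in different quotients;
      they are put together because the elements that \<open>g\<close> conjugates into
      \<open>V\<close> form a subgroup.\<close>
    then have "v \<in> ?B"
    proof (rule prime_parts_mem[OF _ subgroup.mem_carrier[OF V(1) v]])
      fix p and k :: nat assume p: "prime p" and pk: "pi_elt G {p} (v [^] k)"
      have vV: "v [^] k \<in> V" by (rule subgroup_pow_closed[OF V(1) v])
      then have "v [^] k \<in> D" using V(2) by blast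
      from cj_prime[OF this pk p g] obtain j :: nat where "cj G (v [^] k) g = (v [^] k) [^] j" ..
      then show "v [^] k \<in> ?B"
        using subgroup_pow_closed[OF V(1) vV, of j] subgroup.mem_carrier[OF V(1) vV] by simp
    qed
    then show "cj G v g \<in> V" by blast
  qed
  show "induces_power_aut G g D" if g: "g \<in> carrier G" for g
    unfolding induces_power_aut_def using power_aut_of_normal[OF V_normal g] by simp
  show "special_PsigmaT_group \<sigma> (G Mod (O_upper s G D))" if s: "s \<in> sigma_of \<sigma> (card D)" for s
  proof -
    have s\<sigma>: "s \<in> \<sigma>" using s by (simp add: sigma_of_iff)
    interpret e: fin_epi G "G Mod ?K s" "(#>) (?K s)" by (rule epi)
    obtain M where "normal_hall_action (G Mod ?K s) s M \<sigma>" using local[OF s\<sigma>] ..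
    then interpret l: normal_hall_action "G Mod ?K s" s M \<sigma> .
    have "sigma_nilp_residual \<sigma> (G Mod ?K s) = sigma_comm \<sigma> (G Mod ?K s)"
      by (rule e.sigma_nilp_residual_image[OF \<sigma> hall])
    then have "special_PsigmaT_group \<sigma> (G Mod ?K s)" by (rule l.special)
    then show ?thesis using O_upper_eq[OF sD ab, of s] by simp
  qed
qed

end

theorem theoremC:
  fixes \<sigma> :: "nat set set" and G :: "('a, 'b) monoid_scheme" and D :: "'a set"
  assumes "sigma_partition \<sigma>"
    and "group G" and "finite (carrier G)"
    and "sigma_soluble \<sigma> G"
    and "\<exists>\<H>. generalized_wielandt_sigma_set \<sigma> G \<H>"
    and D_def: "D = sigma_nilp_residual \<sigma> G"
  shows "PsigmaT_group \<sigma> G \<longleftrightarrow>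
           ((comm_group (G\<lparr>carrier := D\<rparr>) \<and> hall_subgroup G D \<and> odd (card D) \<and>
             (\<forall>g\<in>carrier G. induces_power_aut G g D)) \<and>
            (\<forall>s\<in>sigma_of \<sigma> (card D). special_PsigmaT_group \<sigma> (G Mod (O_upper s G D))))"
proof -
  interpret fin_group G using assms(2,3) by (simp add: fin_group_def fin_group_axioms_def)
  obtain \<H> where \<H>: "complete_hall_sigma_set \<sigma> G \<H>"
    using assms(5) unfolding generalized_wielandt_sigma_set_def by blast
  note hall = hall_of_complete[OF \<H>]
  show ?thesis
    using PsigmaT_only_if[OF assms(1,4) hall D_def] PsigmaT_if[OF assms(1) hall D_def] by blast
qed

end
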